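(* Let $\Omega\subset\mathbb{R}^n$, $n\ge 3$, be a convex domain. The following conditions are equivalent. (i) The domain $\Omega$ is complete hyperbolic. (ii) For any open Riemann surface $M$, the family $\mathrm{CH}(M,\Omega)$ of conformal harmonic maps $M\to\Omega$ is a normal family. (In particular, $\Omega$ is taut, i.e. $\mathrm{CH}(\mathbb{D},\Omega)$ is a normal family.) (iii) The domain $\Omega$ is hyperbolic. (iv) The domain $\Omega$ does not contain any $2$-dimensional affine subspaces. (v) The domain $\Omega$ has $n-1$ linearly independent separating hyperplanes.
   Context: A domain is a nonempty connected open set. $\mathbb{D}=\{z=x+iy\in\mathbb{C}:|z|<1\}$. A $C^1$ map $f$ from an open subset of $\mathbb{R}^2=\mathbb{C}$ to $\mathbb{R}^n$ is conformal if $|f_x|=|f_y|$ and $f_x\cdot f_y=0$ at every point (it need not be an immersion); conformal maps from a Riemann surface $M$ are defined by the same condition in local holomorphic coordinates. $\mathrm{CH}(M,\Omega)$ denotes the set of all conformal harmonic maps $M\to\Omega$. An open Riemann surface is a connected noncompact Riemann surface. Minimal pseudometric: for $\mathbf{x}\in\Omega$, $\mathbf{v}\in\mathbb{R}^n$, $$g_\Omega(\mathbf{x},\mathbf{v})=\inf\{1/r>0:\exists f\in \mathrm{CH}(\mathbb{D},\Omega),\ f(0)=\mathbf{x},\ f_x(0)=r\mathbf{v}\}.$$ Minimal pseudodistance: $\rho_\Omega(\mathbf{x},\mathbf{y})=\inf_\gamma\int_0^1 g_\Omega(\gamma(t),\dot\gamma(t))\,dt$, the infimum over all piecewise smooth paths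 $\gamma:[0,1]\to\Omega$ from $\mathbf{x}$ to $\mathbf{y}$. $\Omega$ is hyperbolic if $\rho_\Omega(\mathbf{x},\mathbf{y})>0$ for any pair of distinct points of $\Omega$, and complete hyperbolic if moreover $(\Omega,\rho_\Omega)$ is a complete metric space. A sequence $(f_i)$ of continuous maps $M\to\Omega$ is compactly divergent if for any pair of compact sets $K\subset M$ and $K'\subset\Omega$, $f_i(K)\cap K'$ is empty for all but finitely many $i$. A family of continuous maps $M\to\Omega$ is normal if each sequence in it has a subsequence which either converges uniformly on compact sets in $M$ to a map $M\to\Omega$, or is compactly divergent. An affine hyperplane $\Sigma\subset\mathbb{R}^n$ is separating for $\Omega$ if $\Sigma\cap\Omega=\varnothing$ (so, $\Omega$ being connected, it lies in one of the two half-spaces of $\mathbb{R}^n\setminus\Sigma$). Hyperplanes are linearly independent if their normal vectors are linearly independent. *)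

theory Defs
  imports "HOL-Analysis.Analysis" "HOL-Library.Equipollence"
begin

definition partial_x :: "(complex \<Rightarrow> 'a::real_normed_vector) \<Rightarrow> complex \<Rightarrow> 'a" where
  "partial_x f z = frechet_derivative f (at z) 1"

definition partial_y :: "(complex \<Rightarrow> 'a::real_normed_vector) \<Rightarrow> complex \<Rightarrow> 'a" where
  "partial_y f z = frechet_derivative f (at z) \<i>"

text \<open>The set \<open>D\<close> is always open in what follows; differentiability is over the reals.\<close>

definition C1_map_on :: "complex set \<Rightarrow> (complex \<Rightarrow> 'a::real_normed_vector) \<Rightarrow> bool" where
  "C1_map_on D f \<longleftrightarrow> (\<forall>z\<in>D. f differentiable (at z)) \<and>
     continuous_on D (partial_x f) \<and> continuous_on D (partial_y f)"

definition C2_map_on :: "complex set \<Rightarrow> (complex \<Rightarrow> 'a::real_normed_vector) \<Rightarrow> bool" where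
  "C2_map_on D f \<longleftrightarrow>
     C1_map_on D f \<and> C1_map_on D (partial_x f) \<and> C1_map_on D (partial_y f)"

definition conformal_map_on :: "complex set \<Rightarrow> (complex \<Rightarrow> 'a::real_inner) \<Rightarrow> bool" where
  "conformal_map_on D f \<longleftrightarrow> C1_map_on D f \<and>
     (\<forall>z\<in>D. norm (partial_x f z) = norm (partial_y f z) \<and> partial_x f z \<bullet> partial_y f z = 0)"

definition harmonic_map_on :: "complex set \<Rightarrow> (complex \<Rightarrow> 'a::real_normed_vector) \<Rightarrow> bool" where
  "harmonic_map_on D f \<longleftrightarrow> C2_map_on D f \<and>
     (\<forall>z\<in>D. partial_x (partial_x f) z + partial_y (partial_y f) z = 0)"

abbreviation unit_disc :: "complex set" where
  "unit_disc \<equiv> ball 0 1"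

definition CH_plane :: "complex set \<Rightarrow> 'a::real_inner set \<Rightarrow> (complex \<Rightarrow> 'a) set" where
  "CH_plane D \<Omega> = {f. conformal_map_on D f \<and> harmonic_map_on D f \<and> f \<in> D \<rightarrow> \<Omega>}"

text \<open>A Riemann surface is given by a topology \<open>X\<close>, whose carrier \<open>topspace X\<close> is the underlying
  set, and a holomorphic atlas \<open>A\<close>, a set of pairs consisting of a chart domain \<open>U\<close> and a chart
  \<open>\<phi>\<close>, whose values outside \<open>U\<close> are irrelevant. The atlas need not be maximal. Second
  countability is part of the notion of manifold.\<close>

definition riemann_surface :: "'m topology \<Rightarrow> ('m set \<times> ('m \<Rightarrow> complex)) set \<Rightarrow> bool" where
  "riemann_surface X A \<longleftrightarrow>
     Hausdorff_space X \<and> second_countable X \<and>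
     (\<Union>(U, \<phi>)\<in>A. U) = topspace X \<and>
     (\<forall>(U, \<phi>)\<in>A. openin X U \<and> open (\<phi> ` U) \<and>
        homeomorphic_map (subtopology X U) (top_of_set (\<phi> ` U)) \<phi>) \<and>
     (\<forall>(U, \<phi>)\<in>A. \<forall>(V, \<psi>)\<in>A. (\<psi> \<circ> inv_into U \<phi>) holomorphic_on \<phi> ` (U \<inter> V))"

definition open_riemann_surface :: "'m topology \<Rightarrow> ('m set \<times> ('m \<Rightarrow> complex)) set \<Rightarrow> bool" where
  "open_riemann_surface X A \<longleftrightarrow>
     riemann_surface X A \<and> connected_space X \<and> \<not> compact_space X"

definition CH_surface ::
  "'m topology \<Rightarrow> ('m set \<times> ('m \<Rightarrow> complex)) set \<Rightarrow> 'a::real_inner set \<Rightarrow> ('m \<Rightarrow> 'a) set" where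
  "CH_surface X A \<Omega> = {f. f \<in> topspace X \<rightarrow> \<Omega> \<and>
     (\<forall>(U, \<phi>)\<in>A. conformal_map_on (\<phi> ` U) (f \<circ> inv_into U \<phi>) \<and>
                 harmonic_map_on (\<phi> ` U) (f \<circ> inv_into U \<phi>))}"

definition compactly_divergent ::
  "'m topology \<Rightarrow> 'a::topological_space set \<Rightarrow> (nat \<Rightarrow> 'm \<Rightarrow> 'a) \<Rightarrow> bool" where
  "compactly_divergent X \<Omega> f \<longleftrightarrow>
     (\<forall>K K'. compactin X K \<and> compact K' \<and> K' \<subseteq> \<Omega> \<longrightarrow>
        (\<forall>\<^sub>F i in sequentially. f i ` K \<inter> K' = {}))"

definition normal_family ::
  "'m topology \<Rightarrow> 'a::metric_space set \<Rightarrow> ('m \<Rightarrow> 'a) set \<Rightarrow> bool" where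
  "normal_family X \<Omega> F \<longleftrightarrow>
     (\<forall>f :: nat \<Rightarrow> 'm \<Rightarrow> 'a. range f \<subseteq> F \<longrightarrow>
        (\<exists>r :: nat \<Rightarrow> nat. strict_mono r \<and>
           ((\<exists>g \<in> topspace X \<rightarrow> \<Omega>. \<forall>K. compactin X K \<longrightarrow>
                uniform_limit K (\<lambda>i. f (r i)) g sequentially) \<or>
            compactly_divergent X \<Omega> (\<lambda>i. f (r i)))))"

definition taut :: "'a::real_inner set \<Rightarrow> bool" where
  "taut \<Omega> \<longleftrightarrow> normal_family (top_of_set unit_disc) \<Omega> (CH_plane unit_disc \<Omega>)"

text \<open>For a domain \<open>\<Omega>\<close> of dimension at least 2 and \<open>x \<in> \<Omega>\<close> the set below is nonempty
  (consider small affine discs).\<close>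

definition minimal_pseudometric :: "'a::real_inner set \<Rightarrow> 'a \<Rightarrow> 'a \<Rightarrow> real" where
  "minimal_pseudometric \<Omega> x v =
     Inf {1 / r | r. r > 0 \<and> (\<exists>f\<in>CH_plane unit_disc \<Omega>. f 0 = x \<and> partial_x f 0 = r *\<^sub>R v)}"

text \<open>Smoothness on a compact interval, with one-sided derivatives of all orders at the endpoints.\<close>

definition smooth_on_interval :: "real \<Rightarrow> real \<Rightarrow> (real \<Rightarrow> 'a::real_normed_vector) \<Rightarrow> bool" where
  "smooth_on_interval a b \<gamma> \<longleftrightarrow>
     (\<exists>D :: nat \<Rightarrow> real \<Rightarrow> 'a. (\<forall>t\<in>{a..b}. D 0 t = \<gamma> t) \<and>
        (\<forall>k. \<forall>t\<in>{a..b}. (D k has_vector_derivative D (Suc k) t) (at t within {a..b})))"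

definition piecewise_smooth_path :: "(real \<Rightarrow> 'a::real_normed_vector) \<Rightarrow> bool" where
  "piecewise_smooth_path \<gamma> \<longleftrightarrow>
     (\<exists>(m :: nat) (p :: nat \<Rightarrow> real). p 0 = 0 \<and> p m = 1 \<and>
        (\<forall>i<m. p i < p (Suc i) \<and> smooth_on_interval (p i) (p (Suc i)) \<gamma>))"

text \<open>The integrand is undetermined at the finitely many points where \<open>\<gamma>\<close> may fail to be
  differentiable; these form a null set. For a domain of dimension at least 2 the infimum is finite,
  so the conversion to a real number loses nothing.\<close>

definition minimal_pseudodistance :: "'a::real_inner set \<Rightarrow> 'a \<Rightarrow> 'a \<Rightarrow> real" where
  "minimal_pseudodistance \<Omega> x y =
     enn2real (INF \<gamma> \<in> {\<gamma>. piecewise_smooth_path \<gamma> \<and> path_image \<gamma> \<subseteq> \<Omega> \<and>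
                             pathstart \<gamma> = x \<and> pathfinish \<gamma> = y}.
       \<integral>\<^sup>+t\<in>{0..1}. ennreal (minimal_pseudometric \<Omega> (\<gamma> t) (vector_derivative \<gamma> (at t))) \<partial>lborel)"

definition hyperbolic :: "'a::real_inner set \<Rightarrow> bool" where
  "hyperbolic \<Omega> \<longleftrightarrow> (\<forall>x\<in>\<Omega>. \<forall>y\<in>\<Omega>. x \<noteq> y \<longrightarrow> minimal_pseudodistance \<Omega> x y > 0)"

definition complete_hyperbolic :: "'a::real_inner set \<Rightarrow> bool" where
  "complete_hyperbolic \<Omega> \<longleftrightarrow> hyperbolic \<Omega> \<and>
     Metric_space \<Omega> (minimal_pseudodistance \<Omega>) \<and>
     Metric_space.mcomplete \<Omega> (minimal_pseudodistance \<Omega>)"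

definition separating_hyperplane :: "'a::real_inner set \<Rightarrow> 'a \<Rightarrow> real \<Rightarrow> bool" where
  "separating_hyperplane \<Omega> a b \<longleftrightarrow> a \<noteq> 0 \<and> {x. a \<bullet> x = b} \<inter> \<Omega> = {}"

end

theory Submission
  imports Defs "HOL-Complex_Analysis.Complex_Analysis"
begin

text \<open>If \<open>a \<bullet> y < c\<close> on \<open>\<Omega>\<close>, then \<open>c - a \<bullet> f\<close> is a positive harmonic function for every conformal harmonic
  \<open>f\<close> into \<open>\<Omega>\<close>, so the Schwarz lemma bounds its gradient by a multiple of its value. A convex domain without
  affine planes has such functionals \<open>a\<close> spanning a hyperplane of directions, and conformality controls the one
  missing component of the differential by the others. Integrating the gradient bound yields Harnack
  inequalities on small discs, hence normality: a limit that meets the boundary stays in a supporting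
  hyperplane. The same bound on the unit disc says that the minimal metric dominates the differentials of
  \<open>ln (c - a \<bullet> p) / 2\<close> and of a multiple of \<open>ln (s\<^sup>2 + \<bar>p - x\<bar>\<^sup>2)\<close>; the first function blows up at
  the boundary and the second at infinity, which gives completeness.
  Conversely, on an affine plane the dilations form a non-normal family and the minimal metric vanishes.\<close>

subsection \<open>Positive harmonic functions\<close>

text \<open>The boundary and infinity need different functionals. The n - 1 functionals of one fixed
  set control the whole differential of a conformal harmonic map, weighted by \<open>slack\<close>,
  a combination of the distances to their hyperplanes. A boundary point usually lies on none of
  these hyperplanes, so it is treated by a supporting functional of its own, chosen only once the
  limit point is known. At infinity \<open>slack\<close> grows at most linearly, so the metric is
  bounded below only by a multiple of 1 / (1 + |x|). This is the borderline rate at which lengths to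
  infinity still diverge, logarithmically.

  A second obstacle is that nothing makes the integrand in the definition of length measurable.
  Upper bounds therefore use only affine substitutions and splittings of the parameter interval,
  which survive for lower integrals. Lower bounds exhibit a measurable minorant: the absolute
  derivative along the path of a function whose differential is dominated by the metric.\<close>

lemma has_derivative_partials:
  assumes "f differentiable (at z)"
  shows "(f has_derivative (\<lambda>h. Re h *\<^sub>R partial_x f z + Im h *\<^sub>R partial_y f z)) (at z)"
proof -
  let ?D = "frechet_derivative f (at z)"
  have D: "(f has_derivative ?D) (at z)"
    using assms frechet_derivative_works by blast
  then interpret bounded_linear ?D
    by (rule has_derivative_bounded_linear)
  have "?D h = Re h *\<^sub>R partial_x f z + Im h *\<^sub>R partial_y f z" for h
  proof -
    have "h = Re h *\<^sub>R 1 + Im h *\<^sub>R \<i>"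
      by (simp add: complex_eq_iff)
    then have "?D h = ?D (Re h *\<^sub>R 1 + Im h *\<^sub>R \<i>)"
      by simp
    then show ?thesis
      by (simp only: add scale partial_x_def partial_y_def)
  qed
  then have "?D = (\<lambda>h. Re h *\<^sub>R partial_x f z + Im h *\<^sub>R partial_y f z)"
    by auto
  with D show ?thesis
    by simp
qed

lemma partials_eqI:
  assumes "(f has_derivative (\<lambda>h. Re h *\<^sub>R p + Im h *\<^sub>R q)) (at z)"
  shows "partial_x f z = p" "partial_y f z = q" "f differentiable (at z)"
proof -
  have "frechet_derivative f (at z) = (\<lambda>h. Re h *\<^sub>R p + Im h *\<^sub>R q)"
    using assms frechet_derivative_at by metis
  then show "partial_x f z = p" "partial_y f z = q"
    by (auto simp: partial_x_def partial_y_def)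
  show "f differentiable (at z)"
    using assms differentiable_def by blast
qed

lemma CH_plane_mono: "f \<in> CH_plane D \<Omega> \<Longrightarrow> E \<subseteq> D \<Longrightarrow> f \<in> CH_plane E \<Omega>"
  unfolding CH_plane_def conformal_map_on_def harmonic_map_on_def C2_map_on_def C1_map_on_def
  by (auto intro: continuous_on_subset)

text \<open>The mean value theorem is used once in each variable. Since the second difference is
  symmetric in the two variables, using it in both orders compares the two mixed derivatives at
  nearby points.\<close>

lemma second_difference_mean_value:
  fixes u P Q :: "real \<Rightarrow> real \<Rightarrow> real"
  assumes h: "h > 0"
    and P: "\<And>s t. \<lbrakk>0 \<le> s; s \<le> h; 0 \<le> t; t \<le> h\<rbrakk> \<Longrightarrow> ((\<lambda>s. u s t) has_real_derivative P s t) (at s)"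
    and Q: "\<And>s t. \<lbrakk>0 \<le> s; s \<le> h; 0 \<le> t; t \<le> h\<rbrakk> \<Longrightarrow> ((\<lambda>t. P s t) has_real_derivative Q s t) (at t)"
  obtains s t where "0 \<le> s" "s \<le> h" "0 \<le> t" "t \<le> h"
    "u h h - u 0 h - u h 0 + u 0 0 = h * h * Q s t"
proof -
  have "\<exists>s. 0 < s \<and> s < h \<and> (u h h - u h 0) - (u 0 h - u 0 0) = (h - 0) * (P s h - P s 0)"
    using h by (intro MVT2 DERIV_diff P) auto
  then obtain s where s: "0 < s" "s < h" "(u h h - u h 0) - (u 0 h - u 0 0) = h * (P s h - P s 0)"
    by auto
  have "\<exists>t. 0 < t \<and> t < h \<and> P s h - P s 0 = (h - 0) * Q s t"
    using h s by (intro MVT2 Q) auto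
  then obtain t where t: "0 < t" "t < h" "P s h - P s 0 = h * Q s t"
    by auto
  show thesis
    using s t by (intro that[of s t]) (auto simp: algebra_simps)
qed

text \<open>Symmetry of second derivatives is half of the Cauchy-Riemann equations for
  \<open>p - i q\<close>, and \<open>C2_map_on\<close> only provides continuity of the two mixed
  derivatives.\<close>

lemma mixed_partials_eq:
  fixes u p q :: "complex \<Rightarrow> real"
  assumes S: "open S" "z \<in> S"
    and u: "\<And>w. w \<in> S \<Longrightarrow> (u has_derivative (\<lambda>h. Re h *\<^sub>R p w + Im h *\<^sub>R q w)) (at w)"
    and p: "\<And>w. w \<in> S \<Longrightarrow> (p has_derivative (\<lambda>h. Re h *\<^sub>R px w + Im h *\<^sub>R py w)) (at w)"
    and q: "\<And>w. w \<in> S \<Longrightarrow> (q has_derivative (\<lambda>h. Re h *\<^sub>R qx w + Im h *\<^sub>R qy w)) (at w)"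
    and cont: "continuous_on S py" "continuous_on S qx"
  shows "py z = qx z"
proof (rule ccontr)
  assume ne: "py z \<noteq> qx z"
  \<comment> \<open>Half the gap: a common value cannot lie within \<open>d\<close> of both mixed
    derivatives at \<open>z\<close>.\<close>
  define d where "d = \<bar>py z - qx z\<bar> / 2"
  have d: "d > 0"
    using ne by (simp add: d_def)
  have "isCont py z" "isCont qx z"
    using cont S continuous_on_eq_continuous_at by blast+
  then obtain r1 r2 where r: "r1 > 0" "\<And>w. dist w z < r1 \<Longrightarrow> dist (py w) (py z) < d"
      "r2 > 0" "\<And>w. dist w z < r2 \<Longrightarrow> dist (qx w) (qx z) < d"
    unfolding continuous_at_eps_delta using d by metis
  obtain r3 where r3: "r3 > 0" "ball z r3 \<subseteq> S"
    using S openE by blast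
  define r where "r = min r1 (min r2 r3)"
  \<comment> \<open>All points \<open>W s t\<close> of the square are within 2 h < r of
    \<open>z\<close>.\<close>
  define h where "h = r / 3"
  have h: "h > 0" "r > 0"
    using r r3 by (auto simp: r_def h_def)
  define W where "W s t = z + of_real s + of_real t * \<i>" for s t :: real
  have W: "dist (W s t) z < r" if "0 \<le> s" "s \<le> h" "0 \<le> t" "t \<le> h" for s t
  proof -
    have "dist (W s t) z \<le> norm (of_real s :: complex) + norm (of_real t * \<i>)"
      using norm_triangle_ineq[of "of_real s :: complex" "of_real t * \<i>"]
      by (simp add: W_def dist_norm add.assoc)
    also have "\<dots> = s + t"
      using that by (simp add: norm_mult)
    also have "\<dots> < r"
      using that h unfolding h_def by linarith
    finally show ?thesis .
  qed
  then have WS: "W s t \<in> S" if "0 \<le> s" "s \<le> h" "0 \<le> t" "t \<le> h" for s t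
    using that r3 unfolding r_def by (metis dist_commute mem_ball min_less_iff_conj subsetD)
  have Ws: "((\<lambda>s. W s t) has_derivative (\<lambda>k. of_real k)) (at s)" for s t
    unfolding W_def by (auto intro!: derivative_eq_intros)
  have Wt: "((\<lambda>t. W s t) has_derivative (\<lambda>k. of_real k * \<i>)) (at t)" for s t
    unfolding W_def by (auto intro!: derivative_eq_intros)
  have ds: "((\<lambda>s. f (W s t)) has_real_derivative a) (at s)"
    if "(f has_derivative (\<lambda>h. Re h *\<^sub>R a + Im h *\<^sub>R b)) (at (W s t))" for f and a b s t :: real
    using has_derivative_compose[OF Ws that]
    by (simp add: has_field_derivative_def mult.commute[of a] mult_commute_abs)
  have dt: "((\<lambda>t. f (W s t)) has_real_derivative b) (at t)"
    if "(f has_derivative (\<lambda>h. Re h *\<^sub>R a + Im h *\<^sub>R b)) (at (W s t))" for f and a b s t :: real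
    using has_derivative_compose[OF Wt that]
    by (simp add: has_field_derivative_def mult.commute[of b] mult_commute_abs)
  obtain s t where 1: "0 \<le> s" "s \<le> h" "0 \<le> t" "t \<le> h"
      "u (W h h) - u (W 0 h) - u (W h 0) + u (W 0 0) = h * h * py (W s t)"
    by (rule second_difference_mean_value[of h "\<lambda>s t. u (W s t)" "\<lambda>s t. p (W s t)" "\<lambda>s t. py (W s t)"])
      (use h in \<open>auto intro!: ds[OF u] dt[OF p] WS\<close>)
  obtain t' s' where 2: "0 \<le> t'" "t' \<le> h" "0 \<le> s'" "s' \<le> h"
      "u (W h h) - u (W h 0) - u (W 0 h) + u (W 0 0) = h * h * qx (W s' t')"
    by (rule second_difference_mean_value[of h "\<lambda>t s. u (W s t)" "\<lambda>t s. q (W s t)" "\<lambda>t s. qx (W s t)"])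
      (use h in \<open>auto intro!: dt[OF u] ds[OF q] WS\<close>)
  have "h * h * py (W s t) = h * h * qx (W s' t')"
    using 1(5) 2(5) by linarith
  then have "py (W s t) = qx (W s' t')"
    using h by simp
  moreover have "dist (py (W s t)) (py z) < d" "dist (qx (W s' t')) (qx z) < d"
    using W[of s t] W[of s' t'] 1 2 r unfolding r_def by (meson min_less_iff_conj)+
  ultimately show False
    unfolding d_def dist_real_def by (simp add: abs_if split: if_splits)
qed

text \<open>The hypotheses on \<open>p\<close> and \<open>q\<close> are the Cauchy-Riemann equations
  for \<open>\<phi> = p - i q\<close>. Its primitive \<open>G\<close>, normalised to have real part
  \<open>u\<close>, is composed with the Cayley map (w - c) / (w + c), where c = u(z). After
  rescaling the disc this is a self-map of the unit disc fixing 0, with derivative R \<phi>(z) / (2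
  c) there, so the Schwarz lemma yields the constant 2 / R.\<close>

lemma positive_harmonic_gradient_bound:
  fixes u p q :: "complex \<Rightarrow> real"
  assumes R: "R > 0"
    and u: "\<And>w. w \<in> ball z R \<Longrightarrow> (u has_derivative (\<lambda>h. Re h *\<^sub>R p w + Im h *\<^sub>R q w)) (at w)"
    and p: "\<And>w. w \<in> ball z R \<Longrightarrow> (p has_derivative (\<lambda>h. Re h *\<^sub>R px w + Im h *\<^sub>R py w)) (at w)"
    and q: "\<And>w. w \<in> ball z R \<Longrightarrow> (q has_derivative (\<lambda>h. Re h *\<^sub>R py w - Im h *\<^sub>R px w)) (at w)"
    and pos: "\<And>w. w \<in> ball z R \<Longrightarrow> u w > 0"
  shows "\<bar>Re h * p z + Im h * q z\<bar> \<le> 2 / R * u z * norm h"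
proof -
  define \<phi> where "\<phi> w = of_real (p w) - \<i> * of_real (q w)" for w
  have zb: "z \<in> ball z R"
    using R by simp
  have "(\<phi> has_field_derivative (of_real (px w) - \<i> * of_real (py w))) (at w)" if "w \<in> ball z R" for w
    unfolding \<phi>_def has_field_derivative_def
    by (rule derivative_eq_intros p[OF that] q[OF that] refl)+ (auto simp: fun_eq_iff complex_eq_iff)
  then have hol: "\<phi> holomorphic_on ball z R"
    unfolding holomorphic_on_open[OF open_ball] by blast
  obtain F where F: "\<And>w. w \<in> ball z R \<Longrightarrow> (F has_field_derivative \<phi> w) (at w)"
    using holomorphic_convex_primitive'[OF convex_ball open_ball hol]
    by (metis at_within_open open_ball)
  define e where "e w = Re (F w) - u w" for w
  have "(e has_derivative (\<lambda>h. 0)) (at w within ball z R)" if "w \<in> ball z R" for w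
  proof -
    have "(F has_derivative (*) (\<phi> w)) (at w)"
      using F[OF that] by (simp add: has_field_derivative_def)
    then have "(e has_derivative (\<lambda>h. 0)) (at w)"
      unfolding e_def
      by (auto intro!: derivative_eq_intros u[OF that] simp: \<phi>_def fun_eq_iff)
    then show ?thesis
      by (rule has_derivative_at_withinI)
  qed
  then have ec: "e w = e z" if "w \<in> ball z R" for w
    using has_derivative_zero_constant[OF convex_ball, of z R e] that zb by metis
  define G where "G w = F w - F z + of_real (u z)" for w
  have ReG: "Re (G w) = u w" if "w \<in> ball z R" for w
    using ec[OF that] by (simp add: G_def e_def)
  have dG: "(G has_field_derivative \<phi> w) (at w)" if "w \<in> ball z R" for w
    unfolding G_def by (auto intro!: derivative_eq_intros F[OF that])
  define c where "c = u z"
  have c: "c > 0"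
    using pos[OF zb] by (simp add: c_def)
  define f where "f \<zeta> = (G (z + R * \<zeta>) - c) / (G (z + R * \<zeta>) + c)" for \<zeta> :: complex
  have inb: "z + R * \<zeta> \<in> ball z R" if "norm \<zeta> < 1" for \<zeta> :: complex
    using that R by (simp add: dist_norm norm_mult)
  have ne: "G (z + R * \<zeta>) + c \<noteq> 0" if "norm \<zeta> < 1" for \<zeta> :: complex
  proof
    assume "G (z + R * \<zeta>) + c = 0"
    then have "Re (G (z + R * \<zeta>)) + c = 0"
      by (metis Re_complex_of_real plus_complex.simps(1) zero_complex.simps(1))
    then show False
      using ReG[OF inb[OF that]] pos[OF inb[OF that]] c by simp
  qed
  have df: "(f has_field_derivative (\<phi> (z + R * \<zeta>) * R * (G (z + R * \<zeta>) + c) - (G (z + R * \<zeta>) - c) * (\<phi> (z + R * \<zeta>) * R)) /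
      ((G (z + R * \<zeta>) + c) * (G (z + R * \<zeta>) + c))) (at \<zeta>)" if "norm \<zeta> < 1" for \<zeta> :: complex
  proof -
    have 1: "((\<lambda>\<zeta>. z + R * \<zeta>) has_field_derivative R) (at \<zeta>)"
      by (auto intro!: derivative_eq_intros)
    have 2: "((\<lambda>\<zeta>. G (z + R * \<zeta>)) has_field_derivative \<phi> (z + R * \<zeta>) * R) (at \<zeta>)"
      by (rule DERIV_chain2[OF dG 1]) (rule inb[OF that])
    show ?thesis
      unfolding f_def using ne[OF that] by (auto intro!: derivative_eq_intros 2)
  qed
  have "f holomorphic_on ball 0 1"
    unfolding holomorphic_on_open[OF open_ball] by (metis df mem_ball_0)
  moreover have Gz: "G z = c"
    by (simp add: G_def c_def)
  then have "f 0 = 0"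
    by (simp add: f_def)
  moreover have "norm (f \<zeta>) < 1" if "norm \<zeta> < 1" for \<zeta> :: complex
  proof -
    define g where "g = G (z + R * \<zeta>)"
    have g: "Re g > 0"
      using ReG[OF inb[OF that]] pos[OF inb[OF that]] by (simp add: g_def)
    have "(norm (g - c))\<^sup>2 < (norm (g + c))\<^sup>2"
      unfolding cmod_power2 using g c by (simp add: power2_eq_square algebra_simps)
    then have "norm (g - c) < norm (g + c)"
      by (rule power_less_imp_less_base) simp
    then show ?thesis
      using ne[OF that] unfolding f_def g_def[symmetric] by (simp add: norm_divide)
  qed
  ultimately have "norm (deriv f 0) \<le> 1"
    using Schwarz_Lemma(2)[of f 0] by simp
  moreover have "deriv f 0 = \<phi> z * R / (2 * c)"
    using DERIV_imp_deriv[OF df[of 0]] Gz c by (simp add: field_simps)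
  ultimately have le: "norm (\<phi> z) \<le> 2 / R * c"
    using R c by (simp add: norm_mult norm_divide field_simps)
  have "\<bar>Re h * p z + Im h * q z\<bar> = \<bar>Re (\<phi> z * h)\<bar>"
    by (simp add: \<phi>_def algebra_simps)
  also have "\<dots> \<le> norm (\<phi> z) * norm h"
    using abs_Re_le_cmod norm_mult by metis
  also have "\<dots> \<le> 2 / R * c * norm h"
    using le by (rule mult_right_mono) simp
  finally show ?thesis
    by (simp add: c_def)
qed

text \<open>The positive harmonic function is \<open>b - a \<bullet> F\<close>. Its value at the
  centre stays on the right-hand side, so the bound sharpens as \<open>F z\<close> approaches the
  hyperplane; both the Harnack inequalities and completeness at the boundary rest on this.\<close>

lemma CH_gradient_bound:
  assumes F: "F \<in> CH_plane (ball z R) \<Omega>" and R: "R > 0"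
    and ab: "\<And>y. y \<in> \<Omega> \<Longrightarrow> a \<bullet> y < b"
  shows "\<bar>a \<bullet> (Re h *\<^sub>R partial_x F z + Im h *\<^sub>R partial_y F z)\<bar> \<le> 2 / R * (b - a \<bullet> F z) * norm h"
proof -
  let ?B = "ball z R"
  note [simp] = CH_plane_def harmonic_map_on_def C2_map_on_def C1_map_on_def
  let ?xx = "partial_x (partial_x F)" and ?xy = "partial_y (partial_x F)"
    and ?yx = "partial_x (partial_y F)" and ?yy = "partial_y (partial_y F)"
  have dF: "(F has_derivative (\<lambda>h. Re h *\<^sub>R partial_x F w + Im h *\<^sub>R partial_y F w)) (at w)"
    and dx: "(partial_x F has_derivative (\<lambda>h. Re h *\<^sub>R ?xx w + Im h *\<^sub>R ?xy w)) (at w)"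
    and dy: "(partial_y F has_derivative (\<lambda>h. Re h *\<^sub>R ?yx w + Im h *\<^sub>R ?yy w)) (at w)"
    if "w \<in> ?B" for w
    using F that by (auto intro!: has_derivative_partials)
  have inner: "((\<lambda>w. a \<bullet> f w) has_derivative (\<lambda>h. Re h *\<^sub>R (a \<bullet> v) + Im h *\<^sub>R (a \<bullet> v'))) (at w)"
    if "(f has_derivative (\<lambda>h. Re h *\<^sub>R v + Im h *\<^sub>R v')) (at w)" for f v v' w
    using has_derivative_inner_right[OF that, of a] by (simp add: inner_add_right)
  have mixed: "a \<bullet> ?xy w = a \<bullet> ?yx w" if "w \<in> ?B" for w
    by (rule mixed_partials_eq[where S = ?B and u = "\<lambda>w. a \<bullet> F w" and p = "\<lambda>w. a \<bullet> partial_x F w"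
          and q = "\<lambda>w. a \<bullet> partial_y F w" and py = "\<lambda>w. a \<bullet> ?xy w" and qx = "\<lambda>w. a \<bullet> ?yx w"
          and px = "\<lambda>w. a \<bullet> ?xx w" and qy = "\<lambda>w. a \<bullet> ?yy w"])
      (use F in \<open>auto intro!: inner[OF dF, simplified] inner[OF dx, simplified]
        inner[OF dy, simplified] continuous_intros simp: that[simplified]\<close>)
  have lap: "a \<bullet> ?yy w = - (a \<bullet> ?xx w)" if "w \<in> ?B" for w
    using F that by (metis (no_types, lifting) CH_plane_def harmonic_map_on_def inner_minus_right mem_Collect_eq minus_unique)
  have "\<bar>Re h * - (a \<bullet> partial_x F z) + Im h * - (a \<bullet> partial_y F z)\<bar> \<le> 2 / R * (b - a \<bullet> F z) * norm h"
  proof (rule positive_harmonic_gradient_bound[OF R])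
    fix w assume w: "w \<in> ?B"
    show "((\<lambda>w. b - a \<bullet> F w) has_derivative
        (\<lambda>h. Re h *\<^sub>R - (a \<bullet> partial_x F w) + Im h *\<^sub>R - (a \<bullet> partial_y F w))) (at w)"
      using has_derivative_diff[OF has_derivative_const[of b] inner[OF dF[OF w]]] by (simp add: algebra_simps)
    show "((\<lambda>w. - (a \<bullet> partial_x F w)) has_derivative
        (\<lambda>h. Re h *\<^sub>R - (a \<bullet> ?xx w) + Im h *\<^sub>R - (a \<bullet> ?xy w))) (at w)"
      using has_derivative_minus[OF inner[OF dx[OF w]]] by (simp add: algebra_simps)
    show "((\<lambda>w. - (a \<bullet> partial_y F w)) has_derivative
        (\<lambda>h. Re h *\<^sub>R - (a \<bullet> ?xy w) - Im h *\<^sub>R - (a \<bullet> ?xx w))) (at w)"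
      using has_derivative_minus[OF inner[OF dy[OF w]]] mixed[OF w] lap[OF w]
      by (simp add: algebra_simps)
    have "F w \<in> \<Omega>"
      using F w unfolding CH_plane_def by blast
    then show "b - a \<bullet> F w > 0"
      using ab by simp
  qed
  moreover have "a \<bullet> (Re h *\<^sub>R partial_x F z + Im h *\<^sub>R partial_y F z) =
      - (Re h * - (a \<bullet> partial_x F z) + Im h * - (a \<bullet> partial_y F z))"
    by (simp add: inner_add_right)
  ultimately show ?thesis
    by (simp only: abs_minus_cancel)
qed

text \<open>Around every point of the half-radius disc a disc of radius R / 2 is left, so the
  gradient bound says that ln (b - a . F) has derivative at most 4 / R there. Over a distance below
  R / 2 the logarithm changes by at most 2, whence the factor \<open>exp 2\<close>.\<close>

lemma CH_Harnack:
  assumes F: "F \<in> CH_plane (ball z R) \<Omega>" and w: "dist z w < R / 2"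
    and ab: "\<And>y. y \<in> \<Omega> \<Longrightarrow> a \<bullet> y < b"
  shows "b - a \<bullet> F w \<le> exp 2 * (b - a \<bullet> F z)" "b - a \<bullet> F z \<le> exp 2 * (b - a \<bullet> F w)"
proof -
  have R: "R > 0"
    using w zero_le_dist[of z w] by linarith
  let ?B = "ball z (R / 2)"
  have pos: "b - a \<bullet> F v > 0" if "v \<in> ?B" for v
  proof -
    have "v \<in> ball z R"
      using that R by auto
    then have "F v \<in> \<Omega>"
      using F unfolding CH_plane_def by blast
    then show ?thesis
      using ab by simp
  qed
  define D where "D v h = - (a \<bullet> (Re h *\<^sub>R partial_x F v + Im h *\<^sub>R partial_y F v)) / (b - a \<bullet> F v)" for v h
  have "norm (ln (b - a \<bullet> F w) - ln (b - a \<bullet> F z)) \<le> 4 / R * norm (w - z)"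
  proof (rule differentiable_bound[where S = ?B and f' = D])
    fix v assume v: "v \<in> ?B"
    then have "v \<in> ball z R"
      using R by auto
    then have "F differentiable (at v)"
      using F by (auto simp: CH_plane_def conformal_map_on_def C1_map_on_def)
    note d = has_derivative_partials[OF this]
    have "((\<lambda>v. ln (b - a \<bullet> F v)) has_derivative D v) (at v)"
      using pos[OF v] unfolding D_def
      by (auto intro!: derivative_eq_intros d simp: field_simps)
    then show "((\<lambda>v. ln (b - a \<bullet> F v)) has_derivative D v) (at v within ?B)"
      by (rule has_derivative_at_withinI)
    have "ball v (R / 2) \<subseteq> ball z R"
    proof
      fix y assume "y \<in> ball v (R / 2)"
      then show "y \<in> ball z R"
        using v dist_triangle[of z y v] by simp
    qed
    then have F': "F \<in> CH_plane (ball v (R / 2)) \<Omega>"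
      using F CH_plane_mono by blast
    show "onorm (D v) \<le> 4 / R"
    proof (rule onorm_le)
      fix h
      show "norm (D v h) \<le> 4 / R * norm h"
        using CH_gradient_bound[OF F' _ ab, of h] R pos[OF v]
        by (simp add: D_def field_simps)
    qed
  qed (use w R in auto)
  also have "\<dots> \<le> 2"
    using w R by (simp add: dist_norm norm_minus_commute field_simps)
  finally have le: "ln (b - a \<bullet> F w) \<le> 2 + ln (b - a \<bullet> F z)" "ln (b - a \<bullet> F z) \<le> 2 + ln (b - a \<bullet> F w)"
    by auto
  have p: "b - a \<bullet> F w > 0" "b - a \<bullet> F z > 0"
    using pos w R by auto
  have "exp (ln (b - a \<bullet> F w)) \<le> exp (2 + ln (b - a \<bullet> F z))"
    "exp (ln (b - a \<bullet> F z)) \<le> exp (2 + ln (b - a \<bullet> F w))"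
    using le by simp_all
  then show "b - a \<bullet> F w \<le> exp 2 * (b - a \<bullet> F z)" "b - a \<bullet> F z \<le> exp 2 * (b - a \<bullet> F w)"
    using p by (simp_all add: exp_add)
qed

subsection \<open>Convex domains without planes\<close>

lemma orthonormal_pair_exists:
  fixes S :: "'a::euclidean_space set"
  assumes "subspace S" "dim S \<ge> 2"
  obtains e1 e2 where "e1 \<in> S" "e2 \<in> S" "norm e1 = 1" "norm e2 = 1" "e1 \<bullet> e2 = 0"
proof -
  obtain B where B: "B \<subseteq> S" "pairwise orthogonal B" "\<And>x. x \<in> B \<Longrightarrow> norm x = 1"
      "independent B" "card B = dim S" "span B = S"
    using orthonormal_basis_subspace[OF assms(1)] by blast
  then obtain T where "T \<subseteq> B" "card T = 2"
    using assms(2) obtain_subset_with_card_n by metis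
  then obtain e1 e2 where "e1 \<in> B" "e2 \<in> B" "e1 \<noteq> e2"
    by (auto simp: card_2_iff)
  with B show thesis
    by (intro that[of e1 e2]) (auto simp: pairwise_def orthogonal_def)
qed

text \<open>An orthonormal frame is used because it makes the parametrization of the plane, and all
  its dilations, conformal.\<close>

definition contains_plane :: "'a::real_inner set \<Rightarrow> bool" where
  "contains_plane \<Omega> \<longleftrightarrow> (\<exists>x e1 e2. norm e1 = 1 \<and> norm e2 = 1 \<and> e1 \<bullet> e2 = 0 \<and>
     (\<forall>s t. x + s *\<^sub>R e1 + t *\<^sub>R e2 \<in> \<Omega>))"

lemma dim_orthonormal_pair:
  fixes e1 e2 :: "'a::euclidean_space"
  assumes "norm e1 = 1" "norm e2 = 1" "e1 \<bullet> e2 = 0"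
  shows "dim {e1, e2} = 2"
proof -
  have ne: "e1 \<noteq> e2"
    using assms by auto
  moreover have "0 \<notin> {e1, e2}"
    using assms by auto
  moreover have "pairwise orthogonal {e1, e2}"
    using assms by (auto simp: pairwise_def orthogonal_def inner_commute)
  ultimately have "independent {e1, e2}"
    using pairwise_orthogonal_independent by blast
  with ne show ?thesis
    by (simp add: dim_eq_card_independent)
qed

lemma contains_plane_iff_affine:
  fixes \<Omega> :: "'a::euclidean_space set"
  shows "contains_plane \<Omega> \<longleftrightarrow> (\<exists>S. affine S \<and> aff_dim S = 2 \<and> S \<subseteq> \<Omega>)"
proof
  assume "contains_plane \<Omega>"
  then obtain x e1 e2 where e: "norm e1 = 1" "norm e2 = 1" "e1 \<bullet> e2 = 0"
    and sub: "\<And>s t. x + s *\<^sub>R e1 + t *\<^sub>R e2 \<in> \<Omega>"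
    unfolding contains_plane_def by blast
  let ?S = "(+) x ` span {e1, e2}"
  have "affine ?S"
    using affine_translation subspace_imp_affine subspace_span by blast
  moreover have "aff_dim ?S = 2"
    using dim_orthonormal_pair[OF e] aff_dim_translation_eq[of x "span {e1, e2}"]
      aff_dim_subspace[OF subspace_span[of "{e1, e2}"]] by simp
  moreover have "?S \<subseteq> \<Omega>"
  proof clarify
    fix y assume "y \<in> span {e1, e2}"
    then obtain s t where "y - s *\<^sub>R e1 = t *\<^sub>R e2"
      by (auto simp: span_breakdown_eq[of y] span_singleton)
    then have "x + y = x + s *\<^sub>R e1 + t *\<^sub>R e2"
      by (simp add: algebra_simps)
    with sub show "x + y \<in> \<Omega>"
      by metis
  qed
  ultimately show "\<exists>S. affine S \<and> aff_dim S = 2 \<and> S \<subseteq> \<Omega>"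
    by blast
next
  assume "\<exists>S. affine S \<and> aff_dim S = 2 \<and> S \<subseteq> \<Omega>"
  then obtain S where S: "affine S" "aff_dim S = 2" "S \<subseteq> \<Omega>"
    by blast
  then have "S \<noteq> {}"
    by auto
  then obtain x where x: "x \<in> S"
    by blast
  let ?L = "(+) (- x) ` S"
  have L: "subspace ?L"
    using affine_diffs_subspace[OF S(1) x] by (simp add: image_def)
  have "aff_dim ?L = 2"
    using S(2) aff_dim_translation_eq by metis
  then have "dim ?L = 2"
    using aff_dim_subspace[OF L] by simp
  then obtain e1 e2 where e: "e1 \<in> ?L" "e2 \<in> ?L" "norm e1 = 1" "norm e2 = 1" "e1 \<bullet> e2 = 0"
    using orthonormal_pair_exists[OF L] by auto
  have "x + s *\<^sub>R e1 + t *\<^sub>R e2 \<in> \<Omega>" for s t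
  proof -
    have "s *\<^sub>R e1 + t *\<^sub>R e2 \<in> ?L"
      using L e by (intro subspace_add subspace_scale)
    then show ?thesis
      using S(3) by (auto simp: algebra_simps)
  qed
  with e show "contains_plane \<Omega>"
    unfolding contains_plane_def by blast
qed

definition open_halfspaces_around :: "'a::real_inner set \<Rightarrow> 'a set \<Rightarrow> ('a \<Rightarrow> real) \<Rightarrow> bool" where
  "open_halfspaces_around \<Omega> N b \<longleftrightarrow> (\<forall>a\<in>N. \<forall>y\<in>\<Omega>. a \<bullet> y < b a)"

text \<open>Separation of convex sets gives a weak inequality only. Openness makes it strict on the
  domain: a point of equality could be moved slightly to the wrong side.\<close>

lemma supporting_halfspace_open_convex:
  fixes \<Omega> :: "'a::euclidean_space set"
  assumes "convex \<Omega>" "open \<Omega>" "x \<notin> \<Omega>"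
  obtains a b where "a \<noteq> 0" "a \<bullet> x \<ge> b" "\<And>y. y \<in> \<Omega> \<Longrightarrow> a \<bullet> y < b"
proof (cases "\<Omega> = {}")
  case True
  obtain i :: 'a where "i \<in> Basis"
    using nonempty_Basis by blast
  then show thesis
    by (intro that[of i "i \<bullet> x"]) (use True in auto)
next
  case False
  then obtain a b where a: "a \<noteq> 0" "\<forall>y\<in>{x}. a \<bullet> y \<le> b" "\<forall>y\<in>\<Omega>. a \<bullet> y \<ge> b"
    using separating_hyperplane_sets[of "{x}" \<Omega>] assms by auto
  have "a \<bullet> y > b" if "y \<in> \<Omega>" for y
  proof -
    obtain e where e: "e > 0" "cball y e \<subseteq> \<Omega>"
      using assms(2) \<open>y \<in> \<Omega>\<close> open_contains_cball by blast
    \<comment> \<open>The point of the closed ball about \<open>y\<close> where the functional is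
      smallest.\<close>
    have "y - (e / norm a) *\<^sub>R a \<in> cball y e"
      using a(1) e by (simp add: dist_norm)
    then have "a \<bullet> (y - (e / norm a) *\<^sub>R a) \<ge> b"
      using a e by blast
    moreover have "a \<bullet> ((e / norm a) *\<^sub>R a) > 0"
      using a(1) e by simp
    ultimately show ?thesis
      by (simp add: inner_diff_right)
  qed
  then show thesis
    using a by (intro that[of "- a" "- b"]) auto
qed

lemma dim_orthogonal_complement:
  fixes N :: "'a::euclidean_space set"
  shows "dim {v. \<forall>a\<in>N. a \<bullet> v = 0} + dim N = DIM('a)"
proof -
  have "{y \<in> UNIV. \<forall>x\<in>span N. orthogonal x y} = {v. \<forall>a\<in>N. a \<bullet> v = 0}"
  proof -
    have "(\<forall>x\<in>span N. orthogonal x v) \<longleftrightarrow> (\<forall>a\<in>N. a \<bullet> v = 0)" for v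
    proof
      assume "\<forall>a\<in>N. a \<bullet> v = 0"
      then have "\<And>a. a \<in> N \<Longrightarrow> orthogonal v a"
        by (simp add: orthogonal_def inner_commute)
      then show "\<forall>x\<in>span N. orthogonal x v"
        using orthogonal_to_span orthogonal_commute by blast
    qed (simp add: orthogonal_def span_base)
    then show ?thesis
      by simp
  qed
  then show ?thesis
    using dim_subspace_orthogonal_to_vectors[OF subspace_span[of N] subspace_UNIV] by simp
qed

text \<open>Let \<open>A\<close> be the functionals bounded above on the domain and
  \<open>?V\<close> their common kernel. Moving a point of the domain by a vector of
  \<open>?V\<close> cannot leave the domain, since a functional separating the moved point would
  belong to \<open>A\<close> and hence not notice the move. Two orthonormal vectors in
  \<open>?V\<close> would thus span a plane in the domain, so \<open>?V\<close> has dimension at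
  most 1 and \<open>A\<close> has rank at least n - 1.\<close>

lemma no_plane_imp_halfspaces:
  fixes \<Omega> :: "'a::euclidean_space set"
  assumes \<Omega>: "\<Omega> \<noteq> {}" "open \<Omega>" "convex \<Omega>" and np: "\<not> contains_plane \<Omega>"
  obtains N b where "independent N" "card N = DIM('a) - 1" "open_halfspaces_around \<Omega> N b"
proof -
  define A where "A = {a. \<exists>b. \<forall>y\<in>\<Omega>. a \<bullet> y < b}"
  let ?V = "{v. \<forall>a\<in>A. a \<bullet> v = 0}"
  obtain x where x: "x \<in> \<Omega>"
    using \<Omega> by blast
  have lin: "x + v \<in> \<Omega>" if "v \<in> ?V" for v
  proof (rule ccontr)
    assume "x + v \<notin> \<Omega>"
    then obtain a b where ab: "a \<noteq> 0" "a \<bullet> (x + v) \<ge> b" "\<And>y. y \<in> \<Omega> \<Longrightarrow> a \<bullet> y < b"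
      using supporting_halfspace_open_convex \<Omega> by metis
    then have "a \<bullet> v = 0"
      using that by (auto simp: A_def)
    then show False
      using ab(2) ab(3)[OF x] by (simp add: inner_add_right)
  qed
  have V: "subspace ?V"
    by (auto simp: subspace_def inner_add_right)
  have "dim ?V < 2"
  proof (rule ccontr)
    assume "\<not> dim ?V < 2"
    then obtain e1 e2 where e: "e1 \<in> ?V" "e2 \<in> ?V" "norm e1 = 1" "norm e2 = 1" "e1 \<bullet> e2 = 0"
      using orthonormal_pair_exists[OF V] by (auto simp: not_less)
    have "x + s *\<^sub>R e1 + t *\<^sub>R e2 \<in> \<Omega>" for s t
    proof -
      have "s *\<^sub>R e1 + t *\<^sub>R e2 \<in> ?V"
        using V e by (intro subspace_add subspace_scale)
      from lin[OF this] show ?thesis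
        by (simp only: add.assoc)
    qed
    with e np show False
      unfolding contains_plane_def by blast
  qed
  then have "dim A \<ge> DIM('a) - 1"
    using dim_orthogonal_complement[of A] by linarith
  moreover obtain B where B: "B \<subseteq> A" "independent B" "card B = dim A"
    using basis_exists[of A] by metis
  ultimately have "DIM('a) - 1 \<le> card B"
    by simp
  then obtain N where N: "N \<subseteq> B" "card N = DIM('a) - 1"
    using obtain_subset_with_card_n[of "DIM('a) - 1" B] by metis
  have "\<exists>b. \<forall>y\<in>\<Omega>. a \<bullet> y < b" if "a \<in> N" for a
    using that N B by (auto simp: A_def)
  then obtain b where "\<forall>a\<in>N. \<forall>y\<in>\<Omega>. a \<bullet> y < b a"
    by metis
  then have "open_halfspaces_around \<Omega> N b"
    by (simp add: open_halfspaces_around_def)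
  moreover have "independent N"
    using independent_mono N(1) B(2) by blast
  ultimately show thesis
    using that N(2) by blast
qed

text \<open>The common kernel of n - 1 independent functionals is a line, which has no room for two
  orthonormal vectors.\<close>

lemma no_orthonormal_pair_orthogonal:
  fixes N :: "'a::euclidean_space set"
  assumes "independent N" "card N = DIM('a) - 1"
    and e: "norm e1 = 1" "norm e2 = 1" "e1 \<bullet> e2 = 0"
    and "\<And>a. a \<in> N \<Longrightarrow> a \<bullet> e1 = 0" "\<And>a. a \<in> N \<Longrightarrow> a \<bullet> e2 = 0"
  shows False
proof -
  have "dim {e1, e2} \<le> dim {v. \<forall>a\<in>N. a \<bullet> v = 0}"
    using assms by (intro dim_subset) auto
  moreover have "dim N = DIM('a) - 1"
    using assms by (simp add: dim_eq_card_independent)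
  moreover have "DIM('a) > 0"
    by simp
  ultimately show False
    using dim_orthogonal_complement[of N] dim_orthonormal_pair[OF e] by linarith
qed

text \<open>A functional that is not constant along a line takes every value on it, so the line
  meets each level set. Hence the normals of separating hyperplanes vanish on the directions of any
  plane in the domain.\<close>

lemma separating_hyperplanes_imp_no_plane:
  fixes \<Omega> :: "'a::euclidean_space set"
  assumes "independent N" "card N = DIM('a) - 1"
    and sep: "\<And>a. a \<in> N \<Longrightarrow> \<exists>b. separating_hyperplane \<Omega> a b"
  shows "\<not> contains_plane \<Omega>"
proof
  assume "contains_plane \<Omega>"
  then obtain x e1 e2 where e: "norm e1 = 1" "norm e2 = 1" "e1 \<bullet> e2 = 0"
    and sub: "\<And>s t. x + s *\<^sub>R e1 + t *\<^sub>R e2 \<in> \<Omega>"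
    unfolding contains_plane_def by blast
  have orth: "a \<bullet> e = 0" if "a \<in> N" and e: "\<And>s. x + s *\<^sub>R e \<in> \<Omega>" for a e
  proof (rule ccontr)
    assume ne: "a \<bullet> e \<noteq> 0"
    obtain b where b: "{x. a \<bullet> x = b} \<inter> \<Omega> = {}"
      using sep[OF \<open>a \<in> N\<close>] by (auto simp: separating_hyperplane_def)
    have "a \<bullet> (x + ((b - a \<bullet> x) / (a \<bullet> e)) *\<^sub>R e) = b"
      using ne by (simp add: inner_add_right)
    with b e show False
      by blast
  qed
  show False
    using no_orthonormal_pair_orthogonal[OF assms(1,2) e] orth sub[of _ 0] sub[of 0] by simp
qed

text \<open>By compactness of the set of orthonormal pairs; only a conformal pair can be controlled by
  \<open>DIM('a) - 1\<close> functionals.\<close>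

lemma conformal_pair_bound:
  fixes N :: "'a::euclidean_space set"
  assumes N: "independent N" "card N = DIM('a) - 1"
  obtains C where "C > 0"
    "\<And>X Y :: 'a. norm X = norm Y \<Longrightarrow> X \<bullet> Y = 0 \<Longrightarrow> norm X \<le> C * (\<Sum>a\<in>N. \<bar>a \<bullet> X\<bar> + \<bar>a \<bullet> Y\<bar>)"
proof -
  have fin: "finite N"
    using N(1) independent_imp_finite by blast
  define \<sigma> :: "'a \<times> 'a \<Rightarrow> real" where "\<sigma> = (\<lambda>(X, Y). \<Sum>a\<in>N. \<bar>a \<bullet> X\<bar> + \<bar>a \<bullet> Y\<bar>)"
  define K :: "('a \<times> 'a) set" where "K = (sphere 0 1 \<times> sphere 0 1) \<inter> {P. fst P \<bullet> snd P = 0}"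
  have cont: "continuous_on K \<sigma>"
    unfolding \<sigma>_def by (auto intro!: continuous_intros simp: split_beta)
  have comp: "compact K"
    unfolding K_def
    by (intro compact_Int_closed compact_Times compact_sphere closed_Collect_eq continuous_intros)
  have pos: "\<sigma> P > 0" if P: "P \<in> K" for P
  proof (rule ccontr)
    assume "\<not> \<sigma> P > 0"
    moreover have "\<sigma> P \<ge> 0"
      unfolding \<sigma>_def by (auto simp: split_beta intro: sum_nonneg)
    ultimately have "\<sigma> P = 0"
      by simp
    then have "\<forall>a\<in>N. \<bar>a \<bullet> fst P\<bar> + \<bar>a \<bullet> snd P\<bar> = 0"
      unfolding \<sigma>_def using fin by (simp add: split_beta sum_nonneg_eq_0_iff)
    then have z: "a \<bullet> fst P = 0" "a \<bullet> snd P = 0" if "a \<in> N" for a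
      using that by force+
    show False
      using P by (intro no_orthonormal_pair_orthogonal[OF N _ _ _ z]) (auto simp: K_def)
  qed
  obtain m where m: "m > 0" "\<And>P. P \<in> K \<Longrightarrow> m \<le> \<sigma> P"
  proof (cases "K = {}")
    \<comment> \<open>This happens in dimension 1, where there are no orthonormal pairs.\<close>
    case True
    then show ?thesis
      using that[of 1] by auto
  next
    case False
    then obtain P where "P \<in> K" "\<forall>Q\<in>K. \<sigma> P \<le> \<sigma> Q"
      using continuous_attains_inf[OF comp _ cont] by blast
    then show ?thesis
      using that pos by blast
  qed
  show thesis
  proof (rule that[of "1 / m"])
    show "1 / m > 0"
      using m by simp
    fix X Y :: 'a assume XY: "norm X = norm Y" "X \<bullet> Y = 0"
    show "norm X \<le> 1 / m * (\<Sum>a\<in>N. \<bar>a \<bullet> X\<bar> + \<bar>a \<bullet> Y\<bar>)"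
    proof (cases "X = 0")
      case True
      then show ?thesis
        using m by (auto intro!: sum_nonneg divide_nonneg_pos)
    next
      case False
      let ?c = "1 / norm X"
      have "Y \<noteq> 0"
        using False XY by auto
      then have "(?c *\<^sub>R X, ?c *\<^sub>R Y) \<in> K"
        using False XY by (auto simp: K_def)
      then have "m \<le> \<sigma> (?c *\<^sub>R X, ?c *\<^sub>R Y)"
        by (rule m)
      also have "\<dots> = ?c * (\<Sum>a\<in>N. \<bar>a \<bullet> X\<bar> + \<bar>a \<bullet> Y\<bar>)"
        unfolding \<sigma>_def by (simp add: sum_distrib_left abs_mult distrib_left)
      finally show ?thesis
        using m False by (simp add: field_simps)
    qed
  qed
qed

subsection \<open>Normal families\<close>

lemma compactin_eventually_ballI:
  assumes K: "compactin X K"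
    and loc: "\<And>p. p \<in> K \<Longrightarrow> \<exists>V. openin X V \<and> p \<in> V \<and> (\<forall>\<^sub>F k in F. \<forall>q\<in>V. P k q)"
  shows "\<forall>\<^sub>F k in F. \<forall>q\<in>K. P k q"
proof -
  obtain V where V: "\<And>p. p \<in> K \<Longrightarrow> openin X (V p) \<and> p \<in> V p \<and> (\<forall>\<^sub>F k in F. \<forall>q\<in>V p. P k q)"
    using loc by metis
  then have "K \<subseteq> \<Union>(V ` K)" "\<forall>U\<in>V ` K. openin X U"
    by auto
  then obtain \<F> where "finite \<F>" "\<F> \<subseteq> V ` K" "K \<subseteq> \<Union>\<F>"
    using K unfolding compactin_def by meson
  then obtain T where T: "finite T" "T \<subseteq> K" "K \<subseteq> \<Union>(V ` T)"
    by (metis finite_subset_image)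
  then have "\<forall>\<^sub>F k in F. \<forall>p\<in>T. \<forall>q\<in>V p. P k q"
    using V by (intro eventually_ball_finite) blast+
  then show ?thesis
    by eventually_elim (use T in blast)
qed

text \<open>The set where \<open>P\<close> holds is open and so is its complement. This is how a
  local Harnack comparison turns into an alternative on the whole surface.\<close>

lemma connected_space_locally_constant:
  assumes X: "connected_space X" and "p \<in> topspace X" "q \<in> topspace X" "P p"
    and loc: "\<And>p. p \<in> topspace X \<Longrightarrow> \<exists>V. openin X V \<and> p \<in> V \<and> (\<forall>q\<in>V. P q \<longleftrightarrow> P p)"
  shows "P q"
proof -
  \<comment> \<open>Stated for a general \<open>Q\<close> so as to cover both \<open>P\<close> and
    its negation.\<close>
  have opn: "openin X {p \<in> topspace X. Q p}"
    if Q: "\<And>p V q. p \<in> topspace X \<Longrightarrow> Q p \<Longrightarrow> openin X V \<Longrightarrow> q \<in> V \<Longrightarrow> P q = P p \<Longrightarrow> Q q" for Q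
  proof (subst openin_subopen, clarify)
    fix p assume p: "p \<in> topspace X" "Q p"
    then obtain V where V: "openin X V" "p \<in> V" "\<forall>q\<in>V. P q \<longleftrightarrow> P p"
      using loc by blast
    then have "V \<subseteq> {p \<in> topspace X. Q p}"
      using Q[OF p V(1)] openin_subset[OF V(1)] by blast
    then show "\<exists>T. openin X T \<and> p \<in> T \<and> T \<subseteq> {p \<in> topspace X. Q p}"
      using V by blast
  qed
  let ?A = "{p \<in> topspace X. P p}"
  have "openin X ?A"
    by (rule opn) blast
  moreover have "openin X {p \<in> topspace X. \<not> P p}"
    by (rule opn) blast
  moreover have "topspace X - ?A = {p \<in> topspace X. \<not> P p}"
    by blast
  ultimately have "openin X ?A" "closedin X ?A"
    by (auto simp: closedin_def)
  then have "?A = {} \<or> ?A = topspace X"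
    using X unfolding connected_space_clopen_in by blast
  then show ?thesis
    using assms(2-4) by blast
qed

text \<open>Second countability provides a countable dense set, on which a diagonal subsequence
  converges. Equicontinuity carries the Cauchy property from a nearby dense point to every point,
  and then makes the convergence locally uniform.\<close>

lemma equicontinuous_convergent_subsequence:
  fixes f :: "nat \<Rightarrow> 'm \<Rightarrow> 'a::{banach, heine_borel}"
  assumes X: "second_countable X"
    and bdd: "\<And>p. p \<in> topspace X \<Longrightarrow> bounded (range (\<lambda>k. f k p))"
    and equi: "\<And>p \<epsilon>. p \<in> topspace X \<Longrightarrow> \<epsilon> > 0 \<Longrightarrow>
      \<exists>V. openin X V \<and> p \<in> V \<and> (\<forall>k. \<forall>q\<in>V. norm (f k q - f k p) \<le> \<epsilon>)"
  obtains r g where "strict_mono (r :: nat \<Rightarrow> nat)"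
    "\<And>p. p \<in> topspace X \<Longrightarrow> (\<lambda>k. f (r k) p) \<longlonglongrightarrow> g p"
    "\<And>K. compactin X K \<Longrightarrow> uniform_limit K (\<lambda>k. f (r k)) g sequentially"
proof -
  obtain D where D: "countable D" "D \<subseteq> topspace X" "X closure_of D = topspace X"
    using second_countable_imp_separable_space[OF X] by (auto simp: separable_space_def)
  have "\<exists>B>0. \<forall>k. norm (f k p) \<le> B" if "p \<in> topspace X" for p
    using bdd[OF that] by (auto simp: bounded_pos)
  then obtain B where B: "\<And>p. p \<in> topspace X \<Longrightarrow> B p > 0 \<and> (\<forall>k. norm (f k p) \<le> B p)"
    by metis
  \<comment> \<open>The diagonal lemma wants one bound for all points of \<open>D\<close>, whereas
    \<open>B\<close> varies with the point; the values are normalised and scaled back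
    afterwards.\<close>
  have "norm ((1 / B d) *\<^sub>R f k d) \<le> 1" if "d \<in> D" for k d
  proof -
    have "B d > 0" "norm (f k d) \<le> B d"
      using B D that by blast+
    then show ?thesis
      by simp
  qed
  then obtain r :: "nat \<Rightarrow> nat" where r: "strict_mono r"
    and lim: "\<And>d. d \<in> D \<Longrightarrow> \<exists>l. (\<lambda>k. (1 / B d) *\<^sub>R f (r k) d) \<longlonglongrightarrow> l"
    using function_convergent_subsequence[OF D(1), of "\<lambda>k d. (1 / B d) *\<^sub>R f k d" 1] by metis
  have convD: "convergent (\<lambda>k. f (r k) d)" if d: "d \<in> D" for d
  proof -
    obtain l where "(\<lambda>k. (1 / B d) *\<^sub>R f (r k) d) \<longlonglongrightarrow> l"
      using lim[OF d] by blast
    then have "(\<lambda>k. B d *\<^sub>R ((1 / B d) *\<^sub>R f (r k) d)) \<longlonglongrightarrow> B d *\<^sub>R l"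
      by (intro tendsto_intros)
    moreover have "B d > 0"
      using B D d by blast
    ultimately show ?thesis
      by (auto simp: convergent_def)
  qed
  have "convergent (\<lambda>k. f (r k) p)" if p: "p \<in> topspace X" for p
  proof -
    have "Cauchy (\<lambda>k. f (r k) p)"
    proof (rule CauchyI)
      fix e :: real assume e: "e > 0"
      then obtain V where V: "openin X V" "p \<in> V" "\<And>k q. q \<in> V \<Longrightarrow> norm (f k q - f k p) \<le> e / 4"
        using equi[OF p, of "e / 4"] by auto
      then obtain d where d: "d \<in> D" "d \<in> V"
        using p D(3) by (metis in_closure_of)
      obtain M where M: "\<And>m n. m \<ge> M \<Longrightarrow> n \<ge> M \<Longrightarrow> norm (f (r m) d - f (r n) d) < e / 4"
        using CauchyD[OF convergent_Cauchy[OF convD[OF d(1)]], of "e / 4"] e by (metis zero_less_divide_iff zero_less_numeral)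
      have "norm (f (r m) p - f (r n) p) < e" if "m \<ge> M" "n \<ge> M" for m n
      proof -
        have "norm (f (r m) p - f (r n) p) \<le> norm (f (r m) d - f (r m) p) + norm (f (r m) d - f (r n) d)
            + norm (f (r n) d - f (r n) p)"
          by norm
        also have "\<dots> < e"
          using V(3)[OF d(2), of "r m"] V(3)[OF d(2), of "r n"] M[OF that] e by linarith
        finally show ?thesis .
      qed
      then show "\<exists>M. \<forall>m\<ge>M. \<forall>n\<ge>M. norm (f (r m) p - f (r n) p) < e"
        by blast
    qed
    then show ?thesis
      by (simp add: Cauchy_convergent)
  qed
  then obtain g where g: "\<And>p. p \<in> topspace X \<Longrightarrow> (\<lambda>k. f (r k) p) \<longlonglongrightarrow> g p"
    unfolding convergent_def by metis
  have "uniform_limit K (\<lambda>k. f (r k)) g sequentially" if K: "compactin X K" for K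
  proof (rule uniform_limitI)
    fix e :: real assume e: "e > 0"
    show "\<forall>\<^sub>F k in sequentially. \<forall>q\<in>K. dist (f (r k) q) (g q) < e"
    proof (rule compactin_eventually_ballI[OF K])
      fix p assume "p \<in> K"
      then have p: "p \<in> topspace X"
        using K compactin_subset_topspace by blast
      obtain V where V: "openin X V" "p \<in> V" "\<And>k q. q \<in> V \<Longrightarrow> norm (f k q - f k p) \<le> e / 4"
        using equi[OF p, of "e / 4"] e by auto
      have gq: "norm (g q - g p) \<le> e / 4" if q: "q \<in> V" for q
      proof -
        have "(\<lambda>k. norm (f (r k) q - f (r k) p)) \<longlonglongrightarrow> norm (g q - g p)"
          using q V(1) openin_subset p by (intro tendsto_intros g) blast+
        then show ?thesis
          by (rule LIMSEQ_le_const2) (use V(3)[OF q] in blast)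
      qed
      have "\<forall>\<^sub>F k in sequentially. dist (f (r k) p) (g p) < e / 4"
        using tendstoD[OF g[OF p], of "e / 4"] e by simp
      then have "\<forall>\<^sub>F k in sequentially. \<forall>q\<in>V. dist (f (r k) q) (g q) < e"
      proof eventually_elim
        case (elim k)
        show ?case
        proof
          fix q assume q: "q \<in> V"
          have "dist (f (r k) q) (g q) \<le> norm (f (r k) q - f (r k) p) + dist (f (r k) p) (g p) + norm (g q - g p)"
            unfolding dist_norm by norm
          also have "\<dots> < e"
            using elim V(3)[OF q, of "r k"] gq[OF q] e by linarith
          finally show "dist (f (r k) q) (g q) < e" .
        qed
      qed
      then show "\<exists>V. openin X V \<and> p \<in> V \<and> (\<forall>\<^sub>F k in sequentially. \<forall>q\<in>V. dist (f (r k) q) (g q) < e)"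
        using V by blast
    qed
  qed
  with r g show thesis
    using that by blast
qed

text \<open>One chart and one radius serve all members of the family, so that estimates on discs
  hold on a neighbourhood independent of the map. Both Riemann surfaces and the unit disc itself fit
  this description.\<close>

definition locally_CH :: "'m topology \<Rightarrow> 'a::real_inner set \<Rightarrow> ('m \<Rightarrow> 'a) set \<Rightarrow> bool" where
  "locally_CH X \<Omega> \<F> \<longleftrightarrow> (\<forall>p\<in>topspace X. \<exists>W R \<phi>. openin X W \<and> p \<in> W \<and> R > 0 \<and>
     continuous_map (subtopology X W) euclidean \<phi> \<and> \<phi> ` W \<subseteq> ball (\<phi> p) R \<and>
     (\<forall>f\<in>\<F>. \<exists>F\<in>CH_plane (ball (\<phi> p) R) \<Omega>. \<forall>q\<in>W. f q = F (\<phi> q)))"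

section \<open>Estimates for conformal harmonic maps into a convex domain bounded by n - 1
  independent hyperplanes\<close>

locale convex_halfspace_domain =
  fixes \<Omega> N :: "'a::euclidean_space set" and b :: "'a \<Rightarrow> real"
  assumes open_domain: "open \<Omega>" and convex_domain: "convex \<Omega>"
    and indep: "independent N" and card_N: "card N = DIM('a) - 1" and dim2: "DIM('a) \<ge> 2"
    and halfspaces: "open_halfspaces_around \<Omega> N b"
begin

text \<open>On the domain each summand is |a| times the distance to the hyperplane
  \<open>a \<bullet> y = b a\<close>.\<close>

definition slack :: "'a \<Rightarrow> real" where
  "slack x = (\<Sum>a\<in>N. b a - a \<bullet> x)"

lemma finite_N: "finite N"
  using indep independent_imp_finite by blast

lemma less_b: "a \<in> N \<Longrightarrow> y \<in> \<Omega> \<Longrightarrow> a \<bullet> y < b a"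
  using halfspaces by (simp add: open_halfspaces_around_def)

lemma slack_pos:
  assumes "x \<in> \<Omega>"
  shows "slack x > 0"
proof -
  have "N \<noteq> {}"
    using card_N dim2 by auto
  then show ?thesis
    unfolding slack_def using less_b assms finite_N by (intro sum_pos) auto
qed

text \<open>Linear growth lets bounds by \<open>slack\<close> become multiplicative comparisons of 1
  + |f|, and makes the distance to infinity at least logarithmic instead of possibly finite.\<close>

lemma slack_linear_growth:
  obtains A where "A > 0" "\<And>x. slack x \<le> A * (1 + norm x)"
    "\<And>x y. slack y \<le> slack x + A * norm (y - x)"
proof -
  define A where "A = 1 + (\<Sum>a\<in>N. \<bar>b a\<bar> + norm a)"
  have A: "A \<ge> 1"
    unfolding A_def by (simp add: sum_nonneg)
  show thesis
  proof (rule that[of A])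
    show "A > 0"
      using A by simp
    fix x y
    have "b a - a \<bullet> x \<le> (\<bar>b a\<bar> + norm a) * (1 + norm x)" for a
    proof -
      have "- (a \<bullet> x) \<le> norm a * norm x"
        using Cauchy_Schwarz_ineq2[of a x] by linarith
      moreover have "0 \<le> \<bar>b a\<bar> * norm x" "0 \<le> norm a"
        by auto
      ultimately show ?thesis
        unfolding distrib_right distrib_left by linarith
    qed
    then have "slack x \<le> (\<Sum>a\<in>N. (\<bar>b a\<bar> + norm a) * (1 + norm x))"
      unfolding slack_def by (intro sum_mono)
    also have "\<dots> \<le> A * (1 + norm x)"
      unfolding A_def by (simp add: sum_distrib_right distrib_right)
    finally show "slack x \<le> A * (1 + norm x)" .
    have "b a - a \<bullet> y \<le> b a - a \<bullet> x + (\<bar>b a\<bar> + norm a) * norm (y - x)" for a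
    proof -
      have "- (a \<bullet> (y - x)) \<le> norm a * norm (y - x)"
        using Cauchy_Schwarz_ineq2[of a "y - x"] by linarith
      moreover have "0 \<le> \<bar>b a\<bar> * norm (y - x)"
        by auto
      ultimately show ?thesis
        unfolding distrib_right inner_diff_right by linarith
    qed
    then have "slack y \<le> (\<Sum>a\<in>N. b a - a \<bullet> x + (\<bar>b a\<bar> + norm a) * norm (y - x))"
      unfolding slack_def by (intro sum_mono)
    also have "\<dots> \<le> slack x + A * norm (y - x)"
      unfolding A_def slack_def sum.distrib[of "\<lambda>a. b a - a \<bullet> x"] sum_distrib_right[symmetric] distrib_right[of 1]
      by simp
    finally show "slack y \<le> slack x + A * norm (y - x)" .
  qed
qed

text \<open>The gradient bound controls the component along each \<open>a\<close> in
  \<open>N\<close>, and the conformal pair bound recovers the full partial derivatives. In the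
  factor 8, 4 / R comes from adding the bounds for the two partials, and 2 from |Re h| + |Im h|
  \<le> 2 |h|.\<close>

lemma CH_derivative_bound:
  obtains C where "C > 0"
    "\<And>F z R h. F \<in> CH_plane (ball z R) \<Omega> \<Longrightarrow> R > 0 \<Longrightarrow>
      norm (Re h *\<^sub>R partial_x F z + Im h *\<^sub>R partial_y F z) \<le> C / R * slack (F z) * norm h"
proof -
  obtain C where C: "C > 0"
    "\<And>X Y :: 'a. norm X = norm Y \<Longrightarrow> X \<bullet> Y = 0 \<Longrightarrow> norm X \<le> C * (\<Sum>a\<in>N. \<bar>a \<bullet> X\<bar> + \<bar>a \<bullet> Y\<bar>)"
    using conformal_pair_bound[OF indep card_N] by metis
  have "norm (Re h *\<^sub>R partial_x F z + Im h *\<^sub>R partial_y F z) \<le> (8 * C) / R * slack (F z) * norm h"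
    if F: "F \<in> CH_plane (ball z R) \<Omega>" and R: "R > 0" for F z R h
  proof -
    let ?X = "partial_x F z" and ?Y = "partial_y F z"
    have conf: "norm ?X = norm ?Y" "?X \<bullet> ?Y = 0"
      using F R by (auto simp: CH_plane_def conformal_map_on_def)
    have "\<bar>a \<bullet> ?X\<bar> + \<bar>a \<bullet> ?Y\<bar> \<le> 4 / R * (b a - a \<bullet> F z)" if "a \<in> N" for a
    proof -
      have "\<bar>a \<bullet> ?X\<bar> \<le> 2 / R * (b a - a \<bullet> F z)" "\<bar>a \<bullet> ?Y\<bar> \<le> 2 / R * (b a - a \<bullet> F z)"
        using CH_gradient_bound[OF F R, of a "b a" 1] CH_gradient_bound[OF F R, of a "b a" \<i>] less_b[OF that]
        by simp_all
      moreover have "4 / R * (b a - a \<bullet> F z) = 2 / R * (b a - a \<bullet> F z) + 2 / R * (b a - a \<bullet> F z)"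
        by (simp add: field_simps)
      ultimately show ?thesis
        by linarith
    qed
    then have "(\<Sum>a\<in>N. \<bar>a \<bullet> ?X\<bar> + \<bar>a \<bullet> ?Y\<bar>) \<le> (\<Sum>a\<in>N. 4 / R * (b a - a \<bullet> F z))"
      by (intro sum_mono)
    also have "\<dots> = 4 / R * slack (F z)"
      by (simp add: slack_def sum_distrib_left)
    finally have le: "norm ?X \<le> C * (4 / R * slack (F z))"
      using C(2)[OF conf] C(1) by (meson mult_left_mono less_imp_le order_trans)
    have "norm (Re h *\<^sub>R ?X + Im h *\<^sub>R ?Y) \<le> \<bar>Re h\<bar> * norm ?X + \<bar>Im h\<bar> * norm ?X"
      using norm_triangle_ineq[of "Re h *\<^sub>R ?X" "Im h *\<^sub>R ?Y"] conf by simp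
    also have "\<dots> \<le> norm h * norm ?X + norm h * norm ?X"
      by (intro add_mono mult_right_mono abs_Re_le_cmod abs_Im_le_cmod) auto
    also have "\<dots> \<le> 2 * norm h * (C * (4 / R * slack (F z)))"
      using mult_left_mono[OF le, of "2 * norm h"] by simp
    finally show ?thesis
      by (simp add: field_simps)
  qed
  then show thesis
    using C(1) by (intro that[of "8 * C"]) auto
qed

lemma slack_Harnack:
  assumes F: "F \<in> CH_plane (ball z R) \<Omega>" and w: "dist z w < R / 2"
  shows "slack (F w) \<le> exp 2 * slack (F z)" "slack (F z) \<le> exp 2 * slack (F w)"
  unfolding slack_def sum_distrib_left
  by (intro sum_mono CH_Harnack[OF F w] less_b; assumption)+

text \<open>At a point of the half-radius disc the derivative bound is available with radius R / 2,
  which costs the factor 2, and Harnack replaces \<open>slack\<close> there by its value at the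
  centre, which costs \<open>exp 2\<close>.\<close>

lemma CH_local_lipschitz:
  obtains C where "C > 0"
    "\<And>F z R w. F \<in> CH_plane (ball z R) \<Omega> \<Longrightarrow> dist z w < R / 2 \<Longrightarrow>
      norm (F w - F z) \<le> C / R * slack (F z) * dist z w"
proof -
  obtain C where C: "C > 0"
    "\<And>F z R h. F \<in> CH_plane (ball z R) \<Omega> \<Longrightarrow> R > 0 \<Longrightarrow>
      norm (Re h *\<^sub>R partial_x F z + Im h *\<^sub>R partial_y F z) \<le> C / R * slack (F z) * norm h"
    using CH_derivative_bound by metis
  have "norm (F w - F z) \<le> (2 * C * exp 2) / R * slack (F z) * dist z w"
    if F: "F \<in> CH_plane (ball z R) \<Omega>" and w: "dist z w < R / 2" for F z R w
  proof -
    have R: "R > 0"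
      using w zero_le_dist[of z w] by linarith
    let ?B = "ball z (R / 2)"
    have "norm (F w - F z) \<le> (2 * C * exp 2) / R * slack (F z) * norm (w - z)"
    proof (rule differentiable_bound[where S = ?B and f' = "\<lambda>v h. Re h *\<^sub>R partial_x F v + Im h *\<^sub>R partial_y F v"])
      fix v assume v: "v \<in> ?B"
      then have "v \<in> ball z R"
        using R by auto
      then have "F differentiable (at v)"
        using F by (auto simp: CH_plane_def conformal_map_on_def C1_map_on_def)
      from has_derivative_partials[OF this]
      show "(F has_derivative (\<lambda>h. Re h *\<^sub>R partial_x F v + Im h *\<^sub>R partial_y F v)) (at v within ?B)"
        by (rule has_derivative_at_withinI)
      have "ball v (R / 2) \<subseteq> ball z R"
      proof
        fix y assume "y \<in> ball v (R / 2)"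
        then show "y \<in> ball z R"
          using v dist_triangle[of z y v] by simp
      qed
      then have F': "F \<in> CH_plane (ball v (R / 2)) \<Omega>"
        using F CH_plane_mono by blast
      show "onorm (\<lambda>h. Re h *\<^sub>R partial_x F v + Im h *\<^sub>R partial_y F v) \<le> (2 * C * exp 2) / R * slack (F z)"
      proof (rule onorm_le)
        fix h
        have "norm (Re h *\<^sub>R partial_x F v + Im h *\<^sub>R partial_y F v) \<le> C / (R / 2) * slack (F v) * norm h"
          using C(2)[OF F'] R by simp
        also have "\<dots> \<le> C / (R / 2) * (exp 2 * slack (F z)) * norm h"
          using slack_Harnack(1)[OF F] v C(1) R by (intro mult_right_mono mult_left_mono) auto
        finally show "norm (Re h *\<^sub>R partial_x F v + Im h *\<^sub>R partial_y F v)
            \<le> (2 * C * exp 2) / R * slack (F z) * norm h"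
          by (simp add: field_simps)
      qed
    qed (use w R in auto)
    then show ?thesis
      by (simp add: dist_norm norm_minus_commute)
  qed
  then show thesis
    using C(1) by (intro that[of "2 * C * exp 2"]) auto
qed

text \<open>The neighbourhood depends only on the chart and \<epsilon>: it serves every member of
  the family and, in the last clause, every half-space containing the domain. The latter matters
  because supporting functionals are chosen after a limit has been taken.\<close>

lemma locally_CH_Harnack:
  assumes X: "locally_CH X \<Omega> \<F>" and p: "p \<in> topspace X" and \<epsilon>: "\<epsilon> > 0"
  obtains V where "openin X V" "p \<in> V"
    "\<And>f q. f \<in> \<F> \<Longrightarrow> q \<in> V \<Longrightarrow> norm (f q - f p) \<le> \<epsilon> * slack (f p)"
    "\<And>f q. f \<in> \<F> \<Longrightarrow> q \<in> V \<Longrightarrow> slack (f p) \<le> exp 2 * slack (f q)"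
    "\<And>f q a c. f \<in> \<F> \<Longrightarrow> q \<in> V \<Longrightarrow> \<forall>y\<in>\<Omega>. a \<bullet> y < c \<Longrightarrow>
       c - a \<bullet> f q \<le> exp 2 * (c - a \<bullet> f p) \<and> c - a \<bullet> f p \<le> exp 2 * (c - a \<bullet> f q)"
proof -
  obtain C where C: "C > 0"
    "\<And>F z R w. F \<in> CH_plane (ball z R) \<Omega> \<Longrightarrow> dist z w < R / 2 \<Longrightarrow>
      norm (F w - F z) \<le> C / R * slack (F z) * dist z w"
    using CH_local_lipschitz by metis
  obtain W R \<phi> where W: "openin X W" "p \<in> W" "R > 0"
      "continuous_map (subtopology X W) euclidean \<phi>"
    and F: "\<And>f. f \<in> \<F> \<Longrightarrow> \<exists>F\<in>CH_plane (ball (\<phi> p) R) \<Omega>. \<forall>q\<in>W. f q = F (\<phi> q)"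
    using X p unfolding locally_CH_def by metis
  \<comment> \<open>R / 2 keeps the Harnack inequalities applicable; the second entry makes the
    Lipschitz factor C / R times the distance at most \<epsilon>.\<close>
  define \<delta> where "\<delta> = min (R / 2) (\<epsilon> * R / C)"
  have "\<epsilon> * R / C > 0"
    using W(3) C(1) \<epsilon> by simp
  then have \<delta>: "\<delta> > 0" "\<delta> \<le> R / 2" "\<delta> \<le> \<epsilon> * R / C"
    using W(3) unfolding \<delta>_def by linarith+
  define V where "V = {q \<in> topspace (subtopology X W). \<phi> q \<in> ball (\<phi> p) \<delta>}"
  have "openin (subtopology X W) V"
    unfolding V_def using W(4) by (rule openin_continuous_map_preimage) simp
  then have "openin X V"
    using W(1) openin_trans_full by blast
  moreover have "p \<in> V"
    using W p \<delta> by (simp add: V_def)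
  moreover have VD: "q \<in> W" "dist (\<phi> p) (\<phi> q) < \<delta>" "dist (\<phi> p) (\<phi> q) < R / 2" if "q \<in> V" for q
    using that \<delta> by (auto simp: V_def)
  have "norm (f q - f p) \<le> \<epsilon> * slack (f p)" "slack (f p) \<le> exp 2 * slack (f q)"
    if f: "f \<in> \<F>" and q: "q \<in> V" for f q
  proof -
    obtain G where G: "G \<in> CH_plane (ball (\<phi> p) R) \<Omega>" "\<And>q. q \<in> W \<Longrightarrow> f q = G (\<phi> q)"
      using F[OF f] by blast
    have "G (\<phi> p) \<in> \<Omega>"
      using G(1) W(3) by (auto simp: CH_plane_def)
    then have s: "slack (G (\<phi> p)) > 0"
      by (rule slack_pos)
    have "C / R * dist (\<phi> p) (\<phi> q) \<le> C / R * (\<epsilon> * R / C)"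
      using VD[OF q] \<delta> C(1) W(3) by (intro mult_left_mono) auto
    then have "C / R * dist (\<phi> p) (\<phi> q) \<le> \<epsilon>"
      using C(1) W(3) by simp
    then have "C / R * dist (\<phi> p) (\<phi> q) * slack (G (\<phi> p)) \<le> \<epsilon> * slack (G (\<phi> p))"
      using s by (intro mult_right_mono) auto
    then have "norm (G (\<phi> q) - G (\<phi> p)) \<le> \<epsilon> * slack (G (\<phi> p))"
      using C(2)[OF G(1) VD(3)[OF q]] by (simp add: mult_ac)
    then show "norm (f q - f p) \<le> \<epsilon> * slack (f p)"
      using G(2) VD(1)[OF q] W(2) by simp
    show "slack (f p) \<le> exp 2 * slack (f q)"
      using slack_Harnack(2)[OF G(1) VD(3)[OF q]] G(2) VD(1)[OF q] W(2) by simp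
  qed
  moreover have "c - a \<bullet> f q \<le> exp 2 * (c - a \<bullet> f p) \<and> c - a \<bullet> f p \<le> exp 2 * (c - a \<bullet> f q)"
    if f: "f \<in> \<F>" and q: "q \<in> V" and a: "\<forall>y\<in>\<Omega>. a \<bullet> y < c" for f q a c
  proof -
    obtain G where G: "G \<in> CH_plane (ball (\<phi> p) R) \<Omega>" "\<And>q. q \<in> W \<Longrightarrow> f q = G (\<phi> q)"
      using F[OF f] by blast
    show ?thesis
      using CH_Harnack[OF G(1) VD(3)[OF q], of a c] a G(2) VD(1)[OF q] W(2) by simp
  qed
  ultimately show thesis
    using that by blast
qed

text \<open>With \<epsilon> = 1, the displacement |f(q) - f(p)| is at most
  \<open>slack (f p)\<close>, which is linearly bounded in |f(p)| and, after Harnack, also in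
  |f(q)|. Hence boundedness of a sequence of maps, as well as escape to infinity, spreads to nearby
  points.\<close>

lemma locally_CH_norm_comparison:
  assumes X: "locally_CH X \<Omega> \<F>" and p: "p \<in> topspace X"
  obtains V C where "openin X V" "p \<in> V" "C > 0"
    "\<And>f q. f \<in> \<F> \<Longrightarrow> q \<in> V \<Longrightarrow> 1 + norm (f q) \<le> C * (1 + norm (f p))"
    "\<And>f q. f \<in> \<F> \<Longrightarrow> q \<in> V \<Longrightarrow> 1 + norm (f p) \<le> C * (1 + norm (f q))"
proof -
  obtain A where A: "A > 0" "\<And>x. slack x \<le> A * (1 + norm x)"
    using slack_linear_growth by metis
  obtain V where V: "openin X V" "p \<in> V"
    "\<And>f q. f \<in> \<F> \<Longrightarrow> q \<in> V \<Longrightarrow> norm (f q - f p) \<le> 1 * slack (f p)"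
    "\<And>f q. f \<in> \<F> \<Longrightarrow> q \<in> V \<Longrightarrow> slack (f p) \<le> exp 2 * slack (f q)"
    by (rule locally_CH_Harnack[OF X p zero_less_one]) (rule that; assumption)
  define C where "C = 1 + exp 2 * A"
  show thesis
  proof (rule that[OF V(1,2), of C])
    show "C > 0"
      using A(1) by (simp add: C_def add_pos_pos)
    fix f q assume f: "f \<in> \<F>" "q \<in> V"
    have n: "norm (f q - f p) \<le> slack (f p)"
      using V(3)[OF f] by simp
    have "norm (f q) \<le> norm (f p) + slack (f p)"
      using n norm_triangle_ineq2[of "f q" "f p"] by linarith
    also have "slack (f p) \<le> A * (1 + norm (f p))"
      by (rule A)
    also have "\<dots> \<le> exp 2 * A * (1 + norm (f p))"
      using A(1) by (intro mult_right_mono) (auto simp: add_nonneg_nonneg)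
    finally show "1 + norm (f q) \<le> C * (1 + norm (f p))"
      by (simp add: C_def algebra_simps)
    have "norm (f p) \<le> norm (f q) + slack (f p)"
      using n norm_triangle_ineq2[of "f p" "f q"] norm_minus_commute[of "f p"] by simp
    also have "slack (f p) \<le> exp 2 * (A * (1 + norm (f q)))"
      using V(4)[OF f] A(2)[of "f q"] by (meson exp_ge_zero mult_left_mono order_trans)
    finally show "1 + norm (f p) \<le> C * (1 + norm (f q))"
      by (simp add: C_def algebra_simps)
  qed
qed

lemma locally_CH_boundedness_spreads:
  assumes X: "locally_CH X \<Omega> \<F>" "connected_space X" and f: "\<And>k. f k \<in> \<F>"
    and pq: "p \<in> topspace X" "q \<in> topspace X" "bounded (range (\<lambda>k. f k p))"
  shows "bounded (range (\<lambda>k. f k q))"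
proof (rule connected_space_locally_constant[OF X(2) pq(1,2), where P = "\<lambda>p. bounded (range (\<lambda>k. f k p))"])
  fix p assume p: "p \<in> topspace X"
  obtain V C where V: "openin X V" "p \<in> V" "C > 0"
    "\<And>f q. f \<in> \<F> \<Longrightarrow> q \<in> V \<Longrightarrow> 1 + norm (f q) \<le> C * (1 + norm (f p))"
    "\<And>f q. f \<in> \<F> \<Longrightarrow> q \<in> V \<Longrightarrow> 1 + norm (f p) \<le> C * (1 + norm (f q))"
    using locally_CH_norm_comparison[OF X(1) p] by blast
  have *: "bounded (range (\<lambda>k. f k y))"
    if b: "bounded (range (\<lambda>k. f k x))" and le: "\<And>k. 1 + norm (f k y) \<le> C * (1 + norm (f k x))" for x y
  proof -
    obtain B where B: "\<And>k. norm (f k x) \<le> B"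
      using b by (auto simp: bounded_iff)
    have "norm (f k y) \<le> C * (1 + B)" for k
    proof -
      have "C * (1 + norm (f k x)) \<le> C * (1 + B)"
        using V(3) B by (intro mult_left_mono) auto
      with le[of k] show ?thesis
        by linarith
    qed
    then show ?thesis
      by (auto simp: bounded_iff)
  qed
  have "bounded (range (\<lambda>k. f k q)) \<longleftrightarrow> bounded (range (\<lambda>k. f k p))" if "q \<in> V" for q
    using *[of p q] *[of q p] V(4,5) f that by blast
  then show "\<exists>V. openin X V \<and> p \<in> V \<and>
      (\<forall>q\<in>V. bounded (range (\<lambda>k. f k q)) \<longleftrightarrow> bounded (range (\<lambda>k. f k p)))"
    using V(1,2) by blast
qed (fact pq(3))

text \<open>Positivity of c - a . f_k can be lost in the limit, but the Harnack constants do not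
  depend on k and survive. So the zeros of c - a . g, for a functional supporting the domain at
  g(p), form a set that is open and closed, and one zero forces all points to be zeros.\<close>

lemma locally_CH_limit_dichotomy:
  assumes X: "locally_CH X \<Omega> \<F>" "connected_space X" and f: "\<And>k. f k \<in> \<F>"
    and into: "\<And>k p. p \<in> topspace X \<Longrightarrow> f k p \<in> \<Omega>"
    and lim: "\<And>p. p \<in> topspace X \<Longrightarrow> (\<lambda>k. f k p) \<longlonglongrightarrow> g p"
    and p: "p \<in> topspace X" "g p \<notin> \<Omega>" and q: "q \<in> topspace X"
  shows "g q \<notin> \<Omega>"
proof -
  obtain a c where a: "a \<noteq> 0" "a \<bullet> g p \<ge> c" "\<And>y. y \<in> \<Omega> \<Longrightarrow> a \<bullet> y < c"
    using supporting_halfspace_open_convex[OF convex_domain open_domain p(2)] by blast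
  have lima: "(\<lambda>k. a \<bullet> f k x) \<longlonglongrightarrow> a \<bullet> g x" if "x \<in> topspace X" for x
    using that by (intro tendsto_intros lim)
  have le: "a \<bullet> g x \<le> c" if x: "x \<in> topspace X" for x
    using lima[OF x] by (rule LIMSEQ_le_const2) (use less_imp_le[OF a(3)[OF into[OF x]]] in blast)
  have "a \<bullet> g q = c"
  proof (rule connected_space_locally_constant[OF X(2) p(1) q, where P = "\<lambda>x. a \<bullet> g x = c"])
    show "a \<bullet> g p = c"
      using a le p by force
    fix x assume x: "x \<in> topspace X"
    obtain V where V: "openin X V" "x \<in> V"
      "\<And>f q a c. f \<in> \<F> \<Longrightarrow> q \<in> V \<Longrightarrow> \<forall>y\<in>\<Omega>. a \<bullet> y < c \<Longrightarrow>
       c - a \<bullet> f q \<le> exp 2 * (c - a \<bullet> f x) \<and> c - a \<bullet> f x \<le> exp 2 * (c - a \<bullet> f q)"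
      by (rule locally_CH_Harnack[OF X(1) x zero_less_one]) (rule that; assumption)
    have "a \<bullet> g y = c \<longleftrightarrow> a \<bullet> g x = c" if y: "y \<in> V" for y
    proof -
      have yt: "y \<in> topspace X"
        using V(1) y openin_subset by blast
      have H: "c - a \<bullet> f k y \<le> exp 2 * (c - a \<bullet> f k x) \<and> c - a \<bullet> f k x \<le> exp 2 * (c - a \<bullet> f k y)" for k
        using V(3)[OF f y] a(3) by blast
      have "c - a \<bullet> g y \<le> exp 2 * (c - a \<bullet> g x)"
        by (rule LIMSEQ_le[where X = "\<lambda>k. c - a \<bullet> f k y" and Y = "\<lambda>k. exp 2 * (c - a \<bullet> f k x)"])
          (use H in \<open>auto intro!: tendsto_intros lima x yt\<close>)
      moreover have "c - a \<bullet> g x \<le> exp 2 * (c - a \<bullet> g y)"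
        by (rule LIMSEQ_le[where X = "\<lambda>k. c - a \<bullet> f k x" and Y = "\<lambda>k. exp 2 * (c - a \<bullet> f k y)"])
          (use H in \<open>auto intro!: tendsto_intros lima x yt\<close>)
      ultimately show ?thesis
        using le[OF x] le[OF yt] by auto
    qed
    with V(1,2) show "\<exists>V. openin X V \<and> x \<in> V \<and> (\<forall>y\<in>V. a \<bullet> g y = c \<longleftrightarrow> a \<bullet> g x = c)"
      by blast
  qed
  with a(3) show ?thesis
    by force
qed

text \<open>The alternative is decided at one base point. If some subsequence is bounded there, it
  is bounded at every point, hence equicontinuous, and a limit lies either in the domain or entirely
  outside it. If none is, the norms tend to infinity locally uniformly and the original sequence
  already diverges.\<close>

theorem locally_CH_normal_family:
  assumes X: "locally_CH X \<Omega> \<F>" "connected_space X" "second_countable X" "topspace X \<noteq> {}"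
    and into: "\<And>f. f \<in> \<F> \<Longrightarrow> f \<in> topspace X \<rightarrow> \<Omega>"
  shows "normal_family X \<Omega> \<F>"
  unfolding normal_family_def
proof (intro allI impI)
  fix f :: "nat \<Rightarrow> 'b \<Rightarrow> 'a" assume "range f \<subseteq> \<F>"
  then have f: "f k \<in> \<F>" for k
    by blast
  obtain p0 where p0: "p0 \<in> topspace X"
    using X(4) by blast
  show "\<exists>r :: nat \<Rightarrow> nat. strict_mono r \<and>
      ((\<exists>g \<in> topspace X \<rightarrow> \<Omega>. \<forall>K. compactin X K \<longrightarrow> uniform_limit K (\<lambda>i. f (r i)) g sequentially) \<or>
        compactly_divergent X \<Omega> (\<lambda>i. f (r i)))"
  proof (cases "\<exists>r :: nat \<Rightarrow> nat. strict_mono r \<and> bounded (range (\<lambda>k. f (r k) p0))")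
    case True
    then obtain r :: "nat \<Rightarrow> nat" where r: "strict_mono r" "bounded (range (\<lambda>k. f (r k) p0))"
      by blast
    have bdd: "bounded (range (\<lambda>k. f (r k) p))" if "p \<in> topspace X" for p
      by (rule locally_CH_boundedness_spreads[where f = "\<lambda>k. f (r k)", OF X(1,2) f p0 that r(2)])
    obtain A where A: "A > 0" "\<And>x. slack x \<le> A * (1 + norm x)"
      using slack_linear_growth by metis
    have equi: "\<exists>V. openin X V \<and> p \<in> V \<and> (\<forall>k. \<forall>q\<in>V. norm (f (r k) q - f (r k) p) \<le> \<epsilon>)"
      if p: "p \<in> topspace X" and \<epsilon>: "\<epsilon> > 0" for p \<epsilon>
    proof -
      obtain B where B: "B > 0" "\<And>k. norm (f (r k) p) \<le> B"
        using bdd[OF p] by (auto simp: bounded_pos)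
      \<comment> \<open>Chosen to cancel the bound A (1 + B) for \<open>slack\<close> at
        \<open>p\<close>.\<close>
      define \<delta> where "\<delta> = \<epsilon> / (A * (1 + B))"
      have \<delta>: "\<delta> > 0"
        using \<epsilon> A B by (simp add: \<delta>_def add_pos_pos)
      obtain V where V: "openin X V" "p \<in> V"
        "\<And>f q. f \<in> \<F> \<Longrightarrow> q \<in> V \<Longrightarrow> norm (f q - f p) \<le> \<delta> * slack (f p)"
        by (rule locally_CH_Harnack[OF X(1) p \<delta>]) (rule that; assumption)
      have "norm (f (r k) q - f (r k) p) \<le> \<epsilon>" if q: "q \<in> V" for k q
      proof -
        have "slack (f (r k) p) \<le> A * (1 + B)"
          using A(2)[of "f (r k) p"] mult_left_mono[of "1 + norm (f (r k) p)" "1 + B" A] B(2)[of k] A(1)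
          by linarith
        then have "\<delta> * slack (f (r k) p) \<le> \<delta> * (A * (1 + B))"
          using \<delta> by (intro mult_left_mono) auto
        also have "\<dots> = \<epsilon>"
          using A B by (simp add: \<delta>_def)
        finally show ?thesis
          using V(3)[OF f q, of "r k"] by linarith
      qed
      then show ?thesis
        using V by blast
    qed
    obtain r' g where r': "strict_mono (r' :: nat \<Rightarrow> nat)"
      and lim: "\<And>p. p \<in> topspace X \<Longrightarrow> (\<lambda>k. f (r (r' k)) p) \<longlonglongrightarrow> g p"
      and ulim: "\<And>K. compactin X K \<Longrightarrow> uniform_limit K (\<lambda>k. f (r (r' k))) g sequentially"
      using equicontinuous_convergent_subsequence[OF X(3) bdd equi] by metis
    have rr: "strict_mono (r \<circ> r')"
      using r(1) r' strict_mono_o by blast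
    show ?thesis
    proof (cases "g \<in> topspace X \<rightarrow> \<Omega>")
      case True
      then show ?thesis
        using rr ulim by (intro exI[of _ "r \<circ> r'"]) auto
    next
      case False
      then obtain p where p: "p \<in> topspace X" "g p \<notin> \<Omega>"
        by blast
      have out: "g q \<notin> \<Omega>" if "q \<in> topspace X" for q
        by (rule locally_CH_limit_dichotomy[where f = "\<lambda>k. f (r (r' k))", OF X(1,2) f _ lim p that])
          (use f into in blast)
      have "compactly_divergent X \<Omega> (\<lambda>i. f (r (r' i)))"
        unfolding compactly_divergent_def
      proof (intro allI impI)
        fix K K' assume K: "compactin X K \<and> compact K' \<and> K' \<subseteq> \<Omega>"
        \<comment> \<open>A value in \<open>K'\<close> that is within \<open>e\<close> of the limit
          would put the limit inside the domain.\<close>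
        obtain e where e: "e > 0" "(\<Union>x\<in>K'. ball x e) \<subseteq> \<Omega>"
          using compact_subset_open_imp_ball_epsilon_subset[of K' \<Omega>] K open_domain by blast
        have "\<forall>\<^sub>F k in sequentially. \<forall>q\<in>K. dist (f (r (r' k)) q) (g q) < e"
          using uniform_limitD[OF ulim e(1)] K by blast
        then show "\<forall>\<^sub>F k in sequentially. f (r (r' k)) ` K \<inter> K' = {}"
        proof eventually_elim
          case (elim k)
          have "f (r (r' k)) q \<notin> K'" if q: "q \<in> K" for q
          proof
            assume "f (r (r' k)) q \<in> K'"
            then have "g q \<in> \<Omega>"
              using elim q e(2) by force
            then show False
              using out q K compactin_subset_topspace by blast
          qed
          then show ?case
            by blast
        qed
      qed
      then show ?thesis
        using rr by (intro exI[of _ "r \<circ> r'"]) auto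
    qed
  next
    case False
    \<comment> \<open>Infinitely many indices with small values at \<open>p\<close> would give a
      subsequence bounded at \<open>p\<close>, hence bounded at \<open>p0\<close>.\<close>
    have unbdd: "\<forall>\<^sub>F k in sequentially. norm (f k p) > B" if p: "p \<in> topspace X" for p B
    proof (rule ccontr)
      assume "\<not> (\<forall>\<^sub>F k in sequentially. norm (f k p) > B)"
      then have "infinite {k. norm (f k p) \<le> B}"
        by (simp add: frequently_cofinite[symmetric] cofinite_eq_sequentially frequently_def not_le)
      then obtain r :: "nat \<Rightarrow> nat" where r: "strict_mono r" "\<And>k. r k \<in> {k. norm (f k p) \<le> B}"
        using infinite_enumerate by metis
      then have "bounded (range (\<lambda>k. f (r k) p))"
        by (auto simp: bounded_iff)
      then have "bounded (range (\<lambda>k. f (r k) p0))"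
        by (rule locally_CH_boundedness_spreads[where f = "\<lambda>k. f (r k)", OF X(1,2) f p p0])
      with False r(1) show False
        by blast
    qed
    have "compactly_divergent X \<Omega> f"
      unfolding compactly_divergent_def
    proof (intro allI impI)
      fix K K' assume K: "compactin X K \<and> compact K' \<and> K' \<subseteq> \<Omega>"
      then obtain B where B: "B > 0" "\<And>x. x \<in> K' \<Longrightarrow> norm x \<le> B"
        using compact_imp_bounded by (metis bounded_pos)
      have "\<forall>\<^sub>F k in sequentially. \<forall>q\<in>K. norm (f k q) > B"
      proof (rule compactin_eventually_ballI)
        fix p assume "p \<in> K"
        then have p: "p \<in> topspace X"
          using K compactin_subset_topspace by blast
        obtain V C where V: "openin X V" "p \<in> V" "C > 0"
          "\<And>f q. f \<in> \<F> \<Longrightarrow> q \<in> V \<Longrightarrow> 1 + norm (f p) \<le> C * (1 + norm (f q))"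
          using locally_CH_norm_comparison[OF X(1) p] by metis
        \<comment> \<open>By the norm comparison, exceeding C (1 + B) at the point \<open>p\<close>
          alone forces norms above \<open>B\<close> on all of \<open>V\<close>.\<close>
        have "\<forall>\<^sub>F k in sequentially. \<forall>q\<in>V. norm (f k q) > B"
          using unbdd[OF p, of "C * (1 + B)"]
        proof eventually_elim
          case (elim k)
          have "norm (f k q) > B" if q: "q \<in> V" for q
          proof -
            have "C * (1 + B) < C * (1 + norm (f k q))"
              using elim V(4)[OF f q, of k] by linarith
            then show ?thesis
              using V(3) by simp
          qed
          then show ?case
            by blast
        qed
        then show "\<exists>V. openin X V \<and> p \<in> V \<and> (\<forall>\<^sub>F k in sequentially. \<forall>q\<in>V. norm (f k q) > B)"
          using V(1,2) by blast
      qed (use K in blast)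
      then show "\<forall>\<^sub>F k in sequentially. f k ` K \<inter> K' = {}"
        by eventually_elim (use B(2) in force)
    qed
    then show ?thesis
      by (intro exI[of _ id]) (auto simp: strict_mono_id)
  qed
qed

end

subsection \<open>The minimal length of paths\<close>

lemma CH_planeI:
  assumes D: "open D"
    and f: "\<And>z. z \<in> D \<Longrightarrow> (f has_derivative (\<lambda>h. Re h *\<^sub>R p z + Im h *\<^sub>R q z)) (at z)"
    and p: "\<And>z. z \<in> D \<Longrightarrow> (p has_derivative (\<lambda>h. Re h *\<^sub>R px z + Im h *\<^sub>R py z)) (at z)"
    and q: "\<And>z. z \<in> D \<Longrightarrow> (q has_derivative (\<lambda>h. Re h *\<^sub>R qx z + Im h *\<^sub>R qy z)) (at z)"
    and cont: "continuous_on D px" "continuous_on D py" "continuous_on D qx" "continuous_on D qy"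
    and conf: "\<And>z. z \<in> D \<Longrightarrow> norm (p z) = norm (q z)" "\<And>z. z \<in> D \<Longrightarrow> p z \<bullet> q z = 0"
    and harm: "\<And>z. z \<in> D \<Longrightarrow> px z + qy z = 0"
    and into: "\<And>z. z \<in> D \<Longrightarrow> f z \<in> \<Omega>"
  shows "f \<in> CH_plane D \<Omega>"
proof -
  have eq: "partial_x f z = p z" "partial_y f z = q z" if "z \<in> D" for z
    using partials_eqI[OF f[OF that]] by auto
  have px': "(partial_x f has_derivative (\<lambda>h. Re h *\<^sub>R px z + Im h *\<^sub>R py z)) (at z)" if "z \<in> D" for z
    using p[OF that] D that by (rule has_derivative_transform_within_open) (simp add: eq)
  have py': "(partial_y f has_derivative (\<lambda>h. Re h *\<^sub>R qx z + Im h *\<^sub>R qy z)) (at z)" if "z \<in> D" for z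
    using q[OF that] D that by (rule has_derivative_transform_within_open) (simp add: eq)
  have contD: "continuous_on D (partial_x f)" "continuous_on D (partial_y f)"
    using px' py' by (auto intro!: continuous_at_imp_continuous_on has_derivative_continuous)
  have C: "C1_map_on D f" "C1_map_on D (partial_x f)" "C1_map_on D (partial_y f)"
    unfolding C1_map_on_def using partials_eqI[OF f] partials_eqI[OF px'] partials_eqI[OF py'] cont contD
    by (simp_all cong: continuous_on_cong)
  show ?thesis
    unfolding CH_plane_def conformal_map_on_def harmonic_map_on_def C2_map_on_def
    using C conf harm into eq partials_eqI[OF px'] partials_eqI[OF py'] by auto
qed

lemma affine_conformal_CH_plane:
  assumes D: "open D" and uw: "norm u = norm w" "u \<bullet> w = 0"
    and into: "\<And>z. z \<in> D \<Longrightarrow> x + Re z *\<^sub>R u + Im z *\<^sub>R w \<in> \<Omega>"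
  shows "(\<lambda>z. x + Re z *\<^sub>R u + Im z *\<^sub>R w) \<in> CH_plane D \<Omega>"
    and "partial_x (\<lambda>z. x + Re z *\<^sub>R u + Im z *\<^sub>R w) z = u"
proof -
  have d: "((\<lambda>z. x + Re z *\<^sub>R u + Im z *\<^sub>R w) has_derivative (\<lambda>h. Re h *\<^sub>R u + Im h *\<^sub>R w)) (at z)" for z
    by (auto intro!: derivative_eq_intros)
  show "partial_x (\<lambda>z. x + Re z *\<^sub>R u + Im z *\<^sub>R w) z = u"
    by (rule partials_eqI[OF d])
  show "(\<lambda>z. x + Re z *\<^sub>R u + Im z *\<^sub>R w) \<in> CH_plane D \<Omega>"
    by (rule CH_planeI[OF D d, where px = "\<lambda>_. 0" and py = "\<lambda>_. 0" and qx = "\<lambda>_. 0" and qy = "\<lambda>_. 0"])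
      (use uw into in auto)
qed

text \<open>Rotating the disc by a half turn reverses the velocity at the centre; this makes the
  minimal metric even in the vector and the distance symmetric.\<close>

lemma CH_plane_reflect:
  assumes f: "f \<in> CH_plane unit_disc \<Omega>"
  shows "(\<lambda>z. f (- z)) \<in> CH_plane unit_disc \<Omega>" "partial_x (\<lambda>z. f (- z)) 0 = - partial_x f 0"
proof -
  let ?D = "unit_disc"
  let ?xx = "partial_x (partial_x f)" and ?xy = "partial_y (partial_x f)"
    and ?yx = "partial_x (partial_y f)" and ?yy = "partial_y (partial_y f)"
  have D: "- z \<in> ?D" if "z \<in> ?D" for z :: complex
    using that by simp
  have f': "f differentiable (at z)" "partial_x f differentiable (at z)" "partial_y f differentiable (at z)"
    "norm (partial_x f z) = norm (partial_y f z)" "partial_x f z \<bullet> partial_y f z = 0"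
    "?xx z + ?yy z = 0" "f z \<in> \<Omega>" if "z \<in> ?D" for z
    using f that unfolding CH_plane_def conformal_map_on_def harmonic_map_on_def C2_map_on_def C1_map_on_def
    by blast+
  have cont: "continuous_on ?D ?xx" "continuous_on ?D ?xy" "continuous_on ?D ?yx" "continuous_on ?D ?yy"
    using f unfolding CH_plane_def conformal_map_on_def harmonic_map_on_def C2_map_on_def C1_map_on_def
    by blast+
  have refl: "((\<lambda>z. g (- z)) has_derivative (\<lambda>h. Re h *\<^sub>R - a + Im h *\<^sub>R - b)) (at z)"
    if "(g has_derivative (\<lambda>h. Re h *\<^sub>R a + Im h *\<^sub>R b)) (at (- z))" for g :: "complex \<Rightarrow> 'a" and a b z
  proof -
    have "(uminus has_derivative uminus) (at z)"
      by (auto intro!: derivative_eq_intros)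
    from has_derivative_compose[OF this that] show ?thesis
      by simp
  qed
  have refl': "((\<lambda>z. - g (- z)) has_derivative (\<lambda>h. Re h *\<^sub>R a + Im h *\<^sub>R b)) (at z)"
    if "(g has_derivative (\<lambda>h. Re h *\<^sub>R a + Im h *\<^sub>R b)) (at (- z))" for g :: "complex \<Rightarrow> 'a" and a b z
    using has_derivative_minus[OF refl[OF that]] by (simp add: add.commute)
  have contr: "continuous_on ?D (\<lambda>z. g (- z))" if "continuous_on ?D g" for g :: "complex \<Rightarrow> 'a"
    by (rule continuous_on_compose2[OF that]) (auto intro!: continuous_intros)
  show "(\<lambda>z. f (- z)) \<in> CH_plane ?D \<Omega>"
  proof (rule CH_planeI[OF open_ball])
    fix z assume "z \<in> ?D"
    note z = D[OF this]
    show "((\<lambda>z. f (- z)) has_derivative (\<lambda>h. Re h *\<^sub>R - partial_x f (- z) + Im h *\<^sub>R - partial_y f (- z))) (at z)"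
      by (intro refl has_derivative_partials f' z)
    show "((\<lambda>z. - partial_x f (- z)) has_derivative (\<lambda>h. Re h *\<^sub>R ?xx (- z) + Im h *\<^sub>R ?xy (- z))) (at z)"
      by (intro refl' has_derivative_partials f' z)
    show "((\<lambda>z. - partial_y f (- z)) has_derivative (\<lambda>h. Re h *\<^sub>R ?yx (- z) + Im h *\<^sub>R ?yy (- z))) (at z)"
      by (intro refl' has_derivative_partials f' z)
    show "norm (- partial_x f (- z)) = norm (- partial_y f (- z))"
      "- partial_x f (- z) \<bullet> - partial_y f (- z) = 0" "?xx (- z) + ?yy (- z) = 0" "f (- z) \<in> \<Omega>"
      using f'[OF z] by simp_all
  qed (intro contr cont)+
  have "(f has_derivative (\<lambda>h. Re h *\<^sub>R partial_x f 0 + Im h *\<^sub>R partial_y f 0)) (at (- 0))"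
    using has_derivative_partials[OF f'(1)[of 0]] by simp
  from partials_eqI(1)[OF refl[OF this]] show "partial_x (\<lambda>z. f (- z)) 0 = - partial_x f 0" .
qed

section \<open>The minimal pseudometric as an infimum of candidates\<close>

definition metric_candidates :: "'a::real_inner set \<Rightarrow> 'a \<Rightarrow> 'a \<Rightarrow> real set" where
  "metric_candidates \<Omega> x v =
     {1 / r | r. r > 0 \<and> (\<exists>f\<in>CH_plane unit_disc \<Omega>. f 0 = x \<and> partial_x f 0 = r *\<^sub>R v)}"

lemma minimal_pseudometric_eq: "minimal_pseudometric \<Omega> x v = Inf (metric_candidates \<Omega> x v)"
  by (simp add: minimal_pseudometric_def metric_candidates_def)

lemma metric_candidates_nonneg: "c \<in> metric_candidates \<Omega> x v \<Longrightarrow> c \<ge> 0"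
  by (auto simp: metric_candidates_def)

lemma bdd_below_metric_candidates: "bdd_below (metric_candidates \<Omega> x v)"
  using metric_candidates_nonneg by (rule bdd_belowI)

lemma minimal_pseudometric_minus: "minimal_pseudometric \<Omega> x (- v) = minimal_pseudometric \<Omega> x v"
proof -
  have sub: "metric_candidates \<Omega> x w \<subseteq> metric_candidates \<Omega> x (- w)" for w :: 'a
  proof
    fix c assume "c \<in> metric_candidates \<Omega> x w"
    then obtain r f where c: "c = 1 / r" "r > 0" and f: "f \<in> CH_plane unit_disc \<Omega>" "f 0 = x" "partial_x f 0 = r *\<^sub>R w"
      unfolding metric_candidates_def by blast
    have "(\<lambda>z. f (- z)) \<in> CH_plane unit_disc \<Omega>" "f (- 0) = x" "partial_x (\<lambda>z. f (- z)) 0 = r *\<^sub>R - w"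
      using CH_plane_reflect[OF f(1)] f(2,3) by simp_all
    then show "c \<in> metric_candidates \<Omega> x (- w)"
      unfolding metric_candidates_def using c
      by (intro CollectI exI[of _ r] conjI bexI[of _ "\<lambda>z. f (- z)"]) auto
  qed
  have "metric_candidates \<Omega> x v = metric_candidates \<Omega> x (- v)"
    using sub[of v] sub[of "- v"] by auto
  then show ?thesis
    by (simp add: minimal_pseudometric_eq)
qed

lemma metric_candidates_scaleR:
  assumes c: "c > 0" and y: "y \<in> metric_candidates \<Omega> x v"
  shows "c * y \<in> metric_candidates \<Omega> x (c *\<^sub>R v)"
proof -
  obtain r f where r: "y = 1 / r" "r > 0"
    and f: "f \<in> CH_plane unit_disc \<Omega>" "f 0 = x" "partial_x f 0 = r *\<^sub>R v"
    using y unfolding metric_candidates_def by blast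
  have "c * y = 1 / (r / c)" "r / c > 0" "partial_x f 0 = (r / c) *\<^sub>R (c *\<^sub>R v)"
    using c r f by simp_all
  with f(1,2) show ?thesis
    unfolding metric_candidates_def by blast
qed

lemma minimal_pseudometric_scaleR:
  assumes c: "c > 0" and ne: "metric_candidates \<Omega> x v \<noteq> {}"
  shows "minimal_pseudometric \<Omega> x (c *\<^sub>R v) = c * minimal_pseudometric \<Omega> x v"
proof (rule antisym)
  have "minimal_pseudometric \<Omega> x (c *\<^sub>R v) / c \<le> minimal_pseudometric \<Omega> x v"
    unfolding minimal_pseudometric_eq
  proof (rule cInf_greatest[OF ne])
    fix y assume "y \<in> metric_candidates \<Omega> x v"
    from metric_candidates_scaleR[OF c this]
    have "Inf (metric_candidates \<Omega> x (c *\<^sub>R v)) \<le> c * y"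
      using bdd_below_metric_candidates cInf_lower by blast
    then show "Inf (metric_candidates \<Omega> x (c *\<^sub>R v)) / c \<le> y"
      using c by (simp add: field_simps)
  qed
  then show "minimal_pseudometric \<Omega> x (c *\<^sub>R v) \<le> c * minimal_pseudometric \<Omega> x v"
    using c by (simp add: field_simps)
  have "metric_candidates \<Omega> x (c *\<^sub>R v) \<noteq> {}"
    using metric_candidates_scaleR[OF c] ne by blast
  then show "c * minimal_pseudometric \<Omega> x v \<le> minimal_pseudometric \<Omega> x (c *\<^sub>R v)"
    unfolding minimal_pseudometric_eq
  proof (rule cInf_greatest)
    fix y assume "y \<in> metric_candidates \<Omega> x (c *\<^sub>R v)"
    from metric_candidates_scaleR[OF _ this, of "1 / c"]
    have "y / c \<in> metric_candidates \<Omega> x v"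
      using c by simp
    then have "Inf (metric_candidates \<Omega> x v) \<le> y / c"
      using bdd_below_metric_candidates cInf_lower by blast
    then show "c * Inf (metric_candidates \<Omega> x v) \<le> y"
      using c by (simp add: field_simps)
  qed
qed

lemma unit_orthogonal_exists:
  fixes v :: "'a::euclidean_space"
  assumes "DIM('a) \<ge> 2"
  obtains w where "norm w = 1" "v \<bullet> w = 0"
proof -
  obtain y where "y \<noteq> 0" "orthogonal v y"
    using orthogonal_to_vector_exists[OF assms] by metis
  then show thesis
    by (intro that[of "y /\<^sub>R norm y"]) (auto simp: orthogonal_def)
qed

text \<open>For nonzero \<open>v\<close> the candidate comes from the flat disc of radius
  \<open>d\<close> spanned by \<open>v\<close> and an orthogonal direction. For \<open>v = 0\<close>
  constant maps make every positive number a candidate but not 0 itself, so \<epsilon> is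
  needed.\<close>

lemma metric_candidates_small:
  fixes \<Omega> :: "'a::euclidean_space set"
  assumes dim: "DIM('a) \<ge> 2" and d: "d > 0" "ball x d \<subseteq> \<Omega>" and \<epsilon>: "\<epsilon> > 0"
  obtains c where "c \<in> metric_candidates \<Omega> x v" "c \<le> norm v / d + \<epsilon>"
proof (cases "v = 0")
  case True
  have "(\<lambda>z. x + Re z *\<^sub>R 0 + Im z *\<^sub>R 0) \<in> CH_plane unit_disc \<Omega>"
    "partial_x (\<lambda>z. x + Re z *\<^sub>R 0 + Im z *\<^sub>R 0) 0 = (0 :: 'a)"
    using d by (intro affine_conformal_CH_plane[where \<Omega> = \<Omega> and D = unit_disc]; force)+
  then have "1 / (1 / \<epsilon>) \<in> metric_candidates \<Omega> x v"
    unfolding metric_candidates_def using \<epsilon> True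
    by (intro CollectI exI[of _ "1 / \<epsilon>"] conjI bexI[of _ "\<lambda>z. x + Re z *\<^sub>R 0 + Im z *\<^sub>R 0"]) auto
  then show thesis
    using True by (intro that[of \<epsilon>]) auto
next
  case False
  define e where "e = v /\<^sub>R norm v"
  obtain w where w: "norm w = 1" "v \<bullet> w = 0"
    using unit_orthogonal_exists[OF dim] .
  have e: "norm e = 1" "e \<bullet> w = 0"
    using False w by (auto simp: e_def)
  let ?f = "\<lambda>z. x + Re z *\<^sub>R (d *\<^sub>R e) + Im z *\<^sub>R (d *\<^sub>R w)"
  have into: "?f z \<in> \<Omega>" if z: "z \<in> unit_disc" for z
  proof -
    have "(norm (Re z *\<^sub>R (d *\<^sub>R e) + Im z *\<^sub>R (d *\<^sub>R w)))\<^sup>2 = d\<^sup>2 * ((Re z)\<^sup>2 + (Im z)\<^sup>2)"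
      using e w(1) d(1) by (subst norm_add_Pythagorean)
        (auto simp: orthogonal_def power_mult_distrib distrib_left mult.commute)
    also have "\<dots> = (d * norm z)\<^sup>2"
      by (simp add: cmod_power2 power_mult_distrib)
    finally have "norm (Re z *\<^sub>R (d *\<^sub>R e) + Im z *\<^sub>R (d *\<^sub>R w)) = d * norm z"
      using d(1) by (simp add: power2_eq_iff_nonneg)
    also have "\<dots> < d"
      using z d(1) by simp
    finally have "dist x (x + (Re z *\<^sub>R (d *\<^sub>R e) + Im z *\<^sub>R (d *\<^sub>R w))) < d"
      by (simp only: dist_norm norm_minus_commute[of x] add_diff_cancel_left')
    then have "dist x (?f z) < d"
      by (simp only: add.assoc)
    then show ?thesis
      using d(2) by auto
  qed
  have f: "?f \<in> CH_plane unit_disc \<Omega>" "partial_x ?f 0 = d *\<^sub>R e"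
    by (rule affine_conformal_CH_plane[where D = unit_disc and \<Omega> = \<Omega>];
        use e w into in simp)+
  have "d *\<^sub>R e = (d / norm v) *\<^sub>R v"
    by (simp add: e_def divide_inverse)
  then have "1 / (d / norm v) \<in> metric_candidates \<Omega> x v"
    unfolding metric_candidates_def using f d(1) False
    by (intro CollectI exI[of _ "d / norm v"] conjI bexI[of _ ?f]) auto
  then show thesis
    using \<epsilon> by (intro that[of "norm v / d"]) auto
qed

text \<open>The real \<open>Inf\<close> of an empty set is unspecified, so every lower bound for the
  metric passes through this fact.\<close>

lemma metric_candidates_nonempty:
  fixes \<Omega> :: "'a::euclidean_space set"
  assumes "DIM('a) \<ge> 2" "open \<Omega>" "x \<in> \<Omega>"
  shows "metric_candidates \<Omega> x v \<noteq> {}"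
proof -
  obtain d where "d > 0" "ball x d \<subseteq> \<Omega>"
    using assms openE by blast
  then show ?thesis
    using metric_candidates_small[OF assms(1), of d x \<Omega> 1 v] by auto
qed

lemma minimal_pseudometric_nonneg:
  fixes \<Omega> :: "'a::euclidean_space set"
  assumes "DIM('a) \<ge> 2" "open \<Omega>" "x \<in> \<Omega>"
  shows "minimal_pseudometric \<Omega> x v \<ge> 0"
  unfolding minimal_pseudometric_eq
  by (rule cInf_greatest[OF metric_candidates_nonempty[OF assms]]) (rule metric_candidates_nonneg)

lemma minimal_pseudometric_le:
  fixes \<Omega> :: "'a::euclidean_space set"
  assumes dim: "DIM('a) \<ge> 2" and d: "d > 0" "ball x d \<subseteq> \<Omega>"
  shows "minimal_pseudometric \<Omega> x v \<le> norm v / d"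
proof (rule field_le_epsilon)
  fix e :: real assume "e > 0"
  then obtain c where "c \<in> metric_candidates \<Omega> x v" "c \<le> norm v / d + e"
    using metric_candidates_small[OF dim d] by metis
  then show "minimal_pseudometric \<Omega> x v \<le> norm v / d + e"
    unfolding minimal_pseudometric_eq
    using cInf_lower[OF _ bdd_below_metric_candidates] by force
qed

section \<open>Lower integrals: affine substitution, scaling, splitting of the domain\<close>

text \<open>The integrand of the minimal length along a path need not be measurable a priori, so the
  integral is a lower integral and is handled through simple functions.\<close>

lemma nn_integral_leI:
  assumes "\<And>g. g \<in> borel_measurable M \<Longrightarrow> (\<And>x. g x \<le> f x) \<Longrightarrow> integral\<^sup>N M g \<le> c"
  shows "integral\<^sup>N M f \<le> c"
  unfolding nn_integral_def
proof (rule SUP_least)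
  fix g assume "g \<in> {g. simple_function M g \<and> g \<le> f}"
  then have g: "simple_function M g" "\<And>x. g x \<le> f x"
    by (auto simp: le_fun_def)
  then show "integral\<^sup>S M g \<le> c"
    using assms[OF borel_measurable_simple_function] by (simp add: nn_integral_eq_simple_integral)
qed

lemma lower_integral_affine_le:
  fixes c :: real
  assumes c: "c \<noteq> 0"
  shows "(\<integral>\<^sup>+x. f x \<partial>lborel) \<le> ennreal \<bar>c\<bar> * (\<integral>\<^sup>+x. f (t + c * x) \<partial>lborel)"
proof (rule nn_integral_leI)
  fix g assume g: "g \<in> borel_measurable lborel" "\<And>x. g x \<le> f x"
  then have "(\<integral>\<^sup>+x. g x \<partial>lborel) = ennreal \<bar>c\<bar> * (\<integral>\<^sup>+x. g (t + c * x) \<partial>lborel)"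
    using nn_integral_real_affine[of g c t] c by simp
  also have "\<dots> \<le> ennreal \<bar>c\<bar> * (\<integral>\<^sup>+x. f (t + c * x) \<partial>lborel)"
    by (intro mult_left_mono nn_integral_mono g) auto
  finally show "(\<integral>\<^sup>+x. g x \<partial>lborel) \<le> ennreal \<bar>c\<bar> * (\<integral>\<^sup>+x. f (t + c * x) \<partial>lborel)" .
qed

lemma lower_integral_affine_ge:
  fixes c :: real
  assumes c: "c \<noteq> 0"
  shows "ennreal \<bar>c\<bar> * (\<integral>\<^sup>+x. f (t + c * x) \<partial>lborel) \<le> (\<integral>\<^sup>+x. f x \<partial>lborel)"
proof -
  \<comment> \<open>The reverse inequality is the previous lemma for the inverse
    substitution.\<close>
  have "(\<integral>\<^sup>+x. f (t + c * x) \<partial>lborel) \<le> ennreal \<bar>1 / c\<bar> * (\<integral>\<^sup>+x. f (t + c * (- t / c + (1 / c) * x)) \<partial>lborel)"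
    using c by (intro lower_integral_affine_le) auto
  also have "\<dots> = ennreal \<bar>1 / c\<bar> * (\<integral>\<^sup>+x. f x \<partial>lborel)"
  proof -
    have "t + c * (- t / c + (1 / c) * x) = x" for x
      using c by (simp add: field_simps)
    then show ?thesis
      by simp
  qed
  finally have "ennreal \<bar>c\<bar> * (\<integral>\<^sup>+x. f (t + c * x) \<partial>lborel)
      \<le> ennreal \<bar>c\<bar> * (ennreal \<bar>1 / c\<bar> * (\<integral>\<^sup>+x. f x \<partial>lborel))"
    by (rule mult_left_mono) simp
  also have "\<dots> = (\<integral>\<^sup>+x. f x \<partial>lborel)"
    using c by (simp add: mult.assoc[symmetric] ennreal_mult'[symmetric])
  finally show ?thesis .
qed

lemma lower_integral_cmult_le:
  assumes c: "c > 0"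
  shows "(\<integral>\<^sup>+x. ennreal c * f x \<partial>M) \<le> ennreal c * (\<integral>\<^sup>+x. f x \<partial>M)"
proof (rule nn_integral_leI)
  fix g assume [measurable]: "g \<in> borel_measurable M" and g: "\<And>x. g x \<le> ennreal c * f x"
  have cancel: "ennreal c * (ennreal (1 / c) * y) = y" "ennreal (1 / c) * (ennreal c * y) = y" for y
    using c by (simp_all add: mult.assoc[symmetric] ennreal_mult'[symmetric])
  have le: "ennreal (1 / c) * g x \<le> f x" for x
    using mult_left_mono[OF g, of "ennreal (1 / c)" x] by (simp add: cancel)
  have "(\<integral>\<^sup>+x. g x \<partial>M) = ennreal c * (\<integral>\<^sup>+x. ennreal (1 / c) * g x \<partial>M)"
    by (simp add: nn_integral_cmult cancel)
  also have "\<dots> \<le> ennreal c * (\<integral>\<^sup>+x. f x \<partial>M)"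
    by (intro mult_left_mono nn_integral_mono le) auto
  finally show "(\<integral>\<^sup>+x. g x \<partial>M) \<le> ennreal c * (\<integral>\<^sup>+x. f x \<partial>M)" .
qed

text \<open>The lower integral of a sum of nonmeasurable functions may exceed the sum of their lower
  integrals. Splitting over measurable sets is harmless, because a measurable minorant can be cut
  along them.\<close>

lemma lower_integral_subadditive:
  assumes [measurable]: "A \<in> sets M" "B \<in> sets M"
  shows "(\<integral>\<^sup>+x\<in>A \<union> B. f x \<partial>M) \<le> (\<integral>\<^sup>+x\<in>A. f x \<partial>M) + (\<integral>\<^sup>+x\<in>B. f x \<partial>M)"
proof (rule nn_integral_leI)
  fix g assume [measurable]: "g \<in> borel_measurable M" and g: "\<And>x. g x \<le> f x * indicator (A \<union> B) x"
  have gf: "g x \<le> f x" for x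
    using g[of x] by (cases "x \<in> A \<union> B") auto
  have "(\<integral>\<^sup>+x. g x \<partial>M) \<le> (\<integral>\<^sup>+x. g x * indicator A x + g x * indicator B x \<partial>M)"
  proof (intro nn_integral_mono)
    fix x
    show "g x \<le> g x * indicator A x + g x * indicator B x"
      using g[of x] by (cases "x \<in> A"; cases "x \<in> B") auto
  qed
  also have "\<dots> = (\<integral>\<^sup>+x. g x * indicator A x \<partial>M) + (\<integral>\<^sup>+x. g x * indicator B x \<partial>M)"
    by (intro nn_integral_add) auto
  also have "\<dots> \<le> (\<integral>\<^sup>+x\<in>A. f x \<partial>M) + (\<integral>\<^sup>+x\<in>B. f x \<partial>M)"
    by (intro add_mono nn_integral_mono mult_right_mono gf) auto
  finally show "(\<integral>\<^sup>+x. g x \<partial>M) \<le> (\<integral>\<^sup>+x\<in>A. f x \<partial>M) + (\<integral>\<^sup>+x\<in>B. f x \<partial>M)" .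
qed

section \<open>Lengths, paths and the triangle inequality\<close>

definition minimal_length :: "'a::real_inner set \<Rightarrow> (real \<Rightarrow> 'a) \<Rightarrow> ennreal" where
  "minimal_length \<Omega> \<gamma> =
     (\<integral>\<^sup>+t\<in>{0..1}. ennreal (minimal_pseudometric \<Omega> (\<gamma> t) (vector_derivative \<gamma> (at t))) \<partial>lborel)"

definition paths_between :: "'a::real_inner set \<Rightarrow> 'a \<Rightarrow> 'a \<Rightarrow> (real \<Rightarrow> 'a) set" where
  "paths_between \<Omega> x y = {\<gamma>. piecewise_smooth_path \<gamma> \<and> path_image \<gamma> \<subseteq> \<Omega> \<and>
     pathstart \<gamma> = x \<and> pathfinish \<gamma> = y}"

text \<open>Infima and sums are handled with infinite values kept; \<open>enn2real\<close> would
  turn an infinite distance into 0 and is applied only at the end.\<close>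

definition minimal_edistance :: "'a::real_inner set \<Rightarrow> 'a \<Rightarrow> 'a \<Rightarrow> ennreal" where
  "minimal_edistance \<Omega> x y = (INF \<gamma>\<in>paths_between \<Omega> x y. minimal_length \<Omega> \<gamma>)"

lemma minimal_pseudodistance_eq: "minimal_pseudodistance \<Omega> x y = enn2real (minimal_edistance \<Omega> x y)"
  by (simp add: minimal_pseudodistance_def minimal_edistance_def minimal_length_def paths_between_def)

lemma smooth_on_interval_affine:
  assumes \<gamma>: "smooth_on_interval a' b' \<gamma>" and sub: "\<And>t. t \<in> {a..b} \<Longrightarrow> d + c * t \<in> {a'..b'}"
    and eq: "\<And>t. t \<in> {a..b} \<Longrightarrow> \<eta> t = \<gamma> (d + c * t)"
  shows "smooth_on_interval a b \<eta>"
proof -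
  obtain D where D: "\<And>t. t \<in> {a'..b'} \<Longrightarrow> D 0 t = \<gamma> t"
    "\<And>k t. t \<in> {a'..b'} \<Longrightarrow> (D k has_vector_derivative D (Suc k) t) (at t within {a'..b'})"
    using \<gamma> unfolding smooth_on_interval_def by blast
  define E where "E k t = (c ^ k) *\<^sub>R D k (d + c * t)" for k t
  have "(E k has_vector_derivative E (Suc k) t) (at t within {a..b})" if t: "t \<in> {a..b}" for k t
  proof -
    have aff: "((\<lambda>t. d + c * t) has_vector_derivative c) (at t within {a..b})"
      by (auto intro!: derivative_eq_intros simp: has_vector_derivative_def)
    have "(D k has_vector_derivative D (Suc k) (d + c * t)) (at (d + c * t) within (\<lambda>t. d + c * t) ` {a..b})"
      using D(2)[OF sub[OF t]] by (rule has_vector_derivative_within_subset) (use sub in blast)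
    from vector_diff_chain_within[OF aff this]
    have "((\<lambda>t. D k (d + c * t)) has_vector_derivative c *\<^sub>R D (Suc k) (d + c * t)) (at t within {a..b})"
      by (simp add: o_def)
    then have "((\<lambda>t. (c ^ k) *\<^sub>R D k (d + c * t)) has_vector_derivative (c ^ k) *\<^sub>R (c *\<^sub>R D (Suc k) (d + c * t)))
        (at t within {a..b})"
      by (rule bounded_linear.has_vector_derivative[OF bounded_linear_scaleR_right])
    then show ?thesis
      unfolding E_def by (simp add: mult.commute)
  qed
  moreover have "E 0 t = \<eta> t" if "t \<in> {a..b}" for t
    using D(1)[OF sub[OF that]] eq[OF that] by (simp add: E_def)
  ultimately show ?thesis
    unfolding smooth_on_interval_def by blast
qed

lemma piecewise_smooth_pathE:
  assumes "piecewise_smooth_path \<gamma>"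
  obtains m p where "p 0 = (0::real)" "p (m::nat) = 1" "\<And>i. i < m \<Longrightarrow> p i < p (Suc i)"
    "\<And>i. i < m \<Longrightarrow> smooth_on_interval (p i) (p (Suc i)) \<gamma>"
    "\<And>i. i \<le> m \<Longrightarrow> 0 \<le> p i \<and> p i \<le> 1"
proof -
  obtain m p where p: "p 0 = (0::real)" "p (m::nat) = 1" "\<And>i. i < m \<Longrightarrow> p i < p (Suc i)"
    "\<And>i. i < m \<Longrightarrow> smooth_on_interval (p i) (p (Suc i)) \<gamma>"
    using assms unfolding piecewise_smooth_path_def by blast
  have "i \<le> m \<Longrightarrow> 0 \<le> p i" for i
  proof (induction i)
    case (Suc i)
    then show ?case
      using p(3)[of i] by simp
  qed (use p in auto)
  moreover have "i \<le> m \<Longrightarrow> p (m - i) \<le> 1" for i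
  proof (induction i)
    case (Suc i)
    then have "p (m - Suc i) < p (Suc (m - Suc i))"
      by (intro p) auto
    moreover have "Suc (m - Suc i) = m - i"
      using Suc by simp
    ultimately show ?case
      using Suc by simp
  qed (use p in auto)
  then have "i \<le> m \<Longrightarrow> p i \<le> 1" for i
    using diff_diff_cancel diff_le_self by metis
  ultimately show thesis
    using that p by blast
qed

lemma smooth_on_interval_vector_derivative:
  assumes "smooth_on_interval a b \<gamma>"
  obtains D where "continuous_on {a..b} D"
    "\<And>t. t \<in> {a..b} \<Longrightarrow> (\<gamma> has_vector_derivative D t) (at t within {a..b})"
    "\<And>t. t \<in> {a<..<b} \<Longrightarrow> (\<gamma> has_vector_derivative D t) (at t)"
proof -
  obtain D where D: "\<And>t. t \<in> {a..b} \<Longrightarrow> D 0 t = \<gamma> t"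
    "\<And>k t. t \<in> {a..b} \<Longrightarrow> (D k has_vector_derivative D (Suc k) t) (at t within {a..b})"
    using assms unfolding smooth_on_interval_def by blast
  have 1: "(\<gamma> has_vector_derivative D 1 t) (at t within {a..b})" if "t \<in> {a..b}" for t
    using D(2)[OF that, of 0] by (intro has_vector_derivative_transform[OF that, of \<gamma> "D 0"]) (auto simp: D(1))
  show thesis
  proof (rule that[OF _ 1])
    show "continuous_on {a..b} (D 1)"
      using D(2)[of _ 1] by (intro continuous_on_vector_derivative) auto
    show "(\<gamma> has_vector_derivative D 1 t) (at t)" if "t \<in> {a<..<b}" for t
    proof -
      have "at t within {a..b} = at t"
        using that by (intro at_within_interior) simp
      then show ?thesis
        using 1[of t] that by simp
    qed
  qed
qed

lemma piecewise_smooth_path_differentiable: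
  assumes "piecewise_smooth_path \<gamma>"
  obtains S where "finite S" "\<And>t. t \<in> {0..1} - S \<Longrightarrow> (\<gamma> has_vector_derivative vector_derivative \<gamma> (at t)) (at t)"
proof -
  obtain m p where p: "p 0 = (0::real)" "p (m::nat) = 1" "\<And>i. i < m \<Longrightarrow> p i < p (Suc i)"
    "\<And>i. i < m \<Longrightarrow> smooth_on_interval (p i) (p (Suc i)) \<gamma>"
    using piecewise_smooth_pathE[OF assms] by metis
  have loc: "\<exists>i<n. t \<in> {p i<..<p (Suc i)}"
    if "n \<le> m" "t \<in> {0..p n}" "t \<notin> p ` {..n}" for t n
    using that
  proof (induction n)
    case 0
    then show ?case
      using p(1) by auto
  next
    case (Suc n)
    show ?case
    proof (cases "t \<le> p n")
      case True
      with Suc show ?thesis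
        by (fastforce simp: less_Suc_eq)
    next
      case False
      then have "t \<in> {p n<..<p (Suc n)}"
        using Suc.prems by (auto simp: less_le)
      then show ?thesis
        by blast
    qed
  qed
  show thesis
  proof (rule that[of "p ` {..m}"])
    fix t assume "t \<in> {0..1} - p ` {..m}"
    then obtain i where i: "i < m" "t \<in> {p i<..<p (Suc i)}"
      using loc[of m t] p(2) by auto
    then obtain D where "(\<gamma> has_vector_derivative D t) (at t)"
      using smooth_on_interval_vector_derivative[OF p(4)[OF i(1)]] by metis
    then show "(\<gamma> has_vector_derivative vector_derivative \<gamma> (at t)) (at t)"
      using vector_derivative_at by metis
  qed simp
qed

lemma AE_lborel_notin_finite: "finite S \<Longrightarrow> AE t in lborel. t \<notin> (S :: real set)"
  by (intro AE_not_in finite_imp_null_set_lborel)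

lemma piecewise_smooth_path_linepath: "piecewise_smooth_path (linepath x y)"
proof -
  define D :: "nat \<Rightarrow> real \<Rightarrow> 'a" where
    "D k t = (if k = 0 then linepath x y t else if k = 1 then y - x else 0)" for k t
  have "(D k has_vector_derivative D (Suc k) t) (at t within {0..1})" for k t
    unfolding D_def by (cases "k = 0") (auto intro: has_vector_derivative_linepath_within)
  then have "smooth_on_interval 0 1 (linepath x y)"
    unfolding smooth_on_interval_def by (intro exI[of _ D]) (auto simp: D_def)
  then show ?thesis
    unfolding piecewise_smooth_path_def by (intro exI[of _ 1] exI[of _ real]) auto
qed

lemma piecewise_smooth_path_reversepath:
  assumes "piecewise_smooth_path \<gamma>"
  shows "piecewise_smooth_path (reversepath \<gamma>)"
proof -
  obtain m p where p: "p 0 = (0::real)" "p (m::nat) = 1" "\<And>i. i < m \<Longrightarrow> p i < p (Suc i)"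
    "\<And>i. i < m \<Longrightarrow> smooth_on_interval (p i) (p (Suc i)) \<gamma>"
    using piecewise_smooth_pathE[OF assms] by metis
  have "1 - p (m - i) < 1 - p (m - Suc i) \<and>
      smooth_on_interval (1 - p (m - i)) (1 - p (m - Suc i)) (reversepath \<gamma>)" if i: "i < m" for i
  proof -
    have j: "m - Suc i < m" "Suc (m - Suc i) = m - i"
      using i by auto
    then have "smooth_on_interval (p (m - Suc i)) (p (m - i)) \<gamma>"
      using p(4) by metis
    then have "smooth_on_interval (1 - p (m - i)) (1 - p (m - Suc i)) (reversepath \<gamma>)"
      by (rule smooth_on_interval_affine[where d = 1 and c = "-1"]) (auto simp: reversepath_def)
    then show ?thesis
      using p(3)[OF j(1)] j(2) by simp
  qed
  then show ?thesis
    unfolding piecewise_smooth_path_def using p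
    by (intro exI[of _ m] exI[of _ "\<lambda>i. 1 - p (m - i)"]) auto
qed

lemma piecewise_smooth_path_join:
  assumes "piecewise_smooth_path \<gamma>" "piecewise_smooth_path \<eta>" and join: "pathfinish \<gamma> = pathstart \<eta>"
  shows "piecewise_smooth_path (\<gamma> +++ \<eta>)"
proof -
  obtain m p where p: "p 0 = (0::real)" "p (m::nat) = 1" "\<And>i. i < m \<Longrightarrow> p i < p (Suc i)"
    "\<And>i. i < m \<Longrightarrow> smooth_on_interval (p i) (p (Suc i)) \<gamma>" "\<And>i. i \<le> m \<Longrightarrow> 0 \<le> p i \<and> p i \<le> 1"
    using piecewise_smooth_pathE[OF assms(1)] by metis
  obtain n q where q: "q 0 = (0::real)" "q (n::nat) = 1" "\<And>i. i < n \<Longrightarrow> q i < q (Suc i)"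
    "\<And>i. i < n \<Longrightarrow> smooth_on_interval (q i) (q (Suc i)) \<eta>" "\<And>i. i \<le> n \<Longrightarrow> 0 \<le> q i \<and> q i \<le> 1"
    using piecewise_smooth_pathE[OF assms(2)] by metis
  \<comment> \<open>Break points of the first path are halved, those of the second halved and moved
    by 1 / 2. Both formulas give 1 / 2 at index \<open>m\<close>, so either may be used
    there.\<close>
  define r where "r i = (if i \<le> m then p i / 2 else 1 / 2 + q (i - m) / 2)" for i
  have r2: "r i = 1 / 2 + q (i - m) / 2" if "i \<ge> m" for i
    using that p(2) q(1) by (auto simp: r_def)
  have "r i < r (Suc i) \<and> smooth_on_interval (r i) (r (Suc i)) (\<gamma> +++ \<eta>)" if i: "i < m + n" for i
  proof (cases "i < m")
    case True
    then have ri: "r i = p i / 2" "r (Suc i) = p (Suc i) / 2"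
      by (auto simp: r_def)
    have "smooth_on_interval (r i) (r (Suc i)) (\<gamma> +++ \<eta>)"
    proof (rule smooth_on_interval_affine[OF p(4)[OF True], where d = 0 and c = 2])
      fix t assume t: "t \<in> {r i..r (Suc i)}"
      then show "0 + 2 * t \<in> {p i..p (Suc i)}"
        using ri by auto
      then have "t \<le> 1 / 2"
        using p(5)[of "Suc i"] True by auto
      then show "(\<gamma> +++ \<eta>) t = \<gamma> (0 + 2 * t)"
        by (simp add: joinpaths_def)
    qed
    moreover have "r i < r (Suc i)"
      using ri p(3)[OF True] by simp
    ultimately show ?thesis
      by blast
  next
    case False
    define j where "j = i - m"
    have j: "j < n" "r i = 1 / 2 + q j / 2" "r (Suc i) = 1 / 2 + q (Suc j) / 2"
      using False i r2[of i] r2[of "Suc i"] by (auto simp: j_def Suc_diff_le)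
    have "smooth_on_interval (r i) (r (Suc i)) (\<gamma> +++ \<eta>)"
    proof (rule smooth_on_interval_affine[OF q(4)[OF j(1)], where d = "- 1" and c = 2])
      fix t assume t: "t \<in> {r i..r (Suc i)}"
      then show "- 1 + 2 * t \<in> {q j..q (Suc j)}"
        using j by auto
      have "t \<ge> 1 / 2"
        using q(5)[of j] j t by auto
      moreover have "\<gamma> 1 = \<eta> 0"
        using join by (simp add: pathfinish_def pathstart_def)
      ultimately show "(\<gamma> +++ \<eta>) t = \<eta> (- 1 + 2 * t)"
      \<comment> \<open>At the joint \<open>+++\<close> still evaluates the first path, so the
        endpoint condition is needed.\<close>
      proof (cases "t = 1 / 2")
        case True
        with \<open>\<gamma> 1 = \<eta> 0\<close> show ?thesis
          unfolding True by (simp add: joinpaths_def)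
      qed (simp add: joinpaths_def)
    qed
    moreover have "r i < r (Suc i)"
      using j q(3)[OF j(1)] by simp
    ultimately show ?thesis
      by blast
  qed
  moreover have "r 0 = 0" "r (m + n) = 1"
    using p(1) q(2) r2[of "m + n"] by (auto simp: r_def)
  ultimately show ?thesis
    unfolding piecewise_smooth_path_def by blast
qed

text \<open>Reversal negates the velocity, to which the metric is insensitive, away from finitely
  many times. Applied to both orders of the endpoints, the inequality suffices for symmetry of the
  distance.\<close>

lemma minimal_length_reversepath_le:
  assumes "piecewise_smooth_path \<gamma>"
  shows "minimal_length \<Omega> (reversepath \<gamma>) \<le> minimal_length \<Omega> \<gamma>"
proof -
  let ?G = "\<lambda>\<gamma> t. ennreal (minimal_pseudometric \<Omega> (\<gamma> t) (vector_derivative \<gamma> (at t)))"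
  obtain S where S: "finite S"
    "\<And>t. t \<in> {0..1} - S \<Longrightarrow> (\<gamma> has_vector_derivative vector_derivative \<gamma> (at t)) (at t)"
    using piecewise_smooth_path_differentiable[OF assms] by blast
  have eq: "?G (reversepath \<gamma>) t = ?G \<gamma> (1 - t)" if "1 - t \<in> {0..1} - S" for t
  proof -
    have "((\<lambda>t. 1 - t) has_vector_derivative - 1) (at t)"
      by (auto intro!: derivative_eq_intros simp: has_vector_derivative_def)
    from vector_diff_chain_at[OF this S(2)[OF that]]
    have "(reversepath \<gamma> has_vector_derivative - vector_derivative \<gamma> (at (1 - t))) (at t)"
      by (simp add: o_def reversepath_def)
    then show ?thesis
      by (simp add: vector_derivative_at minimal_pseudometric_minus reversepath_def)
  qed
  have "AE t in lborel. t \<notin> (\<lambda>s. 1 - s) ` S"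
    using S(1) by (intro AE_lborel_notin_finite) simp
  then have "minimal_length \<Omega> (reversepath \<gamma>)
      \<le> (\<integral>\<^sup>+t. ?G \<gamma> (1 + (-1) * t) * indicator {0..1} (1 + (-1) * t) \<partial>lborel)"
    unfolding minimal_length_def
  proof (intro nn_integral_mono_AE, elim eventually_mono)
    fix t assume t: "t \<notin> (\<lambda>s. 1 - s) ` S"
    then have "1 - t \<notin> S"
      by force
    then show "?G (reversepath \<gamma>) t * indicator {0..1} t
        \<le> ?G \<gamma> (1 + (-1) * t) * indicator {0..1} (1 + (-1) * t)"
      using eq[of t] by (cases "t \<in> {0..1}") auto
  qed
  also have "\<dots> = ennreal \<bar>-1\<bar> * (\<integral>\<^sup>+t. ?G \<gamma> (1 + (-1) * t) * indicator {0..1} (1 + (-1) * t) \<partial>lborel)"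
    by simp
  also have "\<dots> \<le> minimal_length \<Omega> \<gamma>"
    unfolding minimal_length_def by (rule lower_integral_affine_ge) simp
  finally show ?thesis .
qed

lemma paths_between_reversepath: "\<gamma> \<in> paths_between \<Omega> x y \<Longrightarrow> reversepath \<gamma> \<in> paths_between \<Omega> y x"
  by (simp add: paths_between_def piecewise_smooth_path_reversepath)

lemma minimal_edistance_commute: "minimal_edistance \<Omega> x y = minimal_edistance \<Omega> y x"
proof -
  have "minimal_edistance \<Omega> x y \<le> minimal_edistance \<Omega> y x" for x y
    unfolding minimal_edistance_def
  proof (rule INF_greatest)
    fix \<gamma> assume \<gamma>: "\<gamma> \<in> paths_between \<Omega> y x"
    have "(INF \<gamma>\<in>paths_between \<Omega> x y. minimal_length \<Omega> \<gamma>) \<le> minimal_length \<Omega> (reversepath \<gamma>)"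
      by (rule INF_lower) (rule paths_between_reversepath[OF \<gamma>])
    also have "\<dots> \<le> minimal_length \<Omega> \<gamma>"
      using \<gamma> by (intro minimal_length_reversepath_le) (simp add: paths_between_def)
    finally show "(INF \<gamma>\<in>paths_between \<Omega> x y. minimal_length \<Omega> \<gamma>) \<le> minimal_length \<Omega> \<gamma>" .
  qed
  then show ?thesis
    by (simp add: antisym)
qed

text \<open>On each half the velocity is doubled. By homogeneity so is the integrand, which cancels
  the factor of the substitution t \<mapsto> 2 t + d.\<close>

lemma minimal_length_join_le:
  fixes \<Omega> :: "'a::euclidean_space set"
  assumes dim: "DIM('a) \<ge> 2" "open \<Omega>"
    and \<gamma>: "\<gamma> \<in> paths_between \<Omega> x z" and \<eta>: "\<eta> \<in> paths_between \<Omega> z y"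
  shows "minimal_length \<Omega> (\<gamma> +++ \<eta>) \<le> minimal_length \<Omega> \<gamma> + minimal_length \<Omega> \<eta>"
proof -
  let ?G = "\<lambda>\<gamma> t. ennreal (minimal_pseudometric \<Omega> (\<gamma> t) (vector_derivative \<gamma> (at t)))"
  let ?J = "\<gamma> +++ \<eta>"
  obtain S where S: "finite S"
    "\<And>t. t \<in> {0..1} - S \<Longrightarrow> (\<gamma> has_vector_derivative vector_derivative \<gamma> (at t)) (at t)"
    using piecewise_smooth_path_differentiable \<gamma> unfolding paths_between_def by blast
  obtain T where T: "finite T"
    "\<And>t. t \<in> {0..1} - T \<Longrightarrow> (\<eta> has_vector_derivative vector_derivative \<eta> (at t)) (at t)"
    using piecewise_smooth_path_differentiable \<eta> unfolding paths_between_def by blast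
  have scale: "ennreal (minimal_pseudometric \<Omega> w (2 *\<^sub>R v)) = 2 * ennreal (minimal_pseudometric \<Omega> w v)"
    if "w \<in> \<Omega>" for w v
    using minimal_pseudometric_scaleR[OF _ metric_candidates_nonempty[OF dim that], of 2 v]
      minimal_pseudometric_nonneg[OF dim that] by (simp add: ennreal_mult')
  have im: "\<gamma> t \<in> \<Omega>" "\<eta> t \<in> \<Omega>" if "t \<in> {0..1}" for t
    using \<gamma> \<eta> that by (auto simp: paths_between_def path_image_def)
  have aff: "((\<lambda>t. d + 2 * t) has_vector_derivative 2) (at t)" for d t :: real
    by (auto intro!: derivative_eq_intros simp: has_vector_derivative_def)
  have eq1: "?G ?J t = 2 * ?G \<gamma> (0 + 2 * t)" if t: "t < 1 / 2" "0 + 2 * t \<in> {0..1} - S" for t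
  proof -
    have "((\<lambda>t. \<gamma> (0 + 2 * t)) has_vector_derivative 2 *\<^sub>R vector_derivative \<gamma> (at (0 + 2 * t))) (at t)"
      using vector_diff_chain_at[OF aff S(2)[OF t(2)]] by (simp add: o_def)
    then have "(?J has_vector_derivative 2 *\<^sub>R vector_derivative \<gamma> (at (0 + 2 * t))) (at t)"
      by (rule has_vector_derivative_transform_within_open[of _ _ _ "{..<1 / 2}"])
        (use t in \<open>auto simp: joinpaths_def\<close>)
    moreover have "?J t = \<gamma> (0 + 2 * t)"
      using t by (simp add: joinpaths_def)
    ultimately show ?thesis
      using scale[OF im(1), of "0 + 2 * t"] t(2) by (simp add: vector_derivative_at)
  qed
  have eq2: "?G ?J t = 2 * ?G \<eta> (- 1 + 2 * t)" if t: "t > 1 / 2" "- 1 + 2 * t \<in> {0..1} - T" for t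
  proof -
    have "((\<lambda>t. \<eta> (- 1 + 2 * t)) has_vector_derivative 2 *\<^sub>R vector_derivative \<eta> (at (- 1 + 2 * t))) (at t)"
      using vector_diff_chain_at[OF aff T(2)[OF t(2)]] by (simp add: o_def)
    then have "(?J has_vector_derivative 2 *\<^sub>R vector_derivative \<eta> (at (- 1 + 2 * t))) (at t)"
      by (rule has_vector_derivative_transform_within_open[of _ _ _ "{1 / 2<..}"])
        (use t in \<open>auto simp: joinpaths_def\<close>)
    moreover have "?J t = \<eta> (- 1 + 2 * t)"
      using t by (simp add: joinpaths_def)
    ultimately show ?thesis
      using scale[OF im(2), of "- 1 + 2 * t"] t(2) by (simp add: vector_derivative_at)
  qed
  have half: "(\<integral>\<^sup>+t\<in>I. ?G ?J t \<partial>lborel) \<le> (\<integral>\<^sup>+t\<in>{0..1}. ?G \<zeta> t \<partial>lborel)"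
    if fin: "finite U" and le: "\<And>t. t \<in> I \<Longrightarrow> d + 2 * t \<in> {0..1}"
      "\<And>t. t \<in> I \<Longrightarrow> d + 2 * t \<notin> U \<Longrightarrow> ?G ?J t = 2 * ?G \<zeta> (d + 2 * t)" for U I d \<zeta>
  proof -
    have "AE t in lborel. t \<notin> (\<lambda>s. (s - d) / 2) ` U"
      using fin by (intro AE_lborel_notin_finite) simp
    then have "(\<integral>\<^sup>+t\<in>I. ?G ?J t \<partial>lborel) \<le>
        (\<integral>\<^sup>+t. 2 * (?G \<zeta> (d + 2 * t) * indicator {0..1} (d + 2 * t)) \<partial>lborel)"
    proof (intro nn_integral_mono_AE, elim eventually_mono)
      fix t assume t: "t \<notin> (\<lambda>s. (s - d) / 2) ` U"
      then have "d + 2 * t \<notin> U"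
        by force
      then show "?G ?J t * indicator I t \<le> 2 * (?G \<zeta> (d + 2 * t) * indicator {0..1} (d + 2 * t))"
        using le[of t] by (cases "t \<in> I") auto
    qed
    also have "\<dots> \<le> ennreal 2 * (\<integral>\<^sup>+t. ?G \<zeta> (d + 2 * t) * indicator {0..1} (d + 2 * t) \<partial>lborel)"
      using lower_integral_cmult_le[of 2] by simp
    also have "\<dots> = ennreal \<bar>2\<bar> * (\<integral>\<^sup>+t. ?G \<zeta> (d + 2 * t) * indicator {0..1} (d + 2 * t) \<partial>lborel)"
      by simp
    also have "\<dots> \<le> (\<integral>\<^sup>+t\<in>{0..1}. ?G \<zeta> t \<partial>lborel)"
      by (rule lower_integral_affine_ge) simp
    finally show ?thesis .
  qed
  have "{0..1} = {0..<1 / 2} \<union> {1 / 2..1 :: real}"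
    by auto
  then have "minimal_length \<Omega> ?J \<le> (\<integral>\<^sup>+t\<in>{0..<1 / 2}. ?G ?J t \<partial>lborel) + (\<integral>\<^sup>+t\<in>{1 / 2..1}. ?G ?J t \<partial>lborel)"
    unfolding minimal_length_def by (simp add: lower_integral_subadditive)
  also have "\<dots> \<le> minimal_length \<Omega> \<gamma> + minimal_length \<Omega> \<eta>"
    unfolding minimal_length_def
  proof (rule add_mono)
    show "(\<integral>\<^sup>+t\<in>{0..<1 / 2}. ?G ?J t \<partial>lborel) \<le> (\<integral>\<^sup>+t\<in>{0..1}. ?G \<gamma> t \<partial>lborel)"
    proof (rule half[where d = 0, OF S(1)])
      fix t :: real assume t: "t \<in> {0..<1 / 2}"
      then show in01: "0 + 2 * t \<in> {0..1}"
        by simp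
      show "?G ?J t = 2 * ?G \<gamma> (0 + 2 * t)" if "0 + 2 * t \<notin> S"
        by (rule eq1) (use t in01 that in auto)
    qed
    show "(\<integral>\<^sup>+t\<in>{1 / 2..1}. ?G ?J t \<partial>lborel) \<le> (\<integral>\<^sup>+t\<in>{0..1}. ?G \<eta> t \<partial>lborel)"
    \<comment> \<open>Adding 0 discards t = 1 / 2, where the joined path may have a corner.\<close>
    proof (rule half[where d = "- 1" and U = "insert 0 T"])
      fix t :: real assume t: "t \<in> {1 / 2..1}"
      then show in01: "- 1 + 2 * t \<in> {0..1}"
        by simp
      show "?G ?J t = 2 * ?G \<eta> (- 1 + 2 * t)" if "- 1 + 2 * t \<notin> insert 0 T"
        by (rule eq2) (use t in01 that in auto)
    qed (use T(1) in simp)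
  qed
  finally show ?thesis .
qed

lemma paths_between_join:
  "\<gamma> \<in> paths_between \<Omega> x z \<Longrightarrow> \<eta> \<in> paths_between \<Omega> z y \<Longrightarrow> \<gamma> +++ \<eta> \<in> paths_between \<Omega> x y"
  by (auto simp: paths_between_def path_image_join intro: piecewise_smooth_path_join)

lemma minimal_edistance_triangle:
  fixes \<Omega> :: "'a::euclidean_space set"
  assumes dim: "DIM('a) \<ge> 2" "open \<Omega>"
  shows "minimal_edistance \<Omega> x y \<le> minimal_edistance \<Omega> x z + minimal_edistance \<Omega> z y"
proof (rule ennreal_le_epsilon)
  fix e :: real
  assume fin: "minimal_edistance \<Omega> x z + minimal_edistance \<Omega> z y < top" and e: "e > 0"
  have near: "\<exists>\<gamma>\<in>paths_between \<Omega> u v. minimal_length \<Omega> \<gamma> < minimal_edistance \<Omega> u v + ennreal (e / 2)"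
    if "minimal_edistance \<Omega> u v < top" for u v
  proof -
    have "minimal_edistance \<Omega> u v < minimal_edistance \<Omega> u v + ennreal (e / 2)"
      using that e by (cases "minimal_edistance \<Omega> u v") (auto simp: ennreal_less_iff simp flip: ennreal_plus)
    then show ?thesis
      by (subst (asm) (1) minimal_edistance_def) (simp add: INF_less_iff)
  qed
  obtain \<gamma> where \<gamma>: "\<gamma> \<in> paths_between \<Omega> x z" "minimal_length \<Omega> \<gamma> < minimal_edistance \<Omega> x z + ennreal (e / 2)"
    using near fin by (metis add_top_right_ennreal add_top_left_ennreal top.not_eq_extremum ennreal_add_eq_top)
  obtain \<eta> where \<eta>: "\<eta> \<in> paths_between \<Omega> z y" "minimal_length \<Omega> \<eta> < minimal_edistance \<Omega> z y + ennreal (e / 2)"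
    using near fin by (metis top.not_eq_extremum ennreal_add_eq_top)
  have "minimal_edistance \<Omega> x y \<le> minimal_length \<Omega> (\<gamma> +++ \<eta>)"
    unfolding minimal_edistance_def by (rule INF_lower) (rule paths_between_join[OF \<gamma>(1) \<eta>(1)])
  also have "\<dots> \<le> minimal_length \<Omega> \<gamma> + minimal_length \<Omega> \<eta>"
    by (rule minimal_length_join_le[OF dim \<gamma>(1) \<eta>(1)])
  also have "\<dots> \<le> (minimal_edistance \<Omega> x z + ennreal (e / 2)) + (minimal_edistance \<Omega> z y + ennreal (e / 2))"
    using \<gamma>(2) \<eta>(2) by (intro add_mono less_imp_le)
  also have "\<dots> = minimal_edistance \<Omega> x z + minimal_edistance \<Omega> z y + (ennreal (e / 2) + ennreal (e / 2))"
    by (simp add: ac_simps)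
  also have "ennreal (e / 2) + ennreal (e / 2) = ennreal e"
    using e by (simp flip: ennreal_plus)
  finally show "minimal_edistance \<Omega> x y \<le> minimal_edistance \<Omega> x z + minimal_edistance \<Omega> z y + ennreal e" .
qed

subsection \<open>Complete hyperbolicity\<close>

text \<open>The minorant is |(h o \<gamma>)'| = |H(\<gamma>) . \<gamma>'| on the open interval. It
  is continuous there, hence measurable, lies below the integrand by hypothesis, and its integral
  bounds the change of \<open>h\<close>. The minorant itself is returned, not just the inequality,
  so that pieces can be added.\<close>

lemma lower_integral_smooth_piece:
  fixes H :: "'a::euclidean_space \<Rightarrow> 'a" and h :: "'a \<Rightarrow> real"
  assumes pq: "p \<le> q" and \<gamma>: "smooth_on_interval p q \<gamma>" and im: "\<And>t. t \<in> {p..q} \<Longrightarrow> \<gamma> t \<in> \<Omega>"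
    and h: "\<And>x. x \<in> \<Omega> \<Longrightarrow> (h has_derivative (\<lambda>v. H x \<bullet> v)) (at x)" and H: "continuous_on \<Omega> H"
    and le: "\<And>x v. x \<in> \<Omega> \<Longrightarrow> \<bar>H x \<bullet> v\<bar> \<le> minimal_pseudometric \<Omega> x v"
  obtains \<psi> :: "real \<Rightarrow> ennreal" where "\<psi> \<in> borel_measurable lborel"
    "\<And>t. \<psi> t \<le> ennreal (minimal_pseudometric \<Omega> (\<gamma> t) (vector_derivative \<gamma> (at t))) * indicator {p<..<q} t"
    "ennreal \<bar>h (\<gamma> q) - h (\<gamma> p)\<bar> \<le> integral\<^sup>N lborel \<psi>"
proof -
  obtain D where D: "continuous_on {p..q} D"
    "\<And>t. t \<in> {p..q} \<Longrightarrow> (\<gamma> has_vector_derivative D t) (at t within {p..q})"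
    "\<And>t. t \<in> {p<..<q} \<Longrightarrow> (\<gamma> has_vector_derivative D t) (at t)"
    by (rule smooth_on_interval_vector_derivative[OF \<gamma>]) (rule that; assumption)
  define \<phi> where "\<phi> t = H (\<gamma> t) \<bullet> D t" for t
  have cont\<gamma>: "continuous_on {p..q} \<gamma>"
    using D(2) by (rule continuous_on_vector_derivative)
  have cont: "continuous_on {p..q} \<phi>"
    unfolding \<phi>_def
    by (intro continuous_intros D(1) continuous_on_compose2[OF H cont\<gamma>]) (use im in auto)
  have "((\<lambda>t. h (\<gamma> t)) has_vector_derivative \<phi> t) (at t within {p..q})" if t: "t \<in> {p..q}" for t
  proof -
    have "(h has_derivative (\<lambda>v. H (\<gamma> t) \<bullet> v)) (at (\<gamma> t) within \<gamma> ` {p..q})"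
      using h[OF im[OF t]] by (rule has_derivative_at_withinI)
    moreover have "(\<gamma> has_derivative (\<lambda>s. s *\<^sub>R D t)) (at t within {p..q})"
      using D(2)[OF t] by (simp add: has_vector_derivative_def)
    ultimately have "((\<lambda>t. h (\<gamma> t)) has_derivative (\<lambda>s. H (\<gamma> t) \<bullet> (s *\<^sub>R D t))) (at t within {p..q})"
      by (rule has_derivative_in_compose[rotated])
    then show ?thesis
      by (simp add: has_vector_derivative_def \<phi>_def)
  qed
  then have int: "(\<phi> has_integral (h (\<gamma> q) - h (\<gamma> p))) {p..q}"
    by (intro fundamental_theorem_of_calculus pq)
  have intabs: "(\<lambda>t. \<bar>\<phi> t\<bar>) integrable_on {p..q}"
    using cont by (intro integrable_continuous_real continuous_intros)
  define I where "I = integral {p..q} (\<lambda>t. \<bar>\<phi> t\<bar>)"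
  have I: "\<bar>h (\<gamma> q) - h (\<gamma> p)\<bar> \<le> I"
    using integral_norm_bound_integral[of \<phi> "{p..q}" "\<lambda>t. \<bar>\<phi> t\<bar>"] int intabs
    by (auto simp: I_def integral_unique integrable_on_def)
  have "((\<lambda>t. \<bar>\<phi> t\<bar>) has_integral I) {p<..<q}"
    using intabs unfolding I_def has_integral_Icc_iff_Ioo[symmetric] by (rule integrable_integral)
  then have intU: "((\<lambda>t. indicator {p<..<q} t *\<^sub>R \<bar>\<phi> t\<bar>) has_integral I) UNIV"
  proof -
    have "(\<lambda>t. indicator {p<..<q} t *\<^sub>R \<bar>\<phi> t\<bar>) = (\<lambda>t. if t \<in> {p<..<q} then \<bar>\<phi> t\<bar> else 0)"
      by (auto simp: indicator_def)
    then show ?thesis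
      using \<open>(_ has_integral I) {p<..<q}\<close> by (simp only: has_integral_restrict_UNIV)
  qed
  have meas: "(\<lambda>t. indicator {p<..<q} t *\<^sub>R \<bar>\<phi> t\<bar>) \<in> borel_measurable borel"
    by (intro borel_measurable_continuous_on_indicator continuous_intros continuous_on_subset[OF cont]) auto
  define \<psi> where "\<psi> t = ennreal (indicator {p<..<q} t *\<^sub>R \<bar>\<phi> t\<bar>)" for t
  have eq: "integral\<^sup>N lborel \<psi> = ennreal I"
    unfolding \<psi>_def by (rule nn_integral_has_integral_lborel[OF meas _ intU]) simp
  show thesis
  proof (rule that[of \<psi>])
    show "\<psi> \<in> borel_measurable lborel"
      unfolding \<psi>_def using meas by simp
    show "ennreal \<bar>h (\<gamma> q) - h (\<gamma> p)\<bar> \<le> integral\<^sup>N lborel \<psi>"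
      unfolding eq using I by (rule ennreal_leI)
    show "\<psi> t \<le> ennreal (minimal_pseudometric \<Omega> (\<gamma> t) (vector_derivative \<gamma> (at t))) * indicator {p<..<q} t" for t
    proof (cases "t \<in> {p<..<q}")
      case True
      then have "vector_derivative \<gamma> (at t) = D t"
        using D(3) vector_derivative_at by blast
      moreover have "\<bar>\<phi> t\<bar> \<le> minimal_pseudometric \<Omega> (\<gamma> t) (D t)"
        unfolding \<phi>_def using True by (intro le im) auto
      ultimately show ?thesis
        using True by (simp add: \<psi>_def ennreal_leI)
    qed (simp add: \<psi>_def)
  qed
qed

text \<open>Minorants of successive smooth pieces are measurable and live on disjoint intervals, so
  their sum is again a minorant and its integral is the sum of the integrals. Half-open intervals in
  the induction keep the supports disjoint at break points.\<close>

lemma minimal_length_lower_bound: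
  fixes H :: "'a::euclidean_space \<Rightarrow> 'a" and h :: "'a \<Rightarrow> real"
  assumes \<gamma>: "\<gamma> \<in> paths_between \<Omega> x y"
    and h: "\<And>x. x \<in> \<Omega> \<Longrightarrow> (h has_derivative (\<lambda>v. H x \<bullet> v)) (at x)" and H: "continuous_on \<Omega> H"
    and le: "\<And>x v. x \<in> \<Omega> \<Longrightarrow> \<bar>H x \<bullet> v\<bar> \<le> minimal_pseudometric \<Omega> x v"
  shows "ennreal \<bar>h y - h x\<bar> \<le> minimal_length \<Omega> \<gamma>"
proof -
  let ?G = "\<lambda>t. ennreal (minimal_pseudometric \<Omega> (\<gamma> t) (vector_derivative \<gamma> (at t)))"
  obtain m p where p: "p 0 = (0::real)" "p (m::nat) = 1" "\<And>i. i < m \<Longrightarrow> p i < p (Suc i)"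
    "\<And>i. i < m \<Longrightarrow> smooth_on_interval (p i) (p (Suc i)) \<gamma>" "\<And>i. i \<le> m \<Longrightarrow> 0 \<le> p i \<and> p i \<le> 1"
  proof -
    have "piecewise_smooth_path \<gamma>"
      using \<gamma> by (simp add: paths_between_def)
    from piecewise_smooth_pathE[OF this] that show thesis
      by metis
  qed
  have im: "\<gamma> t \<in> \<Omega>" if "t \<in> {0..1}" for t
    using \<gamma> that by (auto simp: paths_between_def path_image_def)
  have "\<exists>\<psi> \<in> borel_measurable lborel. (\<forall>t. \<psi> t \<le> ?G t * indicator {0..<p i} t) \<and>
      ennreal \<bar>h (\<gamma> (p i)) - h (\<gamma> 0)\<bar> \<le> integral\<^sup>N lborel \<psi>" if "i \<le> m" for i
    using that
  proof (induction i)
    case 0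
    show ?case
      by (intro bexI[of _ "\<lambda>_. 0"]) (auto simp: p(1))
  next
    case (Suc i)
    then obtain \<psi> where \<psi>: "\<psi> \<in> borel_measurable lborel" "\<And>t. \<psi> t \<le> ?G t * indicator {0..<p i} t"
      "ennreal \<bar>h (\<gamma> (p i)) - h (\<gamma> 0)\<bar> \<le> integral\<^sup>N lborel \<psi>"
      by auto
    have i: "i < m" "p i < p (Suc i)" "0 \<le> p i" "p (Suc i) \<le> 1"
      using Suc.prems p(3)[of i] p(5)[of i] p(5)[of "Suc i"] by auto
    have im': "\<gamma> t \<in> \<Omega>" if "t \<in> {p i..p (Suc i)}" for t
      using im that i(3,4) by simp
    obtain \<xi> where \<xi>: "\<xi> \<in> borel_measurable lborel"
      "\<And>t. \<xi> t \<le> ?G t * indicator {p i<..<p (Suc i)} t"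
      "ennreal \<bar>h (\<gamma> (p (Suc i))) - h (\<gamma> (p i))\<bar> \<le> integral\<^sup>N lborel \<xi>"
      by (rule lower_integral_smooth_piece[OF less_imp_le[OF i(2)] p(4)[OF i(1)] im' h H le])
        (assumption | rule that; assumption)+
    have "\<psi> t + \<xi> t \<le> ?G t * indicator {0..<p (Suc i)} t" for t
      using \<psi>(2)[of t] \<xi>(2)[of t] i by (cases "t < p i"; cases "t \<in> {0..<p (Suc i)}") (auto split: split_indicator_asm)
    moreover have "ennreal \<bar>h (\<gamma> (p (Suc i))) - h (\<gamma> 0)\<bar> \<le> (\<integral>\<^sup>+t. \<psi> t + \<xi> t \<partial>lborel)"
    proof -
      have "ennreal \<bar>h (\<gamma> (p (Suc i))) - h (\<gamma> 0)\<bar>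
          \<le> ennreal (\<bar>h (\<gamma> (p i)) - h (\<gamma> 0)\<bar> + \<bar>h (\<gamma> (p (Suc i))) - h (\<gamma> (p i))\<bar>)"
        by (rule ennreal_leI) linarith
      also have "\<dots> = ennreal \<bar>h (\<gamma> (p i)) - h (\<gamma> 0)\<bar> + ennreal \<bar>h (\<gamma> (p (Suc i))) - h (\<gamma> (p i))\<bar>"
        by simp
      also have "\<dots> \<le> integral\<^sup>N lborel \<psi> + integral\<^sup>N lborel \<xi>"
        using \<psi>(3) \<xi>(3) by (rule add_mono)
      also have "\<dots> = (\<integral>\<^sup>+t. \<psi> t + \<xi> t \<partial>lborel)"
        using \<psi>(1) \<xi>(1) by (simp add: nn_integral_add)
      finally show ?thesis .
    qed
    ultimately show ?case
      using \<psi>(1) \<xi>(1) by (intro bexI[of _ "\<lambda>t. \<psi> t + \<xi> t"]) auto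
  qed
  from this[of m] obtain \<psi> where \<psi>: "\<And>t. \<psi> t \<le> ?G t * indicator {0..<1} t"
    "ennreal \<bar>h (\<gamma> 1) - h (\<gamma> 0)\<bar> \<le> integral\<^sup>N lborel \<psi>"
    using p(2) by auto
  have "h y - h x = h (\<gamma> 1) - h (\<gamma> 0)"
    using \<gamma> by (auto simp: paths_between_def pathstart_def pathfinish_def)
  then have "ennreal \<bar>h y - h x\<bar> \<le> integral\<^sup>N lborel \<psi>"
    using \<psi>(2) by simp
  also have "\<dots> \<le> minimal_length \<Omega> \<gamma>"
    unfolding minimal_length_def
  proof (rule nn_integral_mono)
    fix t
    show "\<psi> t \<le> ?G t * indicator {0..1} t"
      using \<psi>(1)[of t] by (auto split: split_indicator split_indicator_asm)
  qed
  finally show ?thesis .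
qed

lemma linepath_in_paths_between: "closed_segment x y \<subseteq> \<Omega> \<Longrightarrow> linepath x y \<in> paths_between \<Omega> x y"
  by (simp add: paths_between_def piecewise_smooth_path_linepath)

lemma minimal_edistance_le_segment:
  assumes seg: "closed_segment x y \<subseteq> \<Omega>"
    and le: "\<And>z. z \<in> closed_segment x y \<Longrightarrow> minimal_pseudometric \<Omega> z (y - x) \<le> c"
  shows "minimal_edistance \<Omega> x y \<le> ennreal c"
proof -
  have "minimal_edistance \<Omega> x y \<le> minimal_length \<Omega> (linepath x y)"
    unfolding minimal_edistance_def by (rule INF_lower) (rule linepath_in_paths_between[OF seg])
  also have "\<dots> \<le> (\<integral>\<^sup>+t\<in>{0..1::real}. ennreal c \<partial>lborel)"
    unfolding minimal_length_def
  proof (rule nn_integral_mono)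
    fix t :: real
    show "ennreal (minimal_pseudometric \<Omega> (linepath x y t) (vector_derivative (linepath x y) (at t))) * indicator {0..1} t
        \<le> ennreal c * indicator {0..1} t"
      using le[OF linepath_in_path] by (cases "t \<in> {0..1}") (auto intro: ennreal_leI)
  qed
  also have "\<dots> = ennreal c"
    by (simp add: nn_integral_cmult)
  finally show ?thesis .
qed

lemma minimal_edistance_le_dist:
  fixes \<Omega> :: "'a::euclidean_space set"
  assumes dim: "DIM('a) \<ge> 2" and d: "d > 0" "\<And>z. z \<in> closed_segment x y \<Longrightarrow> ball z d \<subseteq> \<Omega>"
  shows "minimal_edistance \<Omega> x y \<le> ennreal (dist x y / d)"
proof (rule minimal_edistance_le_segment)
  show "closed_segment x y \<subseteq> \<Omega>"
    using d by force
  show "minimal_pseudometric \<Omega> z (y - x) \<le> dist x y / d" if "z \<in> closed_segment x y" for z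
    using minimal_pseudometric_le[OF dim d(1) d(2)[OF that], of "y - x"] by (simp add: dist_norm norm_minus_commute)
qed

text \<open>A flat disc of radius 1 / \<epsilon> in the plane makes \<epsilon> a candidate for the
  unit vector \<open>e1\<close>. The metric thus vanishes along the segment from \<open>x\<close> to
  \<open>x + e1\<close>, which has length 0.\<close>

lemma contains_plane_not_hyperbolic:
  fixes \<Omega> :: "'a::euclidean_space set"
  assumes "contains_plane \<Omega>"
  shows "\<not> hyperbolic \<Omega>"
proof -
  obtain x e1 e2 where e: "norm e1 = 1" "norm e2 = 1" "e1 \<bullet> e2 = 0"
    and sub: "\<And>s t. x + s *\<^sub>R e1 + t *\<^sub>R e2 \<in> \<Omega>"
    using assms unfolding contains_plane_def by blast
  have zero: "minimal_pseudometric \<Omega> (x + s *\<^sub>R e1) e1 \<le> 0" for s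
  proof (rule field_le_epsilon)
    fix \<epsilon> :: real assume \<epsilon>: "\<epsilon> > 0"
    let ?f = "\<lambda>z. (x + s *\<^sub>R e1) + Re z *\<^sub>R ((1 / \<epsilon>) *\<^sub>R e1) + Im z *\<^sub>R ((1 / \<epsilon>) *\<^sub>R e2)"
    have into: "?f z \<in> \<Omega>" for z
      using sub[of "s + Re z / \<epsilon>" "Im z / \<epsilon>"] by (simp add: algebra_simps)
    have "?f \<in> CH_plane unit_disc \<Omega>" "partial_x ?f 0 = (1 / \<epsilon>) *\<^sub>R e1"
      by (rule affine_conformal_CH_plane[where D = unit_disc and \<Omega> = \<Omega>]; use e into in simp)+
    then have "1 / (1 / \<epsilon>) \<in> metric_candidates \<Omega> (x + s *\<^sub>R e1) e1"
      unfolding metric_candidates_def using \<epsilon>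
      by (intro CollectI exI[of _ "1 / \<epsilon>"] conjI bexI[of _ ?f]) auto
    then show "minimal_pseudometric \<Omega> (x + s *\<^sub>R e1) e1 \<le> 0 + \<epsilon>"
      unfolding minimal_pseudometric_eq
      using cInf_lower[OF _ bdd_below_metric_candidates] by force
  qed
  have seg: "\<exists>s. z = x + s *\<^sub>R e1" if "z \<in> closed_segment x (x + e1)" for z
  proof -
    have "\<exists>u. z = (1 - u) *\<^sub>R x + u *\<^sub>R (x + e1)"
      using that unfolding in_segment by blast
    then obtain u where "z = (1 - u) *\<^sub>R x + u *\<^sub>R (x + e1)" ..
    then show ?thesis
      by (intro exI[of _ u]) (simp add: algebra_simps)
  qed
  have in\<Omega>: "x + s *\<^sub>R e1 \<in> \<Omega>" for s
    using sub[of s 0] by simp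
  have "minimal_edistance \<Omega> x (x + e1) \<le> ennreal 0"
  proof (rule minimal_edistance_le_segment)
    show "closed_segment x (x + e1) \<subseteq> \<Omega>"
      using seg in\<Omega> by blast
    show "minimal_pseudometric \<Omega> z (x + e1 - x) \<le> 0" if "z \<in> closed_segment x (x + e1)" for z
      using seg[OF that] zero by auto
  qed
  then have "minimal_pseudodistance \<Omega> x (x + e1) = 0"
    by (simp add: minimal_pseudodistance_eq)
  moreover have "x \<in> \<Omega>" "x + e1 \<in> \<Omega>" "x \<noteq> x + e1"
    using in\<Omega>[of 0] in\<Omega>[of 1] e(1) by auto
  ultimately show ?thesis
    unfolding hyperbolic_def by force
qed

section \<open>Completeness through logarithmic lower bounds for the distance\<close>

context convex_halfspace_domain
begin

lemma minimal_edistance_finite: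
  assumes "x \<in> \<Omega>" "y \<in> \<Omega>"
  shows "minimal_edistance \<Omega> x y < top"
proof -
  have "closed_segment x y \<subseteq> \<Omega>"
    using assms convex_domain by (simp add: convex_contains_segment)
  then obtain d where d: "d > 0" "(\<Union>z\<in>closed_segment x y. ball z d) \<subseteq> \<Omega>"
    using compact_subset_open_imp_ball_epsilon_subset[OF compact_segment open_domain] by metis
  then have "minimal_edistance \<Omega> x y \<le> ennreal (dist x y / d)"
    by (intro minimal_edistance_le_dist[OF dim2]) auto
  then show ?thesis
    using ennreal_less_top le_less_trans by blast
qed

lemma minimal_pseudodistance_lower_bound:
  assumes xy: "x \<in> \<Omega>" "y \<in> \<Omega>"
    and h: "\<And>x. x \<in> \<Omega> \<Longrightarrow> (h has_derivative (\<lambda>v. H x \<bullet> v)) (at x)" and H: "continuous_on \<Omega> H"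
    and le: "\<And>x v. x \<in> \<Omega> \<Longrightarrow> \<bar>H x \<bullet> v\<bar> \<le> minimal_pseudometric \<Omega> x v"
  shows "\<bar>h y - h x\<bar> \<le> minimal_pseudodistance \<Omega> x y"
proof -
  have "ennreal \<bar>h y - h x\<bar> \<le> minimal_edistance \<Omega> x y"
    unfolding minimal_edistance_def
    by (rule INF_greatest) (rule minimal_length_lower_bound[OF _ h H le])
  then have "enn2real (ennreal \<bar>h y - h x\<bar>) \<le> enn2real (minimal_edistance \<Omega> x y)"
    using minimal_edistance_finite[OF xy] by (rule enn2real_mono)
  then show ?thesis
    by (simp add: minimal_pseudodistance_eq)
qed

lemma minimal_pseudometric_ge_functional:
  assumes x: "x \<in> \<Omega>" and a: "\<And>y. y \<in> \<Omega> \<Longrightarrow> a \<bullet> y < c"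
  shows "\<bar>a \<bullet> v\<bar> / (2 * (c - a \<bullet> x)) \<le> minimal_pseudometric \<Omega> x v"
  unfolding minimal_pseudometric_eq
proof (rule cInf_greatest[OF metric_candidates_nonempty[OF dim2 open_domain x]])
  fix k assume "k \<in> metric_candidates \<Omega> x v"
  then obtain r f where k: "k = 1 / r" "r > 0"
    and f: "f \<in> CH_plane (ball 0 1) \<Omega>" "f 0 = x" "partial_x f 0 = r *\<^sub>R v"
    unfolding metric_candidates_def by blast
  have "\<bar>a \<bullet> (r *\<^sub>R v)\<bar> \<le> 2 * (c - a \<bullet> x)"
    using CH_gradient_bound[OF f(1) zero_less_one a, of 1] f(2,3) by simp
  then show "\<bar>a \<bullet> v\<bar> / (2 * (c - a \<bullet> x)) \<le> k"
    using k(2) a[OF x] by (simp add: k(1) abs_mult field_simps)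
qed

text \<open>A disc competing for \<open>v\<close> with f_x(0) = r v has r |v| bounded by a multiple
  of \<open>slack x\<close>, by the derivative bound at the centre. This controls all directions,
  whereas a single functional sees only its own component.\<close>

lemma minimal_pseudometric_ge_slack:
  obtains \<kappa> where "\<kappa> > 0" "\<And>x v. x \<in> \<Omega> \<Longrightarrow> \<kappa> * norm v / slack x \<le> minimal_pseudometric \<Omega> x v"
proof -
  obtain C where C: "C > 0"
    "\<And>F z R h. F \<in> CH_plane (ball z R) \<Omega> \<Longrightarrow> R > 0 \<Longrightarrow>
      norm (Re h *\<^sub>R partial_x F z + Im h *\<^sub>R partial_y F z) \<le> C / R * slack (F z) * norm h"
    using CH_derivative_bound by metis
  have "1 / C * norm v / slack x \<le> minimal_pseudometric \<Omega> x v" if x: "x \<in> \<Omega>" for x v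
    unfolding minimal_pseudometric_eq
  proof (rule cInf_greatest[OF metric_candidates_nonempty[OF dim2 open_domain x]])
    fix k assume "k \<in> metric_candidates \<Omega> x v"
    then obtain r f where k: "k = 1 / r" "r > 0"
      and f: "f \<in> CH_plane (ball 0 1) \<Omega>" "f 0 = x" "partial_x f 0 = r *\<^sub>R v"
      unfolding metric_candidates_def by blast
    have "r * norm v \<le> C * slack x"
      using C(2)[OF f(1) zero_less_one, of 1] f(2,3) k(2) by simp
    then show "1 / C * norm v / slack x \<le> k"
      using k(2) C(1) slack_pos[OF x] by (simp add: k(1) field_simps)
  qed
  then show thesis
    using C(1) by (intro that[of "1 / C"]) auto
qed

text \<open>Within bounded distance of \<open>x\<close> the quantity c - a . y stays bounded away
  from 0, whatever supporting functional is taken. The factor 2 is that of the gradient bound on the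
  unit disc.\<close>

lemma minimal_pseudodistance_ge_log_slack:
  assumes xy: "x \<in> \<Omega>" "y \<in> \<Omega>" and a: "\<And>y. y \<in> \<Omega> \<Longrightarrow> a \<bullet> y < c"
  shows "\<bar>ln (c - a \<bullet> y) - ln (c - a \<bullet> x)\<bar> \<le> 2 * minimal_pseudodistance \<Omega> x y"
proof -
  define h where "h p = ln (c - a \<bullet> p) / 2" for p
  define H where "H p = (- 1 / (2 * (c - a \<bullet> p))) *\<^sub>R a" for p
  have "\<bar>h y - h x\<bar> \<le> minimal_pseudodistance \<Omega> x y"
  proof (rule minimal_pseudodistance_lower_bound[OF xy])
    fix p assume p: "p \<in> \<Omega>"
    show "(h has_derivative (\<lambda>v. H p \<bullet> v)) (at p)"
      unfolding h_def H_def using a[OF p] by (auto intro!: derivative_eq_intros simp: field_simps)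
    show "\<bar>H p \<bullet> v\<bar> \<le> minimal_pseudometric \<Omega> p v" for v
      using minimal_pseudometric_ge_functional[OF p a, of v] a[OF p]
      by (simp add: H_def abs_mult)
  next
    show "continuous_on \<Omega> H"
      unfolding H_def using a by (intro continuous_intros) force
  qed
  then show ?thesis
    by (simp add: h_def diff_divide_distrib[symmetric])
qed

text \<open>This serves twice: it separates distinct points, and it makes sets of bounded distance
  bounded in the Euclidean sense.\<close>

lemma minimal_pseudodistance_ge_log_dist:
  obtains k where "k > 0"
    "\<And>x y. x \<in> \<Omega> \<Longrightarrow> y \<in> \<Omega> \<Longrightarrow> k * ln (1 + (dist x y / slack x)\<^sup>2) \<le> minimal_pseudodistance \<Omega> x y"
proof -
  obtain \<kappa> where \<kappa>: "\<kappa> > 0" "\<And>x v. x \<in> \<Omega> \<Longrightarrow> \<kappa> * norm v / slack x \<le> minimal_pseudometric \<Omega> x v"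
    using minimal_pseudometric_ge_slack by metis
  obtain A where A: "A > 0" "\<And>x y. slack y \<le> slack x + A * norm (y - x)"
    using slack_linear_growth by metis
  \<comment> \<open>With s = \<open>slack x\<close> and t = |p - x|, the gradient of ln (s^2 + t^2)
    has norm 2 t / (s^2 + t^2) \<le> 3 / (s + t), while \<open>slack p\<close> \<le> s + A t \<le>
    (1 + A) (s + t). So this \<open>k\<close> brings the gradient below \<kappa> /
    \<open>slack p\<close>.\<close>
  define k where "k = \<kappa> / (3 * (1 + A))"
  have k: "k > 0"
    using \<kappa> A by (simp add: k_def)
  have "k * ln (1 + (dist x y / slack x)\<^sup>2) \<le> minimal_pseudodistance \<Omega> x y" if xy: "x \<in> \<Omega>" "y \<in> \<Omega>" for x y
  proof -
    define s where "s = slack x"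
    have s: "s > 0"
      using slack_pos[OF xy(1)] by (simp add: s_def)
    have den: "s\<^sup>2 + (p - x) \<bullet> (p - x) > 0" for p
      using s by (simp add: add_pos_nonneg)
    define h where "h p = k * ln (s\<^sup>2 + (p - x) \<bullet> (p - x))" for p
    define H where "H p = (2 * k / (s\<^sup>2 + (p - x) \<bullet> (p - x))) *\<^sub>R (p - x)" for p
    have "\<bar>h y - h x\<bar> \<le> minimal_pseudodistance \<Omega> x y"
    proof (rule minimal_pseudodistance_lower_bound[OF xy])
      fix p assume p: "p \<in> \<Omega>"
      have "(\<lambda>v. H p \<bullet> v) = (\<lambda>v. k * (2 * ((p - x) \<bullet> v) / (s\<^sup>2 + (p - x) \<bullet> (p - x))))"
        by (simp add: H_def fun_eq_iff mult_ac)
      then show "(h has_derivative (\<lambda>v. H p \<bullet> v)) (at p)"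
        unfolding h_def using den[of p]
        by (auto intro!: derivative_eq_intros simp: inner_commute divide_inverse mult_ac)
      fix v
      define t where "t = norm (p - x)"
      have t: "t \<ge> 0" "(p - x) \<bullet> (p - x) = t\<^sup>2"
        by (auto simp: t_def power2_norm_eq_inner)
      have sp: "slack p > 0"
        using slack_pos[OF p] .
      have "slack p \<le> s + A * t"
        using A(2)[of p x] by (simp add: s_def t_def)
      also have "\<dots> \<le> (1 + A) * (s + t)"
        using A(1) s t by (simp add: algebra_simps)
      finally have slp: "slack p \<le> (1 + A) * (s + t)" .
      have "3 * (s\<^sup>2 + t\<^sup>2) - 2 * t * (s + t) = (s - t)\<^sup>2 + 2 * s\<^sup>2"
        by (simp add: power2_eq_square algebra_simps)
      then have "2 * t * (s + t) \<le> 3 * (s\<^sup>2 + t\<^sup>2)"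
        using zero_le_power2[of s] zero_le_power2[of "s - t"] by linarith
      then have "(1 + A) * (2 * t * (s + t)) \<le> (1 + A) * (3 * (s\<^sup>2 + t\<^sup>2))"
        using A(1) by (intro mult_left_mono) auto
      moreover have "2 * t * slack p \<le> 2 * t * ((1 + A) * (s + t))"
        using slp t by (intro mult_left_mono) auto
      moreover have "2 * t * ((1 + A) * (s + t)) = (1 + A) * (2 * t * (s + t))"
        by simp
      ultimately have "2 * t * slack p \<le> (1 + A) * (3 * (s\<^sup>2 + t\<^sup>2))"
        by linarith
      then have "2 * t / (s\<^sup>2 + t\<^sup>2) \<le> 3 * (1 + A) / slack p"
        using sp den[of p] t(2) by (simp add: field_simps)
      then have "k * (2 * t / (s\<^sup>2 + t\<^sup>2)) \<le> k * (3 * (1 + A) / slack p)"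
        using k by (intro mult_left_mono) auto
      also have "\<dots> = \<kappa> / slack p"
        using A(1) by (simp add: k_def)
      finally have coef: "2 * k * t / (s\<^sup>2 + t\<^sup>2) \<le> \<kappa> / slack p"
        by (simp add: mult_ac)
      have "\<bar>H p \<bullet> v\<bar> \<le> norm (H p) * norm v"
        by (rule Cauchy_Schwarz_ineq2)
      also have "norm (H p) = 2 * k * t / (s\<^sup>2 + t\<^sup>2)"
        using k den[of p] unfolding H_def t(2) by (simp add: t_def)
      also have "\<dots> * norm v \<le> \<kappa> / slack p * norm v"
        using coef by (rule mult_right_mono) simp
      also have "\<dots> \<le> minimal_pseudometric \<Omega> p v"
        using \<kappa>(2)[OF p, of v] by simp
      finally show "\<bar>H p \<bullet> v\<bar> \<le> minimal_pseudometric \<Omega> p v" .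
    next
      show "continuous_on \<Omega> H"
        unfolding H_def by (intro continuous_intros) (use den in \<open>force simp: less_le\<close>)
    qed
    moreover have "h y - h x = k * ln (1 + (dist x y / slack x)\<^sup>2)"
    proof -
      have "h y - h x = k * (ln (s\<^sup>2 + (y - x) \<bullet> (y - x)) - ln (s\<^sup>2))"
        by (simp add: h_def algebra_simps)
      also have "\<dots> = k * ln ((s\<^sup>2 + (y - x) \<bullet> (y - x)) / s\<^sup>2)"
        using den[of y] s by (simp add: ln_div)
      also have "(s\<^sup>2 + (y - x) \<bullet> (y - x)) / s\<^sup>2 = 1 + (dist x y / s)\<^sup>2"
        using s by (simp add: dot_square_norm dist_norm norm_minus_commute power_divide add_divide_distrib)
      finally show ?thesis
        by (simp add: s_def)
    qed
    ultimately show ?thesis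
      by linarith
  qed
  with k show thesis
    using that by blast
qed

lemma Metric_space_minimal_pseudodistance: "Metric_space \<Omega> (minimal_pseudodistance \<Omega>)"
proof
  show "0 \<le> minimal_pseudodistance \<Omega> x y" for x y
    by (simp add: minimal_pseudodistance_eq)
  show "minimal_pseudodistance \<Omega> x y = minimal_pseudodistance \<Omega> y x" for x y
    by (simp add: minimal_pseudodistance_eq minimal_edistance_commute[of _ x])
next
  fix x y assume xy: "x \<in> \<Omega>" "y \<in> \<Omega>"
  obtain k where k: "k > 0"
    "\<And>x y. x \<in> \<Omega> \<Longrightarrow> y \<in> \<Omega> \<Longrightarrow> k * ln (1 + (dist x y / slack x)\<^sup>2) \<le> minimal_pseudodistance \<Omega> x y"
    using minimal_pseudodistance_ge_log_dist by blast
  show "minimal_pseudodistance \<Omega> x y = 0 \<longleftrightarrow> x = y"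
  proof
    assume "minimal_pseudodistance \<Omega> x y = 0"
    then have "k * ln (1 + (dist x y / slack x)\<^sup>2) \<le> 0"
      using k(2)[OF xy] by simp
    then have "(dist x y / slack x)\<^sup>2 \<le> 0"
      using k(1) by (simp add: mult_le_0_iff add_pos_nonneg)
    then show "x = y"
      using slack_pos[OF xy(1)] by simp
  next
    assume [simp]: "x = y"
    obtain d where d: "d > 0" "ball x d \<subseteq> \<Omega>"
      using open_domain xy(1) openE by blast
    have "minimal_edistance \<Omega> x x \<le> ennreal (dist x x / d)"
      by (rule minimal_edistance_le_dist[OF dim2 d(1)]) (use d in simp)
    then show "minimal_pseudodistance \<Omega> x y = 0"
      using \<open>x = y\<close> by (simp add: minimal_pseudodistance_eq)
  qed
next
  fix x y z assume "x \<in> \<Omega>" "y \<in> \<Omega>" "z \<in> \<Omega>"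
  then have fin: "minimal_edistance \<Omega> x y < top" "minimal_edistance \<Omega> y z < top"
    using minimal_edistance_finite by auto
  have "enn2real (minimal_edistance \<Omega> x z) \<le> enn2real (minimal_edistance \<Omega> x y + minimal_edistance \<Omega> y z)"
    using fin by (intro enn2real_mono minimal_edistance_triangle[OF dim2 open_domain]) simp
  also have "\<dots> = enn2real (minimal_edistance \<Omega> x y) + enn2real (minimal_edistance \<Omega> y z)"
    using fin by (rule enn2real_plus)
  finally show "minimal_pseudodistance \<Omega> x z \<le> minimal_pseudodistance \<Omega> x y + minimal_pseudodistance \<Omega> y z"
    by (simp add: minimal_pseudodistance_eq)
qed

lemma minimal_pseudodistance_le_dist:
  assumes d: "d > 0" "ball z (2 * d) \<subseteq> \<Omega>" and xy: "x \<in> ball z d" "y \<in> ball z d"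
  shows "minimal_pseudodistance \<Omega> x y \<le> dist x y / d"
proof -
  have "ball w d \<subseteq> \<Omega>" if "w \<in> closed_segment x y" for w
  proof -
    have w: "w \<in> ball z d"
      using that xy closed_segment_subset[OF xy convex_ball] by blast
    have "ball w d \<subseteq> ball z (2 * d)"
    proof
      fix u assume "u \<in> ball w d"
      then show "u \<in> ball z (2 * d)"
        using w dist_triangle[of z u w] by simp
    qed
    then show ?thesis
      using d(2) by blast
  qed
  then have "minimal_edistance \<Omega> x y \<le> ennreal (dist x y / d)"
    by (rule minimal_edistance_le_dist[OF dim2 d(1)])
  then have "enn2real (minimal_edistance \<Omega> x y) \<le> enn2real (ennreal (dist x y / d))"
    by (rule enn2real_mono) simp
  then show ?thesis
    using d(1) by (simp add: minimal_pseudodistance_eq)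
qed

text \<open>The tail of a Cauchy sequence is within distance 1 of one of its points
  \<open>x\<close>. The bound by ln of the Euclidean distance makes it bounded, so a subsequence has
  a Euclidean limit \<open>l\<close>; the bound for a functional supporting the domain at
  \<open>l\<close> excludes that \<open>l\<close> lies outside. Near \<open>l\<close> the distance
  is at most a multiple of the Euclidean one, so the subsequence converges in the metric, which
  suffices for a Cauchy sequence.\<close>

theorem complete_hyperbolic_domain: "complete_hyperbolic \<Omega>"
proof -
  let ?\<rho> = "minimal_pseudodistance \<Omega>"
  interpret M: Metric_space \<Omega> ?\<rho>
    by (rule Metric_space_minimal_pseudodistance)
  have "hyperbolic \<Omega>"
    unfolding hyperbolic_def using M.mdist_pos_less by blast
  moreover have "M.mcomplete"
    unfolding M.mcomplete_def
  proof (intro allI impI)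
    fix \<sigma> assume \<sigma>: "M.MCauchy \<sigma>"
    then have in\<Omega>: "\<sigma> n \<in> \<Omega>" for n
      by (auto simp: M.MCauchy_def)
    obtain n0 where n0: "\<And>n. n \<ge> n0 \<Longrightarrow> ?\<rho> (\<sigma> n0) (\<sigma> n) < 1"
      using \<sigma> unfolding M.MCauchy_def by (metis order_refl zero_less_one)
    define x where "x = \<sigma> n0"
    have x: "x \<in> \<Omega>"
      by (simp add: x_def in\<Omega>)
    define s where "s = slack x"
    have s: "s > 0"
      using slack_pos[OF x] by (simp add: s_def)
    obtain k where k: "k > 0"
      "\<And>x y. x \<in> \<Omega> \<Longrightarrow> y \<in> \<Omega> \<Longrightarrow> k * ln (1 + (dist x y / slack x)\<^sup>2) \<le> ?\<rho> x y"
      using minimal_pseudodistance_ge_log_dist by blast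
    have bound: "dist x (\<sigma> (n0 + n)) \<le> s * exp (1 / k)" for n
    proof -
      define t where "t = dist x (\<sigma> (n0 + n)) / s"
      have t: "t \<ge> 0"
        using s by (simp add: t_def)
      have "k * ln (1 + t\<^sup>2) \<le> ?\<rho> x (\<sigma> (n0 + n))"
        using k(2)[OF x in\<Omega>] by (simp add: t_def s_def)
      also have "\<dots> < 1"
        using n0 by (simp add: x_def)
      finally have "ln (1 + t\<^sup>2) < 1 / k"
        using k(1) by (simp add: field_simps)
      then have "1 + t\<^sup>2 < exp (1 / k)"
        by (metis exp_less_cancel_iff exp_ln add_pos_nonneg zero_le_power2 zero_less_one)
      moreover have "t \<le> 1 + t\<^sup>2"
        using zero_le_power2[of "t - 1"] t unfolding power2_diff by (simp add: power2_eq_square)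
      ultimately have "s * t \<le> s * exp (1 / k)"
        using s by (intro mult_left_mono) auto
      then show ?thesis
        using s by (simp add: t_def)
    qed
    then have "bounded (range (\<lambda>n. \<sigma> (n0 + n)))"
      unfolding bounded_def by blast
    then obtain l r where r: "strict_mono (r :: nat \<Rightarrow> nat)" and lim: "((\<lambda>n. \<sigma> (n0 + n)) \<circ> r) \<longlonglongrightarrow> l"
      using bounded_imp_convergent_subsequence by blast
    then have lim': "(\<lambda>n. \<sigma> (n0 + r n)) \<longlonglongrightarrow> l"
      by (simp add: o_def)
    have l: "l \<in> \<Omega>"
    proof (rule ccontr)
      assume "l \<notin> \<Omega>"
      then obtain a c where a: "a \<bullet> l \<ge> c" "\<And>y. y \<in> \<Omega> \<Longrightarrow> a \<bullet> y < c"
        using supporting_halfspace_open_convex[OF convex_domain open_domain] by metis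
      \<comment> \<open>Distance below 1 changes ln (c - a . y) by less than 2.\<close>
      have "exp (- 2) * (c - a \<bullet> x) \<le> c - a \<bullet> \<sigma> (n0 + r n)" for n
      proof -
        let ?y = "\<sigma> (n0 + r n)"
        have "\<bar>ln (c - a \<bullet> ?y) - ln (c - a \<bullet> x)\<bar> \<le> 2 * ?\<rho> x ?y"
          by (rule minimal_pseudodistance_ge_log_slack[OF x in\<Omega> a(2)])
        also have "\<dots> < 2"
          using n0[of "n0 + r n"] by (simp add: x_def)
        finally have "- 2 + ln (c - a \<bullet> x) \<le> ln (c - a \<bullet> ?y)"
          by linarith
        then have "exp (- 2 + ln (c - a \<bullet> x)) \<le> exp (ln (c - a \<bullet> ?y))"
          by simp
        moreover have "c - a \<bullet> x > 0" "c - a \<bullet> ?y > 0"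
          using a(2)[OF x] a(2)[OF in\<Omega>] by simp_all
        ultimately show ?thesis
          by (simp only: exp_add exp_ln)
      qed
      moreover have "(\<lambda>n. c - a \<bullet> \<sigma> (n0 + r n)) \<longlonglongrightarrow> c - a \<bullet> l"
        by (intro tendsto_intros lim')
      ultimately have "exp (- 2) * (c - a \<bullet> x) \<le> c - a \<bullet> l"
        by (intro LIMSEQ_le_const) auto
      moreover have "exp (- 2) * (c - a \<bullet> x) > 0"
        using a(2)[OF x] by simp
      ultimately show False
        using a(1) by simp
    qed
    obtain d' where d': "d' > 0" "ball l d' \<subseteq> \<Omega>"
      using open_domain l openE by blast
    define d where "d = d' / 2"
    have d: "d > 0" "ball l (2 * d) \<subseteq> \<Omega>"
      using d' by (auto simp: d_def)
    have "limitin M.mtopology (\<sigma> \<circ> (\<lambda>n. n0 + r n)) l sequentially"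
      unfolding M.limitin_metric
    proof (intro conjI allI impI l)
      fix \<epsilon> :: real assume \<epsilon>: "\<epsilon> > 0"
      have "\<forall>\<^sub>F n in sequentially. dist (\<sigma> (n0 + r n)) l < min d (d * \<epsilon>)"
        using tendstoD[OF lim', of "min d (d * \<epsilon>)"] d \<epsilon> by simp
      then show "\<forall>\<^sub>F n in sequentially. (\<sigma> \<circ> (\<lambda>n. n0 + r n)) n \<in> \<Omega> \<and> ?\<rho> ((\<sigma> \<circ> (\<lambda>n. n0 + r n)) n) l < \<epsilon>"
      proof eventually_elim
        case (elim n)
        have "?\<rho> (\<sigma> (n0 + r n)) l \<le> dist (\<sigma> (n0 + r n)) l / d"
          using elim d by (intro minimal_pseudodistance_le_dist[of d l]) (auto simp: dist_commute)
        also have "\<dots> < \<epsilon>"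
          using elim d by (simp add: field_simps)
        finally show ?case
          using in\<Omega> by simp
      qed
    qed
    moreover have "strict_mono (\<lambda>n. n0 + r n)"
      using r by (simp add: strict_mono_def)
    ultimately show "\<exists>l. limitin M.mtopology \<sigma> l sequentially"
      using M.MCauchy_convergent_subsequence[OF \<sigma>] by blast
  qed
  ultimately show ?thesis
    unfolding complete_hyperbolic_def using Metric_space_minimal_pseudodistance by blast
qed

end

subsection \<open>Riemann surfaces\<close>

lemma CH_surface_locally_CH:
  assumes X: "riemann_surface X A"
  shows "locally_CH X \<Omega> (CH_surface X A \<Omega>)"
  unfolding locally_CH_def
proof
  fix p assume "p \<in> topspace X"
  then obtain U \<phi> where U: "(U, \<phi>) \<in> A" "p \<in> U"
    using X unfolding riemann_surface_def by blast
  have chart: "openin X U" "open (\<phi> ` U)" "homeomorphic_map (subtopology X U) (top_of_set (\<phi> ` U)) \<phi>"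
    using X U(1) unfolding riemann_surface_def by auto
  have top: "topspace (subtopology X U) = U"
    using openin_subset[OF chart(1)] by auto
  have inj: "inj_on \<phi> U"
    using chart(3) homeomorphic_map_def homeomorphic_eq_everything_map top by metis
  have cont: "continuous_map (subtopology X U) euclidean \<phi>"
    using homeomorphic_imp_continuous_map[OF chart(3)] continuous_map_in_subtopology by blast
  obtain R where R: "R > 0" "ball (\<phi> p) R \<subseteq> \<phi> ` U"
    using chart(2) U(2) openE by (metis imageI)
  define W where "W = {q \<in> topspace (subtopology X U). \<phi> q \<in> ball (\<phi> p) R}"
  have "openin (subtopology X U) W"
    unfolding W_def using cont by (rule openin_continuous_map_preimage) simp
  then have "openin X W"
    using chart(1) openin_trans_full by blast
  moreover have "p \<in> W" "W \<subseteq> U" "\<phi> ` W \<subseteq> ball (\<phi> p) R"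
    using U(2) R(1) top by (auto simp: W_def)
  moreover have "continuous_map (subtopology X W) euclidean \<phi>"
    using cont \<open>W \<subseteq> U\<close> continuous_map_from_subtopology_mono by blast
  moreover have "\<exists>F\<in>CH_plane (ball (\<phi> p) R) \<Omega>. \<forall>q\<in>W. f q = F (\<phi> q)"
    if f: "f \<in> CH_surface X A \<Omega>" for f
  proof (intro bexI ballI)
    let ?F = "f \<circ> inv_into U \<phi>"
    show "f q = ?F (\<phi> q)" if "q \<in> W" for q
      using inj that \<open>W \<subseteq> U\<close> by (simp add: inv_into_f_f subset_iff)
    have "U \<subseteq> topspace X"
      using chart(1) by (rule openin_subset)
    then have "?F \<in> CH_plane (\<phi> ` U) \<Omega>"
      using f U(1) inv_into_into[of _ \<phi> U] unfolding CH_plane_def CH_surface_def by fastforce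
    then show "?F \<in> CH_plane (ball (\<phi> p) R) \<Omega>"
      using R(2) CH_plane_mono by blast
  qed
  ultimately show "\<exists>W R \<phi>. openin X W \<and> p \<in> W \<and> R > 0 \<and>
     continuous_map (subtopology X W) euclidean \<phi> \<and> \<phi> ` W \<subseteq> ball (\<phi> p) R \<and>
     (\<forall>f\<in>CH_surface X A \<Omega>. \<exists>F\<in>CH_plane (ball (\<phi> p) R) \<Omega>. \<forall>q\<in>W. f q = F (\<phi> q))"
    using R(1) by blast
qed

lemma CH_plane_locally_CH: "locally_CH (top_of_set (ball z r)) \<Omega> (CH_plane (ball z r) \<Omega>)"
  unfolding locally_CH_def
proof
  fix p assume "p \<in> topspace (top_of_set (ball z r))"
  then obtain R where R: "R > 0" "ball p R \<subseteq> ball z r"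
    using openE[OF open_ball, of p z r] by auto
  show "\<exists>W R \<phi>. openin (top_of_set (ball z r)) W \<and> p \<in> W \<and> R > 0 \<and>
     continuous_map (subtopology (top_of_set (ball z r)) W) euclidean \<phi> \<and> \<phi> ` W \<subseteq> ball (\<phi> p) R \<and>
     (\<forall>f\<in>CH_plane (ball z r) \<Omega>. \<exists>F\<in>CH_plane (ball (\<phi> p) R) \<Omega>. \<forall>q\<in>W. f q = F (\<phi> q))"
    using R CH_plane_mono[OF _ R(2)]
    by (intro exI[of _ "ball p R"] exI[of _ R] exI[of _ id])
      (auto simp: openin_open_eq continuous_map_iff_continuous subtopology_subtopology)
qed

lemma second_countable_euclidean:
  "second_countable (euclidean :: 'a::second_countable_topology topology)"
proof -
  obtain B :: "'a set set" where B: "countable B" "topological_basis B"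
    using ex_countable_basis by blast
  have "\<exists>V\<in>B. x \<in> V \<and> V \<subseteq> U" if "open U" "x \<in> U" for U and x :: 'a
    using topological_basisE[OF B(2) that] by metis
  then show ?thesis
    unfolding second_countable_def open_openin[symmetric]
    using B(1) topological_basis_open[OF B(2)] by blast
qed

context convex_halfspace_domain
begin

theorem CH_surface_normal_family:
  assumes X: "open_riemann_surface X A"
  shows "normal_family X \<Omega> (CH_surface X A \<Omega>)"
proof (rule locally_CH_normal_family)
  show "locally_CH X \<Omega> (CH_surface X A \<Omega>)"
    using X CH_surface_locally_CH unfolding open_riemann_surface_def by blast
  show "connected_space X" "second_countable X"
    using X by (simp_all add: open_riemann_surface_def riemann_surface_def)
  show "topspace X \<noteq> {}"
  proof
    assume "topspace X = {}"
    then have "compact_space X"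
      by (simp add: compact_space_def)
    with X show False
      by (simp add: open_riemann_surface_def)
  qed
qed (simp add: CH_surface_def)

theorem taut_domain: "taut \<Omega>"
  unfolding taut_def
proof (rule locally_CH_normal_family)
  show "locally_CH (top_of_set unit_disc) \<Omega> (CH_plane unit_disc \<Omega>)"
    by (rule CH_plane_locally_CH)
  show "connected_space (top_of_set unit_disc)"
    by (simp add: connected_space_subtopology)
  show "second_countable (top_of_set unit_disc)"
    by (intro second_countable_subtopology second_countable_euclidean)
qed (auto simp: CH_plane_def)

end

text \<open>The surfaces in (ii) live on subsets of the type \<open>'m\<close>, so the complex plane
  has to be transported along an injection. Its image carries the pulled back topology and a single
  chart.\<close>

lemma complex_plane_copy:
  fixes j :: "complex \<Rightarrow> 'm"
  assumes j: "inj j"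
  defines "X \<equiv> pullback_topology (range j) (inv j) euclidean"
  shows "topspace X = range j" "open_riemann_surface X {(range j, inv j)}"
proof -
  show top: "topspace X = range j"
    by (simp add: X_def topspace_pullback_topology)
  have invj: "inv j (j z) = z" for z
    using j by simp
  have img: "inv j ` range j = UNIV"
    using j by (auto simp: image_image)
  have cont: "continuous_map X euclidean (inv j)"
    using continuous_map_pullback[of euclidean euclidean id "range j" "inv j"] by (simp add: X_def)
  have contj: "continuous_map euclidean X j"
    unfolding X_def
    by (rule continuous_map_pullback') (auto simp: o_def invj)
  have hom: "homeomorphic_maps X euclidean (inv j) j"
    using cont contj j top by (auto simp: homeomorphic_maps_def)
  then have hm: "homeomorphic_map X euclidean (inv j)"
    using homeomorphic_map_maps by blast
  then have hs: "X homeomorphic_space (euclidean :: complex topology)"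
    using homeomorphic_map_imp_homeomorphic_space by blast
  have "inv_into (range j) (inv j) z = j z" for z
    using inv_into_f_eq[of "inv j" "range j" "j z" z] invj by (auto simp: inj_on_def)
  then have hol: "(inv j \<circ> inv_into (range j) (inv j)) holomorphic_on UNIV"
    by (simp add: o_def invj)
  have "riemann_surface X {(range j, inv j)}"
    unfolding riemann_surface_def
    using hm top hol img homeomorphic_Hausdorff_space[OF hs] homeomorphic_space_second_countability[OF hs]
      second_countable_euclidean openin_topspace[of X]
    by (auto simp: subtopology_topspace[of X, unfolded top])
  moreover have "connected_space X"
    using homeomorphic_connected_space[OF hs] connectedin_topspace[of "euclidean :: complex topology"]
      connectedin_iff_connected[of "UNIV :: complex set"] connected_UNIV[where 'a = complex] by simp
  moreover have "\<not> compact_space X"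
    using homeomorphic_compact_space[OF hs] compact_imp_bounded not_bounded_UNIV[where 'a = complex]
    by (auto simp: compact_space_def)
  ultimately show "open_riemann_surface X {(range j, inv j)}"
    by (simp add: open_riemann_surface_def)
qed

text \<open>The maps z \<mapsto> x + k z into the plane all send 0 to \<open>x\<close>, so no
  subsequence diverges compactly, while their values at 1 are unbounded along every subsequence, so
  none converges.\<close>

lemma contains_plane_not_normal_family:
  fixes j :: "complex \<Rightarrow> 'm" and \<Omega> :: "'a::euclidean_space set"
  assumes j: "inj j" and plane: "contains_plane \<Omega>"
  defines "X \<equiv> pullback_topology (range j) (inv j) euclidean"
  shows "\<not> normal_family X \<Omega> (CH_surface X {(range j, inv j)} \<Omega>)"
proof
  assume normal: "normal_family X \<Omega> (CH_surface X {(range j, inv j)} \<Omega>)"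
  have top: "topspace X = range j"
    using complex_plane_copy(1)[OF j] by (simp add: X_def)
  have invj: "inv j (j z) = z" for z
    using j by simp
  have img: "inv j ` range j = UNIV"
    using j by (auto simp: image_image)
  have inv_into: "inv_into (range j) (inv j) z = j z" for z
    using inv_into_f_eq[of "inv j" "range j" "j z" z] invj by (auto simp: inj_on_def)
  obtain x e1 e2 where e: "norm e1 = 1" "norm e2 = 1" "e1 \<bullet> e2 = 0"
    and sub: "\<And>s t. x + s *\<^sub>R e1 + t *\<^sub>R e2 \<in> \<Omega>"
    using plane unfolding contains_plane_def by blast
  define F where "F k z = x + Re z *\<^sub>R (real k *\<^sub>R e1) + Im z *\<^sub>R (real k *\<^sub>R e2)" for k z
  define f where "f k m = F k (inv j m)" for k m
  have into: "F k z \<in> \<Omega>" for k z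
    using sub[of "Re z * real k" "Im z * real k"] by (simp add: F_def)
  have "F k \<in> CH_plane UNIV \<Omega>" for k
    unfolding F_def by (rule affine_conformal_CH_plane) (use e into[unfolded F_def] in auto)
  moreover have "f k \<circ> inv_into (range j) (inv j) = F k" for k
    by (simp add: f_def o_def inv_into invj)
  ultimately have "f k \<in> CH_surface X {(range j, inv j)} \<Omega>" for k
    using into by (auto simp: CH_surface_def CH_plane_def img f_def)
  then obtain r :: "nat \<Rightarrow> nat" where r: "strict_mono r"
    and alt: "(\<exists>g \<in> topspace X \<rightarrow> \<Omega>. \<forall>K. compactin X K \<longrightarrow> uniform_limit K (\<lambda>i. f (r i)) g sequentially) \<or>
            compactly_divergent X \<Omega> (\<lambda>i. f (r i))"
    using normal unfolding normal_family_def by (metis image_subsetI)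
  have comp: "compactin X {j z}" for z
    by (simp add: top)
  from alt show False
  proof
    assume "\<exists>g \<in> topspace X \<rightarrow> \<Omega>. \<forall>K. compactin X K \<longrightarrow> uniform_limit K (\<lambda>i. f (r i)) g sequentially"
    then obtain g where "uniform_limit {j 1} (\<lambda>i. f (r i)) g sequentially"
      using comp by blast
    then have "(\<lambda>i. f (r i) (j 1)) \<longlonglongrightarrow> g (j 1)"
      by (rule tendsto_uniform_limitI) simp
    then have "(\<lambda>i. (f (r i) (j 1) - x) \<bullet> e1) \<longlonglongrightarrow> (g (j 1) - x) \<bullet> e1"
      by (intro tendsto_intros)
    moreover have "(f (r i) (j 1) - x) \<bullet> e1 = real (r i)" for i
      using e(1) by (simp add: f_def F_def invj dot_square_norm)
    ultimately have "Bseq (\<lambda>i. real (r i))"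
      using convergent_imp_Bseq convergent_def by (metis (no_types, lifting) ext)
    then obtain B where B: "\<And>i. real (r i) \<le> B"
      by (auto simp: Bseq_def)
    obtain n :: nat where "real n > B"
      using reals_Archimedean2 by blast
    moreover have "n \<le> r n"
      using r by (rule strict_mono_imp_increasing)
    ultimately show False
      using B[of n] by simp
  next
    assume "compactly_divergent X \<Omega> (\<lambda>i. f (r i))"
    moreover have "x \<in> \<Omega>"
      using sub[of 0 0] by simp
    ultimately have "\<forall>\<^sub>F i in sequentially. f (r i) ` {j 0} \<inter> {x} = {}"
      using comp unfolding compactly_divergent_def by (meson compact_sing empty_subsetI insert_subset)
    then show False
      by (simp add: f_def F_def invj)
  qed
qed

(* The Riemann surfaces in (ii) have as underlying sets arbitrary subsets of a type 'm. The
   assumption on 'm only requires it to be large enough to carry the Riemann surfaces at all: by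
   second countability they have at most the cardinality of the continuum. *)

theorem theorem5p1:
  fixes \<Omega> :: "(real ^ 'n) set"
  assumes dim: "CARD('n) \<ge> 3"
    and domain: "\<Omega> \<noteq> {}" "open \<Omega>" "connected \<Omega>"
    and convex: "convex \<Omega>"
    and universe: "(UNIV :: complex set) \<lesssim> (UNIV :: 'm set)"
  defines "cond_i \<equiv> complete_hyperbolic \<Omega>"
    and "cond_ii \<equiv> (\<forall>(M :: 'm topology) A. open_riemann_surface M A \<longrightarrow>
                       normal_family M \<Omega> (CH_surface M A \<Omega>))"
    and "cond_iii \<equiv> hyperbolic \<Omega>"
    and "cond_iv \<equiv> \<not> (\<exists>S. affine S \<and> aff_dim S = 2 \<and> S \<subseteq> \<Omega>)"
    and "cond_v \<equiv> (\<exists>N. independent N \<and> card N = CARD('n) - 1 \<and>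
                      (\<forall>a\<in>N. \<exists>b. separating_hyperplane \<Omega> a b))"
  shows "(cond_i \<longleftrightarrow> cond_ii) \<and> (cond_ii \<longleftrightarrow> cond_iii) \<and> (cond_iii \<longleftrightarrow> cond_iv) \<and>
         (cond_iv \<longleftrightarrow> cond_v) \<and> (cond_ii \<longrightarrow> taut \<Omega>)"
proof -
  have iv: "cond_iv \<longleftrightarrow> \<not> contains_plane \<Omega>"
    by (simp add: cond_iv_def contains_plane_iff_affine)
  obtain j :: "complex \<Rightarrow> 'm" where j: "inj j"
    using universe by (auto simp: lepoll_def)
  \<comment> \<open>Condition (iv) is the hub: each of the others implies it, (i) by way of (iii),
    and it implies (i), (ii), (v) and tautness, hence also (iii).\<close>
  have "cond_i \<Longrightarrow> cond_iii"
    by (simp add: cond_i_def cond_iii_def complete_hyperbolic_def)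
  moreover have "cond_iii \<Longrightarrow> cond_iv"
    using contains_plane_not_hyperbolic iv cond_iii_def by blast
  moreover have "cond_ii \<Longrightarrow> cond_iv"
    using contains_plane_not_normal_family[OF j] complex_plane_copy(2)[OF j] iv cond_ii_def by blast
  moreover have "cond_v \<Longrightarrow> cond_iv"
    using separating_hyperplanes_imp_no_plane[of _ \<Omega>] iv unfolding cond_v_def by auto
  moreover have "cond_i \<and> cond_ii \<and> cond_v \<and> taut \<Omega>" if cond_iv
  proof -
    obtain N b where N: "independent N" "card N = DIM(real ^ 'n) - 1" "open_halfspaces_around \<Omega> N b"
      using no_plane_imp_halfspaces[OF domain(1,2) convex] \<open>cond_iv\<close> iv by blast
    interpret convex_halfspace_domain \<Omega> N b
      by unfold_locales (use domain convex N dim in auto)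
    have "separating_hyperplane \<Omega> a (b a)" if "a \<in> N" for a
    proof -
      have "a \<noteq> 0"
        using N(1) that dependent_zero by blast
      then show ?thesis
        using less_b[OF that] by (force simp: separating_hyperplane_def)
    qed
    then have cond_v
      unfolding cond_v_def using N(1,2) by auto
    moreover have cond_i cond_ii "taut \<Omega>"
      using complete_hyperbolic_domain CH_surface_normal_family taut_domain
      by (auto simp: cond_i_def cond_ii_def)
    ultimately show ?thesis
      by blast
  qed
  ultimately show ?thesis
    by blast
qed

end
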